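(* Let $(g_n)_{n\ge1}$ be a sequence of real drift coefficients, $(\sigma_n^2)_{n\ge1}$ ($\sigma_n>0$) a sequence of diffusion coefficients, and $(q_n^{\pm})_{n\ge1}$ a sequence of parameters of collision, that is, $q_{n+1}^+ + q_n^- = 1$ and $0<q_n^{\pm}<1$ for $n\ge1$. Suppose that $y=(y_n)_{n\ge1}\in\mathbb{R}^\infty$ satisfies $y_1\le y_2\le\dots$ and $$\sum_{n=1}^\infty e^{-\alpha y_n^2}<\infty\quad\text{for all }\alpha>0.$$ Assume that $\inf_{n\ge1}g_n>-\infty$, $\sup_{n\ge1}\sigma_n^2<\infty$, and that there exists $n_0\ge1$ such that $q_n^+\ge\frac12$ for all $n\ge n_0$. Take any i.i.d. standard Brownian motions $B_1,B_2,\dots$. Then there exists the approximative version of the infinite ranked system of competing Brownian particles with parameters $(g_n)_{n\ge1}$, $(\sigma_n^2)_{n\ge1}$, $(q_n^{\pm})_{n\ge1}$, starting from $y$, with driving Brownian motions $B_1,B_2,\dots$.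
   Context: The setting is a filtered probability space satisfying the usual conditions; Brownian motions are with respect to its filtration. Infinite ranked system of competing Brownian particles with drift coefficients $(g_k)$, diffusion coefficients $(\sigma_k^2)$, parameters of collision $(q_k^\pm)$ and driving Brownian motions $B_1,B_2,\dots$ (i.i.d. standard), starting from $y$: an $\mathbb{R}^\infty$-valued process $Y=(Y_k)_{k\ge1}$ with continuous adapted components, $Y(0)=y$, together with continuous adapted real-valued processes $L_{(k,k+1)}$, $k\ge1$ (and $L_{(0,1)}\equiv0$), such that: (i) $Y_1(t)\le Y_2(t)\le\dots$ for $t\ge0$; (ii) $Y_k(t)=Y_k(0)+g_kt+\sigma_kB_k(t)+q_k^+L_{(k-1,k)}(t)-q_k^-L_{(k,k+1)}(t)$ for $k\ge1$, $t\ge0$; (iii) each $L_{(k,k+1)}$ is nondecreasing, $L_{(k,k+1)}(0)=0$, and $\int_0^\infty(Y_{k+1}(t)-Y_k(t))\,dL_{(k,k+1)}(t)=0$. Finite ranked system of $N$ particles with parameters $(g_n)_{1\le n\le N}$, $(\sigma_n^2)_{1\le n\le N}$, $(q_n^\pm)_{1\le n\le N}$ and driving Brownian motions $B_1,\dots,B_N$: defined in the same way with $k=1,\dots,N$ and with $L_{(0,1)}\equiv L_{(N,N+1)}\equiv0$ (strong existence and pathwise uniqueness are known for it). Approximative version: for $N\ge2$ let $Y^{(N)}=(Y_1^{(N)},\dots,Y_N^{(N)})'$ be the finite ranked system with the first $N$ of the given parameters, driven by $B_1,\dots,B_N$, starting from $(y_1,\dots,y_N)$. If almost surely the limits $\lim_{N\to\infty}Y_k^{(N)}(t)=:Y_k(t)$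 exist, uniformly on every $[0,T]$, for every $k\ge1$, and $Y=(Y_k)_{k\ge1}$ is an infinite ranked system of competing Brownian particles with parameters $(g_n)_{n\ge1}$, $(\sigma_n^2)_{n\ge1}$, $(q_n^\pm)_{n\ge1}$ (with driving Brownian motions $B_1,B_2,\dots$, starting from $y$), then $Y$ is called the approximative version of this system. *)

theory Defs
  imports "HOL-Probability.Probability"
begin

text \<open>
  Time is the half-line \<open>[0, \<infinity>)\<close>, encoded as the nonnegative reals; nothing is assumed about
  filtrations or processes at negative times, whence the \<open>max 0 t\<close> below. Particles are indexed by
  \<open>1, 2, \<dots>\<close>; the value at index 0 of a parameter sequence is never used.
\<close>

definition usual_conditions :: "'a measure \<Rightarrow> (real \<Rightarrow> 'a measure) \<Rightarrow> bool" where
  "usual_conditions M F \<longleftrightarrow>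
     prob_space M \<and> complete_measure M \<and>
     filtration (space M) (\<lambda>t. F (max 0 t)) \<and>
     (\<forall>t\<ge>0. sets (F t) \<subseteq> sets M) \<and>
     null_sets M \<subseteq> sets (F 0) \<and>
     (\<forall>t\<ge>0. sets (F t) = (\<Inter>s\<in>{t<..}. sets (F s)))"

definition continuous_adapted ::
    "'a measure \<Rightarrow> (real \<Rightarrow> 'a measure) \<Rightarrow> (real \<Rightarrow> 'a \<Rightarrow> real) \<Rightarrow> bool" where
  "continuous_adapted M F X \<longleftrightarrow>
     (\<forall>t\<ge>0. X t \<in> borel_measurable (F t)) \<and>
     (\<forall>\<omega>\<in>space M. continuous_on {0..} (\<lambda>t. X t \<omega>))"

definition standard_brownian_motion ::
    "'a measure \<Rightarrow> (real \<Rightarrow> 'a measure) \<Rightarrow> (real \<Rightarrow> 'a \<Rightarrow> real) \<Rightarrow> bool" where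
  "standard_brownian_motion M F W \<longleftrightarrow>
     continuous_adapted M F W \<and>
     (AE \<omega> in M. W 0 \<omega> = 0) \<and>
     (\<forall>s t. 0 \<le> s \<and> s < t \<longrightarrow>
        distributed M lborel (\<lambda>\<omega>. W t \<omega> - W s \<omega>) (normal_density 0 (sqrt (t - s))) \<and>
        prob_space.indep_set M (sets (F s))
          (sets (vimage_algebra (space M) (\<lambda>\<omega>. W t \<omega> - W s \<omega>) borel)))"

text \<open>
  Independence is that of the whole processes, as random elements of the product space
  \<open>\<real>\<^bsup>[0,\<infinity>)\<^esup>\<close>. Standard Brownian motions are automatically identically distributed.
\<close>

definition iid_brownian_motions ::
    "'a measure \<Rightarrow> (real \<Rightarrow> 'a measure) \<Rightarrow> (nat \<Rightarrow> real \<Rightarrow> 'a \<Rightarrow> real) \<Rightarrow> bool" where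
  "iid_brownian_motions M F B \<longleftrightarrow>
     (\<forall>k\<ge>1. standard_brownian_motion M F (B k)) \<and>
     prob_space.indep_vars M (\<lambda>_. \<Pi>\<^sub>M t\<in>{0..}. borel)
       (\<lambda>k \<omega>. \<lambda>t\<in>{0..}. B k t \<omega>) {1..}"

text \<open>
  Finite and infinite systems differ only in the set \<open>I\<close> of particle indices, which is
  \<open>{1..N}\<close> or \<open>{1..}\<close>. The process \<open>L k\<close> is \<open>L\<^bsub>(k,k+1)\<^esub>\<close>; it vanishes identically unless both
  \<open>k\<close> and \<open>k + 1\<close> are particles, in particular for \<open>k = 0\<close> and, in the finite case, for \<open>k = N\<close>.

  The Stieltjes integral is a Lebesgue integral with values in \<open>[0, \<infinity>]\<close>, so that no integrability
  is presupposed; the integrand is nonnegative by the ordering of the particles. The integrator is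
  extended by the constant \<open>L k 0\<close> to negative times.
\<close>

definition ranked_system ::
    "'a measure \<Rightarrow> (real \<Rightarrow> 'a measure) \<Rightarrow> nat set \<Rightarrow>
     (nat \<Rightarrow> real) \<Rightarrow> (nat \<Rightarrow> real) \<Rightarrow> (nat \<Rightarrow> real) \<Rightarrow> (nat \<Rightarrow> real) \<Rightarrow>
     (nat \<Rightarrow> real \<Rightarrow> 'a \<Rightarrow> real) \<Rightarrow> (nat \<Rightarrow> real) \<Rightarrow>
     (nat \<Rightarrow> real \<Rightarrow> 'a \<Rightarrow> real) \<Rightarrow> (nat \<Rightarrow> real \<Rightarrow> 'a \<Rightarrow> real) \<Rightarrow> bool" where
  "ranked_system M F I g \<sigma> qp qm B y Y L \<longleftrightarrow>
     (\<forall>k\<in>I. continuous_adapted M F (Y k)) \<and>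
     (\<forall>k. continuous_adapted M F (L k)) \<and>
     (\<forall>k. \<not> (k \<in> I \<and> Suc k \<in> I) \<longrightarrow> (\<forall>t\<ge>0. \<forall>\<omega>\<in>space M. L k t \<omega> = 0)) \<and>
     (AE \<omega> in M.
        (\<forall>k\<in>I. Y k 0 \<omega> = y k) \<and>
        (\<forall>k\<in>I. \<forall>t\<ge>0. Y k t \<omega> = Y k 0 \<omega> + g k * t + \<sigma> k * B k t \<omega>
                           + qp k * L (k - 1) t \<omega> - qm k * L k t \<omega>) \<and>
        (\<forall>k. k \<in> I \<and> Suc k \<in> I \<longrightarrow>
           (\<forall>t\<ge>0. Y k t \<omega> \<le> Y (Suc k) t \<omega>) \<and>
           L k 0 \<omega> = 0 \<and>
           mono_on {0..} (\<lambda>t. L k t \<omega>) \<and>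
           (\<integral>\<^sup>+t\<in>{0..}. ennreal (Y (Suc k) t \<omega> - Y k t \<omega>)
              \<partial>interval_measure (\<lambda>t. L k (max 0 t) \<omega>)) = 0))"

abbreviation finite_ranked_system ::
    "'a measure \<Rightarrow> (real \<Rightarrow> 'a measure) \<Rightarrow> nat \<Rightarrow>
     (nat \<Rightarrow> real) \<Rightarrow> (nat \<Rightarrow> real) \<Rightarrow> (nat \<Rightarrow> real) \<Rightarrow> (nat \<Rightarrow> real) \<Rightarrow>
     (nat \<Rightarrow> real \<Rightarrow> 'a \<Rightarrow> real) \<Rightarrow> (nat \<Rightarrow> real) \<Rightarrow>
     (nat \<Rightarrow> real \<Rightarrow> 'a \<Rightarrow> real) \<Rightarrow> bool" where
  "finite_ranked_system M F N g \<sigma> qp qm B y Y \<equiv>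
     \<exists>L. ranked_system M F {1..N} g \<sigma> qp qm B y Y L"

abbreviation infinite_ranked_system ::
    "'a measure \<Rightarrow> (real \<Rightarrow> 'a measure) \<Rightarrow>
     (nat \<Rightarrow> real) \<Rightarrow> (nat \<Rightarrow> real) \<Rightarrow> (nat \<Rightarrow> real) \<Rightarrow> (nat \<Rightarrow> real) \<Rightarrow>
     (nat \<Rightarrow> real \<Rightarrow> 'a \<Rightarrow> real) \<Rightarrow> (nat \<Rightarrow> real) \<Rightarrow>
     (nat \<Rightarrow> real \<Rightarrow> 'a \<Rightarrow> real) \<Rightarrow> bool" where
  "infinite_ranked_system M F g \<sigma> qp qm B y Y \<equiv>
     \<exists>L. ranked_system M F {1..} g \<sigma> qp qm B y Y L"

text \<open>
  The finite systems \<open>YN N\<close> are determined up to indistinguishability (pathwise uniqueness), so the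
  existential quantifier refers to \<^emph>\<open>the\<close> system of \<open>N\<close> particles; that it exists is part of the
  claim that \<open>Y\<close> is the approximative version.
\<close>

definition approximative_version ::
    "'a measure \<Rightarrow> (real \<Rightarrow> 'a measure) \<Rightarrow>
     (nat \<Rightarrow> real) \<Rightarrow> (nat \<Rightarrow> real) \<Rightarrow> (nat \<Rightarrow> real) \<Rightarrow> (nat \<Rightarrow> real) \<Rightarrow>
     (nat \<Rightarrow> real \<Rightarrow> 'a \<Rightarrow> real) \<Rightarrow> (nat \<Rightarrow> real) \<Rightarrow>
     (nat \<Rightarrow> real \<Rightarrow> 'a \<Rightarrow> real) \<Rightarrow> bool" where
  "approximative_version M F g \<sigma> qp qm B y Y \<longleftrightarrow>
     (\<exists>YN. (\<forall>N\<ge>2. finite_ranked_system M F N g \<sigma> qp qm B y (YN N)) \<and>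
        (AE \<omega> in M. \<forall>k\<ge>1. \<forall>T\<ge>0.
           uniform_limit {0..T} (\<lambda>N t. YN N k t \<omega>) (\<lambda>t. Y k t \<omega>) sequentially)) \<and>
     infinite_ranked_system M F g \<sigma> qp qm B y Y"

end

theory Submission
  imports Defs
begin

text \<open>
  Path by path, the collision terms of \<open>N\<close> particles are the least fixed point of the monotone map
  \<open>L \<mapsto> (\<lambda>k t. sup\<^bsub>s \<le> t\<^esub> (W\<^sub>k - W\<^bsub>k+1\<^esub> + q\<^sub>k\<^sup>+ L\<^bsub>k-1\<^esub> + q\<^bsub>k+1\<^esub>\<^sup>- L\<^bsub>k+1\<^esub>)\<^sup>+)\<close>, where \<open>W\<^sub>k(t) = y\<^sub>k + g\<^sub>k t + \<sigma>\<^sub>k B\<^sub>k(t)\<close>.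
  It increases with \<open>N\<close>, so only finiteness and continuity of the limit are at stake.

  Both follow from a bound, uniform in \<open>N\<close>, on the supremum over \<open>[0, T]\<close> of the total cost
  \<open>\<Sum>\<^sub>k w\<^sub>k \<phi>(Y\<^sub>k)\<close> with \<open>\<phi>(x) = (a - x)\<^sup>+\<close>. On a time grid the reflection does not increase such a cost for
  convex decreasing \<open>\<phi>\<close>, provided \<open>w\<^sub>k q\<^sub>k\<^sup>- \<le> w\<^bsub>k+1\<^esub> q\<^bsub>k+1\<^esub>\<^sup>+\<close>; bounded weights of this kind exist
  because \<open>q\<^sub>n\<^sup>+ \<ge> 1/2\<close> eventually. Letting \<open>\<phi>\<close> evolve backwards by Gaussian smoothing turns the total cost
  into a supermartingale, its initial value is finite by the summability of \<open>exp (- \<alpha> y\<^sub>n\<^sup>2)\<close>,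
  and Doob's maximal inequality gives the bound.

  The cost of the first particle bounds the collision terms. If the limit jumped, infinitely many
  particles would coalesce in one point, which has infinite cost for large \<open>a\<close>.
\<close>

text \<open>Paths and probability meet in one predicate on a single path, \<open>controlled\<close>.
  The probabilistic bound holds for each particle number and each mesh separately, and only with
  probability close to 1, so on a given path it is kept merely for infinitely many \<open>N\<close>;
  that suffices because collision terms increase with \<open>N\<close>.

  The grid serves the cost argument: one step is a free Gaussian move followed by a reflection, and
  two particles that are pushed during a step are exactly tied at its end, so convexity applies
  without any calculus for local times. Suprema over a grid are also countable, hence measurable.
  The basic path lemmas therefore take the set \<open>G\<close> of admissible times as a parameter.

  The fixed point map is monotone but in general no contraction, since
  \<open>qp k + qm (Suc k)\<close> may exceed 1. Deterministic estimates are comparisons with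
  supersolutions instead, and \<open>barrier\<close> provides a strict one.

  The weights must be bounded, to keep the initial cost finite uniformly in \<open>N\<close>, and at
  least 1, to dominate the unweighted cost.\<close>

definition locally_bounded :: "(real \<Rightarrow> real) \<Rightarrow> bool" where
  "locally_bounded f \<longleftrightarrow> (\<forall>T. \<exists>C. \<forall>s\<in>{0..T}. \<bar>f s\<bar> \<le> C)"

lemma locally_bounded_add:
  "locally_bounded f \<Longrightarrow> locally_bounded g \<Longrightarrow> locally_bounded (\<lambda>s. f s + g s)"
  unfolding locally_bounded_def
proof
  fix T assume f: "\<forall>T. \<exists>C. \<forall>s\<in>{0..T}. \<bar>f s\<bar> \<le> C" and g: "\<forall>T. \<exists>C. \<forall>s\<in>{0..T}. \<bar>g s\<bar> \<le> C"
  obtain C D where "\<forall>s\<in>{0..T}. \<bar>f s\<bar> \<le> C" "\<forall>s\<in>{0..T}. \<bar>g s\<bar> \<le> D" using f g by metis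
  then have "\<forall>s\<in>{0..T}. \<bar>f s + g s\<bar> \<le> C + D" by (auto intro: order_trans[OF abs_triangle_ineq] add_mono)
  then show "\<exists>C. \<forall>s\<in>{0..T}. \<bar>f s + g s\<bar> \<le> C" by blast
qed

lemma locally_bounded_cmult:
  "locally_bounded f \<Longrightarrow> locally_bounded (\<lambda>s. c * f s)"
  unfolding locally_bounded_def
proof
  fix T assume f: "\<forall>T. \<exists>C. \<forall>s\<in>{0..T}. \<bar>f s\<bar> \<le> C"
  obtain C where "\<forall>s\<in>{0..T}. \<bar>f s\<bar> \<le> C" using f by metis
  then have "\<forall>s\<in>{0..T}. \<bar>c * f s\<bar> \<le> \<bar>c\<bar> * C" by (auto simp: abs_mult intro: mult_left_mono)
  then show "\<exists>C. \<forall>s\<in>{0..T}. \<bar>c * f s\<bar> \<le> C" by blast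
qed

lemma locally_bounded_diff:
  "locally_bounded f \<Longrightarrow> locally_bounded g \<Longrightarrow> locally_bounded (\<lambda>s. f s - g s)"
  using locally_bounded_add[of f "\<lambda>s. (-1) * g s"] locally_bounded_cmult[of g "-1"] by simp

lemma locally_bounded_mono:
  assumes "mono_on {0..} f" "\<And>t. t \<ge> 0 \<Longrightarrow> f t \<ge> 0"
  shows "locally_bounded f"
  unfolding locally_bounded_def
proof
  fix T
  have "\<forall>s\<in>{0..T}. \<bar>f s\<bar> \<le> f T" using assms by (auto simp: mono_on_def)
  then show "\<exists>C. \<forall>s\<in>{0..T}. \<bar>f s\<bar> \<le> C" by blast
qed

lemma locally_bounded_continuous:
  assumes "continuous_on {0..} f" shows "locally_bounded f"
  unfolding locally_bounded_def
proof
  fix T :: real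
  have "continuous_on {0..T} f" using assms by (rule continuous_on_subset) auto
  then have "bounded (f ` {0..T})" by (intro compact_imp_bounded compact_continuous_image) auto
  then show "\<exists>C. \<forall>s\<in>{0..T}. \<bar>f s\<bar> \<le> C" by (auto simp: bounded_iff)
qed

section \<open>Running suprema over a set of times\<close>

definition running_sup :: "real set \<Rightarrow> (real \<Rightarrow> real) \<Rightarrow> real \<Rightarrow> real" where
  "running_sup G X t = (SUP s\<in>G \<inter> {0..t}. max 0 (X s))"

context
  fixes G :: "real set"
  assumes zero_in: "0 \<in> G"
begin

lemma running_sup_bdd:
  assumes "locally_bounded X" shows "bdd_above ((\<lambda>s. max 0 (X s)) ` (G \<inter> {0..t}))"
proof -
  obtain C where "\<forall>s\<in>{0..t}. \<bar>X s\<bar> \<le> C" using assms unfolding locally_bounded_def by blast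
  then show ?thesis by (intro bdd_aboveI[of _ "max 0 C"]) force
qed

lemma running_sup_upper:
  assumes "locally_bounded X" "s \<in> G" "0 \<le> s" "s \<le> t"
  shows "max 0 (X s) \<le> running_sup G X t"
  unfolding running_sup_def using assms by (intro cSUP_upper running_sup_bdd) auto

lemma running_sup_least:
  assumes "t \<ge> 0" "\<And>s. s \<in> G \<Longrightarrow> 0 \<le> s \<Longrightarrow> s \<le> t \<Longrightarrow> X s \<le> C" "0 \<le> C"
  shows "running_sup G X t \<le> C"
  unfolding running_sup_def
proof (rule cSUP_least)
  show "G \<inter> {0..t} \<noteq> {}" using zero_in assms(1) by auto
qed (use assms in auto)

lemma running_sup_nonneg:
  assumes "locally_bounded X" "t \<ge> 0" shows "0 \<le> running_sup G X t"
  using running_sup_upper[OF assms(1) zero_in order_refl assms(2)] by linarith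

lemma running_sup_mono_time:
  assumes "locally_bounded X" "0 \<le> s" "s \<le> t" shows "running_sup G X s \<le> running_sup G X t"
proof (rule running_sup_least)
  fix r assume "r \<in> G" "0 \<le> r" "r \<le> s"
  then show "X r \<le> running_sup G X t" using running_sup_upper[OF assms(1), of r t] assms(3) by linarith
qed (use running_sup_nonneg[OF assms(1)] assms in auto)

lemma running_sup_locally_bounded:
  assumes "locally_bounded X" shows "locally_bounded (running_sup G X)"
  using running_sup_mono_time[OF assms] running_sup_nonneg[OF assms]
  by (intro locally_bounded_mono) (auto simp: mono_on_def)

text \<open>Two suprema are exchanged: a time that nearly attains the supremum of \<open>Y\<close>
  is nearly attained by \<open>X n\<close> for large \<open>n\<close>, and \<open>X n\<close> stays
  below \<open>Y\<close>. Monotonicity in \<open>n\<close> replaces any uniformity of the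
  convergence.\<close>

lemma running_sup_tendsto:
  assumes "t \<ge> 0" and lb: "\<And>n. locally_bounded (X n)" and lbY: "locally_bounded Y"
    and lim: "\<And>s. s \<ge> 0 \<Longrightarrow> (\<lambda>n. X n s) \<longlonglongrightarrow> Y s"
    and inc: "\<And>n s. s \<ge> 0 \<Longrightarrow> X n s \<le> X (Suc n) s"
  shows "(\<lambda>n. running_sup G (X n) t) \<longlonglongrightarrow> running_sup G Y t"
proof (rule LIMSEQ_I)
  fix e :: real assume "e > 0"
  have XY: "X n s \<le> Y s" if "s \<ge> 0" for n s
    using inc[OF that] by (intro incseq_le[OF _ lim[OF that]] incseq_SucI)
  have up: "running_sup G (X n) t \<le> running_sup G Y t" for n
  proof (rule running_sup_least[OF assms(1)])
    fix s assume "s \<in> G" "0 \<le> s" "s \<le> t"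
    then show "X n s \<le> running_sup G Y t"
      using XY[of s n] running_sup_upper[OF lbY, of s t] by linarith
  qed (rule running_sup_nonneg[OF lbY assms(1)])
  have ne: "G \<inter> {0..t} \<noteq> {}" using zero_in assms(1) by auto
  have "running_sup G Y t - e / 2 < (SUP s\<in>G \<inter> {0..t}. max 0 (Y s))"
    using \<open>e > 0\<close> by (simp add: running_sup_def)
  then obtain s where s: "s \<in> G" "0 \<le> s" "s \<le> t" "running_sup G Y t - e / 2 < max 0 (Y s)"
    using less_cSUP_iff[OF ne running_sup_bdd[OF lbY, of t]] by auto
  have "(\<lambda>n. max 0 (X n s)) \<longlonglongrightarrow> max 0 (Y s)" by (intro tendsto_intros lim s)
  then have "\<forall>\<^sub>F n in sequentially. max 0 (X n s) > max 0 (Y s) - e / 2"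
    by (rule order_tendstoD) (use \<open>e > 0\<close> in simp)
  then obtain n0 where n0: "\<And>n. n \<ge> n0 \<Longrightarrow> max 0 (X n s) > max 0 (Y s) - e / 2"
    by (auto simp: eventually_sequentially)
  have "norm (running_sup G (X n) t - running_sup G Y t) < e" if "n \<ge> n0" for n
    using n0[OF that] s(4) up[of n] running_sup_upper[OF lb s(1-3), of n] by auto
  then show "\<exists>n0. \<forall>n\<ge>n0. norm (running_sup G (X n) t - running_sup G Y t) < e" by blast
qed

end

section \<open>Finite reflection problem as a least fixed point\<close>

locale collision =
  fixes qp qm :: "nat \<Rightarrow> real"
  assumes q_sum: "\<And>n. n \<ge> 1 \<Longrightarrow> qp (Suc n) + qm n = 1"
    and q_pos: "\<And>n. n \<ge> 1 \<Longrightarrow> 0 < qp n" "\<And>n. n \<ge> 1 \<Longrightarrow> 0 < qm n"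
begin

text \<open>The recursion solves \<open>qp k * v (k - 1) - qm k * v k = - (N - k)\<close>: constant collision terms \<open>v\<close>
  that move particle \<open>k\<close> down by \<open>N - k\<close> and so widen every gap by exactly 1.\<close>

primrec barrier :: "nat \<Rightarrow> nat \<Rightarrow> real" where
  "barrier N 0 = 0"
| "barrier N (Suc k) = (qp (Suc k) * barrier N k + (real N - real (Suc k))) / qm (Suc k)"

lemma barrier_nonneg: "k \<le> N \<Longrightarrow> 0 \<le> barrier N k"
  by (induction k) (use q_pos in \<open>auto intro!: divide_nonneg_pos add_nonneg_nonneg mult_nonneg_nonneg simp: less_imp_le\<close>)

lemma barrier_pos: "1 \<le> k \<Longrightarrow> k < N \<Longrightarrow> 0 < barrier N k"
proof (cases k)
  case (Suc j)
  assume "1 \<le> k" "k < N"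
  then have "0 \<le> barrier N j" "0 < qp k" "0 < qm k" "0 < real N - real k"
    using barrier_nonneg[of j N] q_pos[of k] Suc by auto
  then show ?thesis by (auto simp: Suc intro!: divide_pos_pos add_nonneg_pos)
qed simp

text \<open>Follows by adding the recursions at \<open>k\<close> and \<open>Suc k\<close> and using
  \<open>q_sum\<close>. It makes \<open>barrier N\<close> a supersolution of the homogeneous map
  with margin 1, so \<open>a * barrier N\<close> absorbs every perturbation of the driving gaps of
  size \<open>a\<close>.\<close>

lemma barrier_eq:
  assumes "1 \<le> k" "k < N"
  shows "barrier N k = 1 + qp k * barrier N (k - 1) + qm (Suc k) * barrier N (Suc k)"
proof -
  obtain j where k: "k = Suc j" using assms by (cases k) auto
  have 1: "qm k * barrier N k = qp k * barrier N j + (real N - real k)"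
    using q_pos[of k] by (simp add: k)
  have 2: "qm (Suc k) * barrier N (Suc k) = qp (Suc k) * barrier N k + (real N - real (Suc k))"
    using q_pos[of "Suc k"] by simp
  have 3: "barrier N k = qp (Suc k) * barrier N k + qm k * barrier N k"
    using q_sum[of k] assms by (metis distrib_right mult_1)
  have "barrier N k = 1 + qp k * barrier N j + qm (Suc k) * barrier N (Suc k)"
    using 1 2 3 by linarith
  then show ?thesis by (simp add: k del: barrier.simps)
qed

definition push :: "(nat \<Rightarrow> real \<Rightarrow> real) \<Rightarrow> (nat \<Rightarrow> real \<Rightarrow> real) \<Rightarrow> nat \<Rightarrow> real \<Rightarrow> real" where
  "push W L k s = W k s - W (Suc k) s + qp k * L (k - 1) s + qm (Suc k) * L (Suc k) s"

definition reflect :: "real set \<Rightarrow> nat \<Rightarrow> (nat \<Rightarrow> real \<Rightarrow> real) \<Rightarrow> (nat \<Rightarrow> real \<Rightarrow> real) \<Rightarrow> nat \<Rightarrow> real \<Rightarrow> real" where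
  "reflect G N W L k t = (if 1 \<le> k \<and> k < N then running_sup G (push W L k) t else 0)"

text \<open>Iteration from 0, the least candidate, so that monotonicity alone yields convergence to
  the least fixed point once an upper bound is known.\<close>

primrec picard :: "real set \<Rightarrow> nat \<Rightarrow> (nat \<Rightarrow> real \<Rightarrow> real) \<Rightarrow> nat \<Rightarrow> nat \<Rightarrow> real \<Rightarrow> real" where
  "picard G N W 0 = (\<lambda>k t. 0)"
| "picard G N W (Suc n) = reflect G N W (picard G N W n)"

definition skorokhod :: "real set \<Rightarrow> nat \<Rightarrow> (nat \<Rightarrow> real \<Rightarrow> real) \<Rightarrow> nat \<Rightarrow> real \<Rightarrow> real" where
  "skorokhod G N W k t = (SUP n. picard G N W n k t)"

definition ranked :: "(nat \<Rightarrow> real \<Rightarrow> real) \<Rightarrow> (nat \<Rightarrow> real \<Rightarrow> real) \<Rightarrow> nat \<Rightarrow> real \<Rightarrow> real" where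
  "ranked W L k t = W k t + qp k * L (k - 1) t - qm k * L k t"

text \<open>By \<open>q_sum\<close> the term \<open>L k\<close> enters the gap with total
  coefficient 1. Ordering thus means \<open>L k\<close> lies above \<open>push\<close>, and a
  collision means equality: each gap is a one-dimensional reflection problem given its
  neighbours.\<close>

lemma ranked_gap:
  "k \<ge> 1 \<Longrightarrow> ranked W L (Suc k) t - ranked W L k t = L k t - push W L k t"
  using q_sum[of k] unfolding ranked_def push_def
  by (simp add: algebra_simps) (metis distrib_left mult.commute mult_1 add.commute)

lemma push_mono:
  assumes "1 \<le> k" "L (k - 1) s \<le> L' (k - 1) s" "L (Suc k) s \<le> L' (Suc k) s"
  shows "push W L k s \<le> push W L' k s"
  unfolding push_def using assms q_pos[of k] q_pos[of "Suc k"]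
  by (intro add_mono mult_left_mono) auto

lemma push_locally_bounded:
  assumes "\<And>k. locally_bounded (W k)" "\<And>k. locally_bounded (L k)"
  shows "locally_bounded (push W L k)"
  unfolding push_def[abs_def]
  by (intro locally_bounded_add locally_bounded_diff locally_bounded_cmult assms)

context
  fixes G :: "real set" and N :: nat and W :: "nat \<Rightarrow> real \<Rightarrow> real"
  assumes zero_in: "0 \<in> G" and W_bdd: "\<And>k. locally_bounded (W k)"
begin

lemma picard_locally_bounded: "locally_bounded (picard G N W n k)"
proof (induction n arbitrary: k)
  case 0
  then show ?case by (auto simp: locally_bounded_def)
next
  case (Suc n)
  have "locally_bounded (push W (picard G N W n) k)"
    by (intro push_locally_bounded W_bdd Suc)
  from running_sup_locally_bounded[OF zero_in this] show ?case
    by (cases "1 \<le> k \<and> k < N") (auto simp: reflect_def[abs_def] locally_bounded_def)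
qed

lemma picard_push_bounded: "locally_bounded (push W (picard G N W n) k)"
  by (intro push_locally_bounded W_bdd picard_locally_bounded)

lemma picard_outside: "\<not> (1 \<le> k \<and> k < N) \<Longrightarrow> picard G N W n k t = 0"
  by (cases n) (auto simp: reflect_def)

lemma picard_nonneg: "t \<ge> 0 \<Longrightarrow> 0 \<le> picard G N W n k t"
  by (cases n) (auto simp: reflect_def intro!: running_sup_nonneg zero_in picard_push_bounded)

lemma picard_mono_time: "0 \<le> s \<Longrightarrow> s \<le> t \<Longrightarrow> picard G N W n k s \<le> picard G N W n k t"
  by (cases n) (auto simp: reflect_def intro!: running_sup_mono_time zero_in picard_push_bounded)

lemma picard_Suc_upper:
  "1 \<le> k \<Longrightarrow> k < N \<Longrightarrow> s \<in> G \<Longrightarrow> 0 \<le> s \<Longrightarrow> s \<le> t \<Longrightarrow>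
    push W (picard G N W n) k s \<le> picard G N W (Suc n) k t"
  using running_sup_upper[OF zero_in picard_push_bounded, of s t n k] by (simp add: reflect_def)

text \<open>Comparison principle, by induction on \<open>n\<close> and monotonicity of
  \<open>push\<close>. The predicate \<open>P\<close> cuts off the time horizon, because the
  supersolutions in use have the required property only up to a fixed time.\<close>

lemma picard_le_supersolution:
  assumes "P 0"
    and V0: "\<And>k t. P t \<Longrightarrow> 0 \<le> t \<Longrightarrow> k \<le> N \<Longrightarrow> 0 \<le> V k t"
    and P: "\<And>s t. P t \<Longrightarrow> 0 \<le> s \<Longrightarrow> s \<le> t \<Longrightarrow> P s"
    and V: "\<And>k s t. 1 \<le> k \<Longrightarrow> k < N \<Longrightarrow> s \<in> G \<Longrightarrow> 0 \<le> s \<Longrightarrow> s \<le> t \<Longrightarrow> P t \<Longrightarrow> push W V k s \<le> V k t"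
    and "P t" "0 \<le> t" "k \<le> N"
  shows "picard G N W n k t \<le> V k t"
  using \<open>P t\<close> \<open>0 \<le> t\<close> \<open>k \<le> N\<close>
proof (induction n arbitrary: k t)
  case 0
  then show ?case using V0 by auto
next
  case (Suc n)
  show ?case
  proof (cases "1 \<le> k \<and> k < N")
    case True
    have "running_sup G (push W (picard G N W n) k) t \<le> V k t"
    proof (rule running_sup_least[OF zero_in])
      fix s assume s: "s \<in> G" "0 \<le> s" "s \<le> t"
      have "push W (picard G N W n) k s \<le> push W V k s"
        using True Suc s P by (intro push_mono Suc.IH) auto
      also have "\<dots> \<le> V k t" using V True s Suc by auto
      finally show "push W (picard G N W n) k s \<le> V k t" .
    qed (use Suc V0 in auto)
    then show ?thesis using True by (simp add: reflect_def)
  next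
    case False
    then show ?thesis using Suc V0 by (auto simp: reflect_def)
  qed
qed

lemma picard_incseq: "t \<ge> 0 \<Longrightarrow> picard G N W n k t \<le> picard G N W (Suc n) k t"
proof (induction n arbitrary: k t)
  case 0
  show ?case using picard_nonneg[OF 0, of 1] by simp
next
  case (Suc n)
  show ?case
  proof (cases "1 \<le> k \<and> k < N")
    case True
    have "running_sup G (push W (picard G N W n) k) t \<le> picard G N W (Suc (Suc n)) k t"
    proof (rule running_sup_least[OF zero_in Suc.prems])
      fix s assume s: "s \<in> G" "0 \<le> s" "s \<le> t"
      have "push W (picard G N W n) k s \<le> push W (picard G N W (Suc n)) k s"
        using True s by (intro push_mono Suc.IH) auto
      also have "\<dots> \<le> picard G N W (Suc (Suc n)) k t" using True s by (intro picard_Suc_upper) auto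
      finally show "push W (picard G N W n) k s \<le> picard G N W (Suc (Suc n)) k t" .
    qed (use Suc picard_nonneg in blast)
    then show ?thesis using True by (simp add: reflect_def)
  qed (auto simp: reflect_def)
qed

lemma picard_bounded:
  assumes "T \<ge> 0" shows "\<exists>C. \<forall>n k. \<forall>t\<in>{0..T}. k \<le> N \<longrightarrow> picard G N W n k t \<le> C"
proof -
  have "\<exists>C. \<forall>s\<in>{0..T}. \<bar>W k s - W (Suc k) s\<bar> \<le> C" for k
    using locally_bounded_diff[OF W_bdd W_bdd, of k "Suc k"] unfolding locally_bounded_def by blast
  then obtain c where c: "\<And>k s. 0 \<le> s \<Longrightarrow> s \<le> T \<Longrightarrow> \<bar>W k s - W (Suc k) s\<bar> \<le> c k" by (metis atLeastAtMost_iff)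
  define D where "D = (\<Sum>k\<le>N. c k)"
  have c0: "0 \<le> c k" for k using c[of 0 k] assms by auto
  have D: "c k \<le> D" if "k \<le> N" for k
    unfolding D_def using that c0 by (intro member_le_sum) auto
  have D0: "0 \<le> D" unfolding D_def using c0 by (intro sum_nonneg) auto
  \<comment> \<open>A supersolution that is constant in time: \<open>D\<close> dominates all driving
    gaps up to \<open>T\<close>, and the margin 1 of the barrier, multiplied by \<open>D\<close>,
    covers them.\<close>
  have "picard G N W n k t \<le> D * barrier N k" if "0 \<le> t" "t \<le> T" "k \<le> N" for n k t
  proof (rule picard_le_supersolution[where P = "\<lambda>t. t \<le> T" and V = "\<lambda>k t. D * barrier N k"])
    fix k and s t :: real assume k: "1 \<le> k" "k < N" "0 \<le> s" "s \<le> t" "t \<le> T"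
    have "push W (\<lambda>k t. D * barrier N k) k s
        \<le> D + qp k * (D * barrier N (k - 1)) + qm (Suc k) * (D * barrier N (Suc k))"
      using c[of s k] D[of k] k unfolding push_def by auto
    also have "\<dots> = D * (1 + qp k * barrier N (k - 1) + qm (Suc k) * barrier N (Suc k))"
      by (simp add: algebra_simps)
    also have "\<dots> = D * barrier N k" using barrier_eq[OF k(1,2)] by simp
    finally show "push W (\<lambda>k t. D * barrier N k) k s \<le> D * barrier N k" .
  qed (use that assms D0 barrier_nonneg in auto)
  moreover have "D * barrier N k \<le> (\<Sum>k\<le>N. D * barrier N k)" if "k \<le> N" for k
    using that D0 barrier_nonneg by (intro member_le_sum) auto
  ultimately have "picard G N W n k t \<le> (\<Sum>k\<le>N. D * barrier N k)" if "0 \<le> t" "t \<le> T" "k \<le> N" for n k t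
    using that order_trans by blast
  then show ?thesis by (intro exI[of _ "\<Sum>k\<le>N. D * barrier N k"]) auto
qed

lemma picard_tendsto:
  assumes "t \<ge> 0" shows "(\<lambda>n. picard G N W n k t) \<longlonglongrightarrow> skorokhod G N W k t"
  unfolding skorokhod_def
proof (rule LIMSEQ_incseq_SUP)
  show "bdd_above (range (\<lambda>n. picard G N W n k t))"
  proof (cases "k \<le> N")
    case True
    obtain C where "\<forall>n k. \<forall>t\<in>{0..t}. k \<le> N \<longrightarrow> picard G N W n k t \<le> C"
      using picard_bounded[OF assms] by blast
    then show ?thesis using True assms by (intro bdd_aboveI2[where M = C]) auto
  qed (auto simp: picard_outside)
  show "incseq (\<lambda>n. picard G N W n k t)" using picard_incseq[OF assms] by (intro incseq_SucI)
qed

lemma picard_le_skorokhod: "t \<ge> 0 \<Longrightarrow> picard G N W n k t \<le> skorokhod G N W k t"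
  using picard_incseq by (intro incseq_le[OF _ picard_tendsto] incseq_SucI) auto

lemma skorokhod_le:
  "t \<ge> 0 \<Longrightarrow> (\<And>n. picard G N W n k t \<le> C) \<Longrightarrow> skorokhod G N W k t \<le> C"
  using picard_tendsto by (rule LIMSEQ_le_const2) auto

lemma skorokhod_nonneg: "t \<ge> 0 \<Longrightarrow> 0 \<le> skorokhod G N W k t"
  using picard_le_skorokhod[of t 0 k] by simp

lemma skorokhod_mono_time: "0 \<le> s \<Longrightarrow> s \<le> t \<Longrightarrow> skorokhod G N W k s \<le> skorokhod G N W k t"
  by (rule LIMSEQ_le[OF picard_tendsto picard_tendsto]) (auto intro: picard_mono_time)

lemma skorokhod_outside: "\<not> (1 \<le> k \<and> k < N) \<Longrightarrow> skorokhod G N W k t = 0"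
  unfolding skorokhod_def using picard_outside by simp

lemma skorokhod_locally_bounded: "locally_bounded (skorokhod G N W k)"
  using skorokhod_mono_time skorokhod_nonneg by (intro locally_bounded_mono) (auto simp: mono_on_def)

lemma skorokhod_push_bounded: "locally_bounded (push W (skorokhod G N W) k)"
  by (intro push_locally_bounded W_bdd skorokhod_locally_bounded)

lemma skorokhod_fixpoint:
  assumes "t \<ge> 0" "1 \<le> k" "k < N"
  shows "skorokhod G N W k t = running_sup G (push W (skorokhod G N W) k) t"
proof (rule LIMSEQ_unique)
  show "(\<lambda>n. picard G N W (Suc n) k t) \<longlonglongrightarrow> skorokhod G N W k t"
    by (rule LIMSEQ_Suc[OF picard_tendsto[OF assms(1)]])
  have "(\<lambda>n. running_sup G (push W (picard G N W n) k) t)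
      \<longlonglongrightarrow> running_sup G (push W (skorokhod G N W) k) t"
  proof (rule running_sup_tendsto[OF zero_in assms(1)])
    show "(\<lambda>n. push W (picard G N W n) k s) \<longlonglongrightarrow> push W (skorokhod G N W) k s" if "s \<ge> 0" for s
      unfolding push_def by (intro tendsto_intros picard_tendsto that)
  qed (use assms picard_incseq in \<open>auto intro!: picard_push_bounded skorokhod_push_bounded push_mono\<close>)
  then show "(\<lambda>n. picard G N W (Suc n) k t) \<longlonglongrightarrow> running_sup G (push W (skorokhod G N W) k) t"
    using assms by (simp add: reflect_def)
qed

lemma skorokhod_push_le:
  "1 \<le> k \<Longrightarrow> k < N \<Longrightarrow> s \<in> G \<Longrightarrow> 0 \<le> s \<Longrightarrow> s \<le> t \<Longrightarrow>
    push W (skorokhod G N W) k s \<le> skorokhod G N W k t"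
  using running_sup_upper[OF zero_in skorokhod_push_bounded, of s t k] skorokhod_fixpoint[of t k] by simp

end

end

text \<open>Were the supremum to grow, its value at \<open>q\<close> would be attained at the
  maximiser \<open>r\<close> of \<open>X\<close> on the interval, contradicting that
  \<open>X r\<close> lies strictly below the supremum at \<open>r\<close>. This is the source of
  complementarity in continuous time.\<close>

lemma running_sup_flat:
  assumes cont: "continuous_on {0..} X" and "0 \<le> p" "p \<le> q"
    and less: "\<And>s. p \<le> s \<Longrightarrow> s \<le> q \<Longrightarrow> X s < running_sup {0..} X s"
  shows "running_sup {0..} X q = running_sup {0..} X p"
proof (rule ccontr)
  assume neq: "\<not> ?thesis"
  note lb = locally_bounded_continuous[OF cont]
  have zero_in: "(0::real) \<in> {0..}" by simp
  have lt: "running_sup {0..} X p < running_sup {0..} X q"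
    using neq running_sup_mono_time[OF zero_in lb assms(2,3)] by linarith
  have "continuous_on {p..q} X" using cont by (rule continuous_on_subset) (use assms in auto)
  then obtain r where r: "p \<le> r" "r \<le> q" "\<And>s. p \<le> s \<Longrightarrow> s \<le> q \<Longrightarrow> X s \<le> X r"
    using continuous_attains_sup[of "{p..q}" X] assms by auto
  have "running_sup {0..} X q \<le> max (running_sup {0..} X p) (X r)"
  proof (rule running_sup_least[OF zero_in])
    fix s assume s: "s \<in> {0::real..}" "0 \<le> s" "s \<le> q"
    show "X s \<le> max (running_sup {0..} X p) (X r)"
    proof (cases "s \<le> p")
      case True
      then show ?thesis using running_sup_upper[OF zero_in lb s(1,2) True] by linarith
    qed (use r(3)[of s] s in auto)
  qed (use running_sup_nonneg[OF zero_in lb assms(2)] assms in auto)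
  moreover have "X r < running_sup {0..} X r" using less r by auto
  moreover have "running_sup {0..} X r \<le> running_sup {0..} X q"
    using running_sup_mono_time[OF zero_in lb] r assms by auto
  ultimately show False using lt by linarith
qed

section \<open>Time grids\<close>

definition grid :: "real \<Rightarrow> real set" where
  "grid h = range (\<lambda>i::nat. real i * h)"

lemma zero_in_grid: "0 \<in> grid h"
  unfolding grid_def by (rule range_eqI[of _ _ 0]) simp

text \<open>Growth over one grid step can only come from the new grid point. For the collision terms
  this says that a pair pushed during the step has gap exactly 0 at its end.\<close>

lemma running_sup_grid_step:
  assumes "h > 0" and lb: "locally_bounded X"
    and less: "running_sup (grid h) X (real i * h) < running_sup (grid h) X (real (Suc i) * h)"
  shows "running_sup (grid h) X (real (Suc i) * h) = X (real (Suc i) * h)"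
proof -
  let ?L = "running_sup (grid h) X"
  have nn: "0 \<le> ?L (real i * h)"
    using assms by (intro running_sup_nonneg zero_in_grid) auto
  have "?L (real (Suc i) * h) \<le> max (?L (real i * h)) (X (real (Suc i) * h))"
  proof (rule running_sup_least[OF zero_in_grid])
    fix s assume s: "s \<in> grid h" "0 \<le> s" "s \<le> real (Suc i) * h"
    then obtain j where j: "s = real j * h" by (auto simp: grid_def)
    then have "j \<le> Suc i" using s(3) assms(1) by (metis mult_le_cancel_right_pos of_nat_le_iff)
    then consider "j = Suc i" | "j \<le> i" by linarith
    then show "X s \<le> max (?L (real i * h)) (X (real (Suc i) * h))"
    proof cases
      case 2
      then have "s \<le> real i * h" using assms(1) by (simp add: j)
      then show ?thesis using running_sup_upper[OF zero_in_grid lb s(1,2)] by fastforce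
    qed (simp add: j)
  qed (use nn assms in auto)
  moreover have "X (real (Suc i) * h) \<le> ?L (real (Suc i) * h)"
  proof -
    have "real (Suc i) * h \<in> grid h" unfolding grid_def by blast
    then show ?thesis
      using running_sup_upper[OF zero_in_grid lb, of "real (Suc i) * h" h "real (Suc i) * h"] assms(1)
      by auto
  qed
  ultimately show ?thesis using less by linarith
qed

definition grid_floor :: "real \<Rightarrow> real \<Rightarrow> real" where
  "grid_floor h t = real (nat \<lfloor>t / h\<rfloor>) * h"

lemma grid_floor_bounds:
  assumes "h > 0" "t \<ge> 0"
  shows "grid_floor h t \<le> t" "t \<le> grid_floor h t + h" "0 \<le> grid_floor h t"
proof -
  have r: "real (nat \<lfloor>t / h\<rfloor>) = of_int \<lfloor>t / h\<rfloor>" using assms by simp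
  have "of_int \<lfloor>t / h\<rfloor> * h \<le> t / h * h" using assms by (intro mult_right_mono) auto
  then show "grid_floor h t \<le> t" unfolding grid_floor_def r using assms by simp
  have "t / h * h \<le> (of_int \<lfloor>t / h\<rfloor> + 1) * h" using assms by (intro mult_right_mono) linarith+
  then show "t \<le> grid_floor h t + h" unfolding grid_floor_def r using assms by (simp add: algebra_simps)
  show "0 \<le> grid_floor h t" unfolding grid_floor_def using assms by simp
qed

lemma grid_step_eventually:
  assumes "\<delta> > 0" shows "\<forall>\<^sub>F n in sequentially. 1 / real (Suc n) \<le> \<delta>"
proof -
  have "(\<lambda>n. 1 / real (Suc n)) \<longlonglongrightarrow> 0" using LIMSEQ_inverse_real_of_nat by (simp add: inverse_eq_divide)
  then have "\<forall>\<^sub>F n in sequentially. 1 / real (Suc n) < \<delta>" using assms by (rule order_tendstoD)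
  then show ?thesis by (rule eventually_mono) simp
qed

lemma grid_floor_tendsto:
  assumes "t \<ge> 0" shows "(\<lambda>n. grid_floor (1 / real (Suc n)) t) \<longlonglongrightarrow> t"
proof (rule tendsto_sandwich[OF _ _ _ tendsto_const])
  have "(\<lambda>n. t - 1 / real (Suc n)) \<longlonglongrightarrow> t - 0"
    using LIMSEQ_inverse_real_of_nat by (intro tendsto_intros) (simp add: inverse_eq_divide)
  then show "(\<lambda>n. t - 1 / real (Suc n)) \<longlonglongrightarrow> t" by simp
qed (use grid_floor_bounds[OF _ assms, of "1 / real (Suc n)" for n] in \<open>auto simp: algebra_simps\<close>)

lemma uniform_modulus:
  fixes f :: "nat \<Rightarrow> real \<Rightarrow> real"
  assumes "\<And>k. continuous_on {0..} (f k)" "a > 0"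
  shows "\<exists>\<delta>>0. \<forall>k<N. \<forall>s\<in>{0..T}. \<forall>r\<in>{0..T}. \<bar>s - r\<bar> \<le> \<delta> \<longrightarrow> \<bar>f k s - f k r\<bar> \<le> a"
proof (induction N)
  case 0
  show ?case by (intro exI[of _ 1]) auto
next
  case (Suc N)
  then obtain \<delta> where d: "\<delta> > 0"
    "\<forall>k<N. \<forall>s\<in>{0..T}. \<forall>r\<in>{0..T}. \<bar>s - r\<bar> \<le> \<delta> \<longrightarrow> \<bar>f k s - f k r\<bar> \<le> a" by blast
  have "continuous_on {0..T} (f N)" using assms(1) by (rule continuous_on_subset) auto
  then have "uniformly_continuous_on {0..T} (f N)" by (rule compact_uniformly_continuous) auto
  then obtain e where e: "e > 0"
    "\<And>s r. s \<in> {0..T} \<Longrightarrow> r \<in> {0..T} \<Longrightarrow> dist r s < e \<Longrightarrow> dist (f N r) (f N s) < a"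
    unfolding uniformly_continuous_on_def using assms(2) by metis
  show ?case
  proof (intro exI[of _ "min \<delta> (e / 2)"] conjI allI impI ballI)
    fix k s r assume *: "k < Suc N" "s \<in> {0..T}" "r \<in> {0..T}" "\<bar>s - r\<bar> \<le> min \<delta> (e / 2)"
    show "\<bar>f k s - f k r\<bar> \<le> a"
    proof (cases "k = N")
      case True
      have "dist s r < e" using * e(1) by (auto simp: dist_real_def)
      then show ?thesis using e(2)[of r s] * True by (auto simp: dist_real_def)
    qed (use d * in auto)
  qed (use d e in auto)
qed

section \<open>Monotonicity, continuity and grid error of the finite solution\<close>

context collision begin

text \<open>The solution with more times and more particles is a supersolution of the smaller
  problem: it is tested at fewer times, and where the smaller problem has no collision term it is
  still nonnegative.\<close>

lemma skorokhod_mono: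
  assumes "0 \<in> G" "G \<subseteq> G'" "N \<le> N'" "\<And>k. locally_bounded (W k)" "t \<ge> 0"
  shows "skorokhod G N W k t \<le> skorokhod G' N' W k t"
proof -
  have z: "0 \<in> G'" using assms by auto
  note nn = skorokhod_nonneg[OF z assms(4)]
  have "picard G N W n k t \<le> skorokhod G' N' W k t" for n
  proof (cases "k \<le> N")
    case True
    show ?thesis
    proof (rule picard_le_supersolution[OF assms(1,4), where P = "\<lambda>_. True"])
      fix k and s t :: real assume "1 \<le> k" "k < N" "s \<in> G" "0 \<le> s" "s \<le> t"
      then show "push W (skorokhod G' N' W) k s \<le> skorokhod G' N' W k t"
        using assms by (intro skorokhod_push_le[OF z assms(4)]) auto
    qed (use nn assms True in auto)
  next
    case False
    then show ?thesis using picard_outside[OF assms(1,4), where k = k and N = N and n = n and t = t] nn[OF assms(5)] by simp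
  qed
  then show ?thesis by (rule skorokhod_le[OF assms(1,4,5)])
qed

text \<open>Both the continuity in time and the error of a time grid are read off from this comparison:
  the time-changed solution plus a multiple of the barrier is a supersolution.\<close>

lemma skorokhod_time_change:
  assumes z: "0 \<in> G" "0 \<in> G'" and lb: "\<And>k. locally_bounded (W k)" and "a \<ge> 0"
    and \<tau>: "\<And>s. 0 \<le> s \<Longrightarrow> s \<le> T \<Longrightarrow> \<tau> s \<in> G' \<and> 0 \<le> \<tau> s"
    and \<tau>_mono: "\<And>s t. 0 \<le> s \<Longrightarrow> s \<le> t \<Longrightarrow> t \<le> T \<Longrightarrow> \<tau> s \<le> \<tau> t"
    and W: "\<And>k s. 1 \<le> k \<Longrightarrow> k < N \<Longrightarrow> 0 \<le> s \<Longrightarrow> s \<le> T \<Longrightarrow>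
       (W k s - W (Suc k) s) - (W k (\<tau> s) - W (Suc k) (\<tau> s)) \<le> a"
    and "0 \<le> t" "t \<le> T" "k \<le> N"
  shows "skorokhod G N W k t \<le> skorokhod G' N W k (\<tau> t) + a * barrier N k"
proof (rule skorokhod_le[OF z(1) lb \<open>0 \<le> t\<close>])
  fix n
  let ?V = "\<lambda>k u. skorokhod G' N W k (\<tau> u) + a * barrier N k"
  show "picard G N W n k t \<le> ?V k t"
  proof (rule picard_le_supersolution[OF z(1) lb, where P = "\<lambda>t. t \<le> T" and V = ?V])
    fix k u assume "u \<le> T" "0 \<le> u" "k \<le> N"
    then show "0 \<le> ?V k u"
      using skorokhod_nonneg[OF z(2) lb] \<tau>[of u] barrier_nonneg[of k N] \<open>a \<ge> 0\<close> by auto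
  next
    fix k s u assume k: "1 \<le> k" "k < N" and s: "s \<in> G" "0 \<le> s" "s \<le> u" "u \<le> T"
    have *: "push W (skorokhod G' N W) k (\<tau> s) \<le> skorokhod G' N W k (\<tau> u)"
      using \<tau>[of s] \<tau>_mono[of s u] s by (intro skorokhod_push_le[OF z(2) lb k]) auto
    have "push W ?V k s = push W (skorokhod G' N W) k (\<tau> s)
        + ((W k s - W (Suc k) s) - (W k (\<tau> s) - W (Suc k) (\<tau> s)))
        + a * (qp k * barrier N (k - 1) + qm (Suc k) * barrier N (Suc k))"
      unfolding push_def by (simp add: algebra_simps del: barrier.simps)
    also have "\<dots> \<le> skorokhod G' N W k (\<tau> u) + a
        + a * (qp k * barrier N (k - 1) + qm (Suc k) * barrier N (Suc k))"
      using * W[OF k, of s] s by auto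
    also have "\<dots> = skorokhod G' N W k (\<tau> u)
        + a * (1 + qp k * barrier N (k - 1) + qm (Suc k) * barrier N (Suc k))"
      by (simp add: algebra_simps del: barrier.simps)
    also have "\<dots> = ?V k u" using barrier_eq[OF k] by simp
    finally show "push W ?V k s \<le> ?V k u" .
  qed (use assms in auto)
qed

lemma skorokhod_initial:
  assumes "0 \<in> G" "\<And>k. locally_bounded (W k)" "\<And>k. 1 \<le> k \<Longrightarrow> k < N \<Longrightarrow> W k 0 \<le> W (Suc k) 0"
  shows "skorokhod G N W k 0 = 0"
proof (cases "k \<le> N")
  case True
  \<comment> \<open>With the horizon cut to time 0, a sorted start makes the zero function a
    supersolution.\<close>
  have "picard G N W n k 0 \<le> 0" for n
    by (rule picard_le_supersolution[OF assms(1,2), where P = "\<lambda>t. t \<le> 0" and V = "\<lambda>k t. 0"])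
      (use assms(3) True in \<open>auto simp: push_def dest!: order_antisym[of _ "0::real"]\<close>)
  then show ?thesis
    by (intro antisym skorokhod_le[OF assms(1,2)] skorokhod_nonneg[OF assms(1,2)]) auto
qed (use skorokhod_outside[OF assms(1,2)] in auto)

context
  fixes W :: "nat \<Rightarrow> real \<Rightarrow> real"
  assumes W_cont: "\<And>k. continuous_on {0..} (W k)"
begin

lemma W_locally_bounded: "locally_bounded (W k)"
  using W_cont by (rule locally_bounded_continuous)

lemma gap_modulus:
  assumes "a > 0"
  shows "\<exists>\<delta>>0. \<forall>k<N. \<forall>s\<in>{0..T}. \<forall>r\<in>{0..T}. \<bar>s - r\<bar> \<le> \<delta> \<longrightarrow>
    \<bar>(W k s - W (Suc k) s) - (W k r - W (Suc k) r)\<bar> \<le> a"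
  by (rule uniform_modulus[OF _ assms]) (intro continuous_intros W_cont)

text \<open>Time change by the shift \<open>max 0 (u - (t - s))\<close>, which carries
  \<open>t\<close> to \<open>s\<close> and moves no time by more than \<open>t - s\<close>. The
  modulus of continuity of the driving gaps becomes the factor of the barrier.\<close>

lemma skorokhod_increment:
  assumes "a > 0"
  shows "\<exists>\<delta>>0. \<forall>k\<le>N. \<forall>s\<ge>0. \<forall>t\<le>T. s \<le> t \<and> t \<le> s + \<delta> \<longrightarrow>
    skorokhod {0..} N W k t \<le> skorokhod {0..} N W k s + a * barrier N k"
proof -
  obtain \<delta> where d: "\<delta> > 0" "\<And>k s r. k < N \<Longrightarrow> s \<in> {0..T} \<Longrightarrow> r \<in> {0..T} \<Longrightarrow> \<bar>s - r\<bar> \<le> \<delta> \<Longrightarrow>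
    \<bar>(W k s - W (Suc k) s) - (W k r - W (Suc k) r)\<bar> \<le> a"
    using gap_modulus[OF assms, of N T] by blast
  have "skorokhod {0..} N W k t \<le> skorokhod {0..} N W k s + a * barrier N k"
    if *: "k \<le> N" "0 \<le> s" "t \<le> T" "s \<le> t" "t \<le> s + \<delta>" for k s t
  proof -
    have "skorokhod {0..} N W k t \<le> skorokhod {0..} N W k (max 0 (t - (t - s))) + a * barrier N k"
    proof (rule skorokhod_time_change[where \<tau> = "\<lambda>u. max 0 (u - (t - s))" and T = T])
      fix k u assume "1 \<le> k" "k < N" "0 \<le> u" "u \<le> T"
      then show "(W k u - W (Suc k) u) - (W k (max 0 (u - (t - s))) - W (Suc k) (max 0 (u - (t - s)))) \<le> a"
        using d(2)[of k u "max 0 (u - (t - s))"] * by (auto simp: max_def split: if_splits)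
    qed (use * assms W_locally_bounded in auto)
    then show ?thesis using * by simp
  qed
  then show ?thesis using d(1) by blast
qed

lemma skorokhod_continuous: "continuous_on {0..} (skorokhod {0..} N W k)"
proof (cases "1 \<le> k \<and> k < N")
  case True
  let ?L = "skorokhod {0..} N W k"
  have zero_in: "(0::real) \<in> {0..}" by simp
  show ?thesis
    unfolding continuous_on_iff
  proof (intro ballI allI impI)
    fix t e :: real assume t: "t \<in> {0..}" and "e > 0"
    have b: "barrier N k > 0" using barrier_pos True by auto
    obtain \<delta> where d: "\<delta> > 0" "\<And>s u. 0 \<le> s \<Longrightarrow> u \<le> t + 1 \<Longrightarrow> s \<le> u \<Longrightarrow> u \<le> s + \<delta> \<Longrightarrow>
      ?L u \<le> ?L s + e / (2 * barrier N k) * barrier N k"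
      using skorokhod_increment[of "e / (2 * barrier N k)" N "t + 1"] b \<open>e > 0\<close> True
      by (metis divide_pos_pos mult_pos_pos zero_less_numeral less_imp_le)
    have eq: "e / (2 * barrier N k) * barrier N k = e / 2" using b by simp
    show "\<exists>d>0. \<forall>u\<in>{0..}. dist u t < d \<longrightarrow> dist (?L u) (?L t) < e"
    proof (intro exI[of _ "min \<delta> 1"] conjI ballI impI)
      fix u assume u: "u \<in> {0::real..}" "dist u t < min \<delta> 1"
      show "dist (?L u) (?L t) < e"
      proof (cases "u \<le> t")
        case True
        then show ?thesis using d(2)[of u t] u t \<open>e > 0\<close> eq
            skorokhod_mono_time[OF zero_in W_locally_bounded, of u t N] by (auto simp: dist_real_def)
      next
        case False
        then show ?thesis using d(2)[of t u] u t \<open>e > 0\<close> eq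
            skorokhod_mono_time[OF zero_in W_locally_bounded, of t u N] by (auto simp: dist_real_def)
      qed
    qed (use d in auto)
  qed
next
  case False
  have "skorokhod {0..} N W k = (\<lambda>t. 0)"
    by (rule ext, rule skorokhod_outside[OF _ W_locally_bounded False]) simp
  then show ?thesis by simp
qed

text \<open>The same comparison with every time moved back to the last grid point, at distance at
  most \<open>h\<close>. The opposite inequality holds without error, by
  \<open>skorokhod_mono\<close>.\<close>

lemma skorokhod_grid_error:
  assumes "a > 0" "T \<ge> 0"
  shows "\<exists>\<delta>>0. \<forall>h. 0 < h \<and> h \<le> \<delta> \<longrightarrow> (\<forall>k\<le>N. \<forall>t\<in>{0..T}.
    skorokhod {0..} N W k t \<le> skorokhod (grid h) N W k (grid_floor h t) + a * barrier N k)"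
proof -
  obtain \<delta> where d: "\<delta> > 0" "\<And>k s r. k < N \<Longrightarrow> s \<in> {0..T} \<Longrightarrow> r \<in> {0..T} \<Longrightarrow> \<bar>s - r\<bar> \<le> \<delta> \<Longrightarrow>
    \<bar>(W k s - W (Suc k) s) - (W k r - W (Suc k) r)\<bar> \<le> a"
    using gap_modulus[OF assms(1), of N T] by blast
  have "skorokhod {0..} N W k t \<le> skorokhod (grid h) N W k (grid_floor h t) + a * barrier N k"
    if *: "0 < h" "h \<le> \<delta>" "k \<le> N" "0 \<le> t" "t \<le> T" for h k t
  proof (rule skorokhod_time_change[where \<tau> = "grid_floor h" and T = T])
    show "grid_floor h s \<in> grid h \<and> 0 \<le> grid_floor h s" if "0 \<le> s" for s
      using grid_floor_bounds[OF *(1) that] by (auto simp: grid_floor_def grid_def)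
    show "grid_floor h s \<le> grid_floor h t" if "s \<le> t" for s t
      unfolding grid_floor_def using * that
      by (intro mult_right_mono of_nat_mono nat_mono floor_mono divide_right_mono) auto
    fix k s assume "1 \<le> k" "k < N" "0 \<le> s" "s \<le> T"
    then show "(W k s - W (Suc k) s) - (W k (grid_floor h s) - W (Suc k) (grid_floor h s)) \<le> a"
      using d(2)[of k s "grid_floor h s"] grid_floor_bounds[OF *(1), of s] * by auto
  qed (use * assms W_locally_bounded zero_in_grid in auto)
  then show ?thesis using d(1) by force
qed

lemma skorokhod_grid_sandwich:
  assumes "t \<ge> 0" "h > 0"
  shows "skorokhod (grid h) N W k (grid_floor h t) \<le> skorokhod (grid h) N W k t"
    and "skorokhod (grid h) N W k t \<le> skorokhod {0..} N W k t"
proof -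
  show "skorokhod (grid h) N W k (grid_floor h t) \<le> skorokhod (grid h) N W k t"
    using grid_floor_bounds[OF assms(2,1)]
    by (intro skorokhod_mono_time[OF zero_in_grid W_locally_bounded]) auto
  show "skorokhod (grid h) N W k t \<le> skorokhod {0..} N W k t"
    using assms by (intro skorokhod_mono W_locally_bounded zero_in_grid) (auto simp: grid_def)
qed

text \<open>The first form, evaluated at the last grid time, transfers cost bounds from the discrete
  chain to continuous time; the second, evaluated at \<open>t\<close> itself, gives measurability of
  the continuous-time solution.\<close>

lemma skorokhod_grid_tendsto:
  assumes "t \<ge> 0"
  shows "(\<lambda>n. skorokhod (grid (1 / real (Suc n))) N W k (grid_floor (1 / real (Suc n)) t))
      \<longlonglongrightarrow> skorokhod {0..} N W k t" (is "(\<lambda>n. ?f n) \<longlonglongrightarrow> ?l")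
    and "(\<lambda>n. skorokhod (grid (1 / real (Suc n))) N W k t) \<longlonglongrightarrow> skorokhod {0..} N W k t"
proof -
  show 1: "?f \<longlonglongrightarrow> ?l"
  proof (cases "1 \<le> k \<and> k < N")
    case True
    show ?thesis
    proof (rule LIMSEQ_I)
      fix e :: real assume "e > 0"
      have b: "barrier N k > 0" using barrier_pos True by auto
      then have "e / (2 * barrier N k) > 0" using \<open>e > 0\<close> by simp
      from skorokhod_grid_error[OF this assms, of N] obtain \<delta> where d: "\<delta> > 0"
        "\<And>h. 0 < h \<Longrightarrow> h \<le> \<delta> \<Longrightarrow> ?l \<le> skorokhod (grid h) N W k (grid_floor h t)
           + e / (2 * barrier N k) * barrier N k"
        using True assms by (metis atLeastAtMost_iff less_imp_le order_refl)
      have eq: "e / (2 * barrier N k) * barrier N k = e / 2" using b by simp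
      have "\<forall>\<^sub>F n in sequentially. norm (?f n - ?l) < e"
        using grid_step_eventually[OF d(1)]
      proof eventually_elim
        case (elim n)
        show ?case
          using d(2)[OF _ elim] skorokhod_grid_sandwich[OF assms, of "1 / real (Suc n)" N k] \<open>e > 0\<close> eq
          by (auto simp: abs_if)
      qed
      then show "\<exists>n0. \<forall>n\<ge>n0. norm (?f n - ?l) < e" by (simp add: eventually_sequentially)
    qed
  next
    case False
    have "skorokhod G N W k s = 0" if "0 \<in> G" for G s
      by (rule skorokhod_outside[OF that W_locally_bounded False])
    then show ?thesis using zero_in_grid by simp
  qed
  show "(\<lambda>n. skorokhod (grid (1 / real (Suc n))) N W k t) \<longlonglongrightarrow> ?l"
    by (rule tendsto_sandwich[OF _ _ 1 tendsto_const])
      (use skorokhod_grid_sandwich[OF assms] in auto)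
qed

lemma ranked_grid_tendsto:
  assumes "t \<ge> 0"
  shows "(\<lambda>n. ranked W (skorokhod (grid (1 / real (Suc n))) N W) k (grid_floor (1 / real (Suc n)) t))
      \<longlonglongrightarrow> ranked W (skorokhod {0..} N W) k t"
proof -
  have "(\<lambda>n. W k (grid_floor (1 / real (Suc n)) t)) \<longlonglongrightarrow> W k t"
    using W_cont[of k] assms grid_floor_bounds(3)[OF _ assms]
    by (intro continuous_on_tendsto_compose[OF _ grid_floor_tendsto]) auto
  then show ?thesis
    unfolding ranked_def by (intro tendsto_intros skorokhod_grid_tendsto assms)
qed

end

end

section \<open>The limit of infinitely many particles\<close>

text \<open>A theorem of Polya type: pointwise convergence on a finite mesh suffices. As
  \<open>f n\<close> stays below \<open>F\<close>, only a lower bound is needed, and between mesh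
  points it follows from monotonicity of \<open>f n\<close> and uniform continuity of
  \<open>F\<close>.\<close>

lemma uniform_limit_monotone_functions:
  fixes f :: "nat \<Rightarrow> real \<Rightarrow> real"
  assumes mono: "\<And>n s t. 0 \<le> s \<Longrightarrow> s \<le> t \<Longrightarrow> f n s \<le> f n t"
    and mono': "\<And>s t. 0 \<le> s \<Longrightarrow> s \<le> t \<Longrightarrow> F s \<le> F t"
    and le: "\<And>n t. 0 \<le> t \<Longrightarrow> f n t \<le> F t"
    and lim: "\<And>t. 0 \<le> t \<Longrightarrow> (\<lambda>n. f n t) \<longlonglongrightarrow> F t"
    and cont: "continuous_on {0..} F"
  shows "uniform_limit {0..T} f F sequentially"
proof (rule uniform_limitI)
  fix e :: real assume "e > 0"
  have "continuous_on {0..T} F" using cont by (rule continuous_on_subset) auto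
  then have "uniformly_continuous_on {0..T} F" by (rule compact_uniformly_continuous) auto
  then obtain d where d: "d > 0" "\<And>s r. s \<in> {0..T} \<Longrightarrow> r \<in> {0..T} \<Longrightarrow> dist r s < d \<Longrightarrow> dist (F r) (F s) < e / 2"
    unfolding uniformly_continuous_on_def using \<open>e > 0\<close> by (metis half_gt_zero)
  define h where "h = d / 2"
  have h: "h > 0" "h < d" using d by (auto simp: h_def)
  define J where "J = nat \<lfloor>T / h\<rfloor>"
  have "\<forall>\<^sub>F n in sequentially. f n (real j * h) > F (real j * h) - e / 2" for j :: nat
    using lim[of "real j * h"] by (rule order_tendstoD) (use h \<open>e > 0\<close> in auto)
  then have "\<forall>\<^sub>F n in sequentially. \<forall>j\<in>{..J}. f n (real j * h) > F (real j * h) - e / 2"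
    by (intro eventually_ball_finite) auto
  then show "\<forall>\<^sub>F n in sequentially. \<forall>t\<in>{0..T}. dist (f n t) (F t) < e"
  proof (eventually_elim, intro ballI)
    case (elim n)
    fix t assume t: "t \<in> {0..T}"
    define r where "r = grid_floor h t"
    have r: "r \<le> t" "t \<le> r + h" "0 \<le> r" unfolding r_def using grid_floor_bounds h t by auto
    have "nat \<lfloor>t / h\<rfloor> \<le> J"
      unfolding J_def using t h by (intro nat_mono floor_mono divide_right_mono) auto
    then have "f n r > F r - e / 2" using elim unfolding r_def grid_floor_def by auto
    moreover have "dist (F t) (F r) < e / 2" using r t h by (intro d(2)) (auto simp: dist_real_def)
    moreover have "f n r \<le> f n t" "f n t \<le> F t" using mono le r t by auto
    ultimately show "dist (f n t) (F t) < e" unfolding dist_real_def by linarith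
  qed
qed

context collision begin

text \<open>Maximum principle relative to the barrier: at a maximiser \<open>j\<close> of the ratio
  of \<open>\<delta>\<close> to \<open>barrier m\<close>, with maximum \<open>r\<close>, the margin
  1 gives \<open>\<delta> j\<close> at most \<open>\<delta> j - r\<close>, so \<open>r\<close> is 0.
  Subharmonicity is asked only where \<open>\<delta>\<close> is positive, since that is where a jump
  identifies the collision term.\<close>

lemma subharmonic_vanishes:
  assumes nn: "\<And>k. 0 \<le> \<delta> k" and "\<delta> 0 = 0" "\<delta> m = 0"
    and sub: "\<And>k. 1 \<le> k \<Longrightarrow> \<delta> k > 0 \<Longrightarrow> \<delta> k \<le> qp k * \<delta> (k - 1) + qm (Suc k) * \<delta> (Suc k)"
    and "k < m"
  shows "\<delta> k = 0"
proof (cases "k = 0")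
  case False
  define r where "r = Max ((\<lambda>k. \<delta> k / barrier m k) ` {1..<m})"
  have fin: "finite ((\<lambda>k. \<delta> k / barrier m k) ` {1..<m})" by simp
  have ne: "(\<lambda>k. \<delta> k / barrier m k) ` {1..<m} \<noteq> {}" using False assms(5) by auto
  obtain j where j: "1 \<le> j" "j < m" "r = \<delta> j / barrier m j"
    using Max_in[OF fin ne] unfolding r_def by auto
  have le: "\<delta> i \<le> r * barrier m i" if "1 \<le> i" "i < m" for i
  proof -
    have "\<delta> i / barrier m i \<le> r" unfolding r_def using that by (intro Max_ge) auto
    then show ?thesis using barrier_pos[OF that] by (simp add: divide_le_eq)
  qed
  have r0: "0 \<le> r" using j nn barrier_nonneg[of j m] by (auto intro!: divide_nonneg_nonneg)
  have le': "\<delta> i \<le> r * barrier m i" if "i \<le> m" for i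
    using le[of i] that assms(2,3) r0 barrier_nonneg[OF that]
    by (cases "i = 0 \<or> i = m") auto
  have "r = 0"
  proof (rule ccontr)
    assume "r \<noteq> 0"
    then have "r > 0" using r0 by simp
    then have dj: "\<delta> j > 0" using j nn[of j] by (cases "\<delta> j = 0") auto
    have "\<delta> j \<le> qp j * \<delta> (j - 1) + qm (Suc j) * \<delta> (Suc j)" using sub j dj by auto
    also have "\<dots> \<le> qp j * (r * barrier m (j - 1)) + qm (Suc j) * (r * barrier m (Suc j))"
      using j q_pos[of j] q_pos[of "Suc j"] by (intro add_mono mult_left_mono le') auto
    also have "\<dots> = r * (1 + qp j * barrier m (j - 1) + qm (Suc j) * barrier m (Suc j)) - r"
      by (simp add: algebra_simps del: barrier.simps)
    also have "\<dots> = r * barrier m j - r" using barrier_eq[of j m] j by simp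
    also have "\<dots> = \<delta> j - r" using j barrier_pos[of j m] by simp
    finally show False using \<open>r > 0\<close> by simp
  qed
  then show ?thesis using le[of k] False assms(5) nn[of k] by auto
qed (use assms in simp)

text \<open>A supremum of reals, meaningful only on paths where it is bounded;
  \<open>skorokhod_bounded_size\<close> derives this from \<open>controlled\<close>.\<close>

definition collision_limit :: "(nat \<Rightarrow> real \<Rightarrow> real) \<Rightarrow> nat \<Rightarrow> real \<Rightarrow> real" where
  "collision_limit W k t = (SUP N. skorokhod {0..} N W k t)"

text \<open>All that path analysis needs from probability. Infinitely many \<open>N\<close> are
  enough by monotonicity in \<open>N\<close>. Every level \<open>a\<close> is asked for because the
  point at which particles would coalesce is not known in advance.\<close>

definition controlled :: "(nat \<Rightarrow> real \<Rightarrow> real) \<Rightarrow> bool" where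
  "controlled W \<longleftrightarrow> (\<forall>T a. \<exists>K. \<exists>\<^sub>\<infinity>N. \<forall>t\<in>{0..T}.
     (\<Sum>k=1..N. max 0 (a - ranked W (skorokhod {0..} N W) k t)) \<le> K)"

context
  fixes W :: "nat \<Rightarrow> real \<Rightarrow> real"
  assumes W_cont: "\<And>k. continuous_on {0..} (W k)"
    and W_controlled: "controlled W"
begin

lemma zero_in_halfline: "(0::real) \<in> {0..}" by simp

lemmas W_lb = W_locally_bounded[OF W_cont]

lemma skorokhod_mono_size:
  "N \<le> N' \<Longrightarrow> t \<ge> 0 \<Longrightarrow> skorokhod {0..} N W k t \<le> skorokhod {0..} N' W k t"
  by (intro skorokhod_mono W_lb) auto

text \<open>For \<open>N\<close> obeying the control at level 0, no particle is below
  \<open>- K\<close> at time \<open>t\<close>. Solving the equation of particle \<open>Suc k\<close>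
  for its upper collision term then passes a bound from \<open>k\<close> to \<open>Suc k\<close>,
  starting from the vanishing term at 0. Any other \<open>N\<close> lies below such an
  \<open>N'\<close>.\<close>

lemma skorokhod_bounded_size:
  assumes "t \<ge> 0" shows "bdd_above (range (\<lambda>N. skorokhod {0..} N W k t))"
proof -
  obtain K where K: "\<exists>\<^sub>\<infinity>N. \<forall>s\<in>{0..t}.
     (\<Sum>k=1..N. max 0 (0 - ranked W (skorokhod {0..} N W) k s)) \<le> K"
    using W_controlled unfolding controlled_def by blast
  define good where "good N \<longleftrightarrow> (\<forall>s\<in>{0..t}.
     (\<Sum>k=1..N. max 0 (0 - ranked W (skorokhod {0..} N W) k s)) \<le> K)" for N
  have below: "- K \<le> ranked W (skorokhod {0..} N W) k t" if "good N" "1 \<le> k" "k \<le> N" for N k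
  proof -
    have "max 0 (0 - ranked W (skorokhod {0..} N W) k t)
        \<le> (\<Sum>k=1..N. max 0 (0 - ranked W (skorokhod {0..} N W) k t))"
      using that by (intro member_le_sum) auto
    also have "\<dots> \<le> K" using that assms by (auto simp: good_def)
    finally show ?thesis by simp
  qed
  have "\<exists>C. \<forall>N\<ge>k. good N \<longrightarrow> skorokhod {0..} N W k t \<le> C"
  proof (induction k)
    case 0
    have "skorokhod {0..} N W 0 t = 0" for N
      by (rule skorokhod_outside[OF zero_in_halfline W_lb]) simp
    then show ?case by (intro exI[of _ 0]) simp
  next
    case (Suc k)
    then obtain C where C: "\<And>N. N \<ge> k \<Longrightarrow> good N \<Longrightarrow> skorokhod {0..} N W k t \<le> C" by blast
    have "skorokhod {0..} N W (Suc k) t \<le> (W (Suc k) t + qp (Suc k) * C + K) / qm (Suc k)"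
      if "N \<ge> Suc k" "good N" for N
    proof -
      have "qm (Suc k) * skorokhod {0..} N W (Suc k) t
          = W (Suc k) t + qp (Suc k) * skorokhod {0..} N W k t - ranked W (skorokhod {0..} N W) (Suc k) t"
        by (simp add: ranked_def)
      also have "\<dots> \<le> W (Suc k) t + qp (Suc k) * C + K"
        using below[of N "Suc k"] C[of N] that q_pos(1)[of "Suc k"]
        by (smt (verit, best) Suc_leD le_add1 mult_left_mono plus_1_eq_Suc)
      finally show ?thesis using q_pos(2)[of "Suc k"] by (simp add: le_divide_eq mult.commute)
    qed
    then show ?case by blast
  qed
  then obtain C where C: "\<And>N. N \<ge> k \<Longrightarrow> good N \<Longrightarrow> skorokhod {0..} N W k t \<le> C" by blast
  have "skorokhod {0..} N W k t \<le> C" for N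
  proof -
    obtain N' where N': "N' \<ge> max N k" "good N'"
      using K unfolding good_def[symmetric] INFM_nat_le by blast
    then show ?thesis using C[of N'] skorokhod_mono_size[of N N' t k] assms by auto
  qed
  then show ?thesis by (intro bdd_aboveI2)
qed

lemma collision_limit_tendsto:
  "t \<ge> 0 \<Longrightarrow> (\<lambda>N. skorokhod {0..} N W k t) \<longlonglongrightarrow> collision_limit W k t"
  unfolding collision_limit_def
  by (intro LIMSEQ_incseq_SUP skorokhod_bounded_size incseq_SucI skorokhod_mono_size) auto

lemma skorokhod_le_collision_limit: "t \<ge> 0 \<Longrightarrow> skorokhod {0..} N W k t \<le> collision_limit W k t"
  unfolding collision_limit_def by (intro cSUP_upper skorokhod_bounded_size) auto

lemma collision_limit_nonneg: "t \<ge> 0 \<Longrightarrow> 0 \<le> collision_limit W k t"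
  using skorokhod_nonneg[OF zero_in_halfline W_lb] skorokhod_le_collision_limit by (rule order_trans)

lemma collision_limit_mono:
  "0 \<le> s \<Longrightarrow> s \<le> t \<Longrightarrow> collision_limit W k s \<le> collision_limit W k t"
  by (rule LIMSEQ_le[OF collision_limit_tendsto collision_limit_tendsto])
    (auto intro!: exI[of _ 0] skorokhod_mono_time W_lb)

lemma collision_limit_locally_bounded: "locally_bounded (collision_limit W k)"
  using collision_limit_mono collision_limit_nonneg
  by (intro locally_bounded_mono) (auto simp: mono_on_def)

lemma collision_limit_push_bounded: "locally_bounded (push W (collision_limit W) k)"
  by (intro push_locally_bounded W_lb collision_limit_locally_bounded)

lemma collision_limit_0: "collision_limit W 0 t = 0"
proof -
  have "skorokhod {0..} N W 0 t = 0" for N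
    by (rule skorokhod_outside[OF zero_in_halfline W_lb]) simp
  then show ?thesis unfolding collision_limit_def by simp
qed

lemma collision_limit_initial:
  assumes "\<And>k. 1 \<le> k \<Longrightarrow> W k 0 \<le> W (Suc k) 0"
  shows "collision_limit W k 0 = 0"
proof -
  have "skorokhod {0..} N W k 0 = 0" for N
    by (rule skorokhod_initial[OF zero_in_halfline W_lb]) (use assms in auto)
  then show ?thesis unfolding collision_limit_def by simp
qed

lemma collision_limit_fixpoint:
  assumes "t \<ge> 0" "1 \<le> k"
  shows "collision_limit W k t = running_sup {0..} (push W (collision_limit W) k) t"
proof (rule LIMSEQ_unique)
  show "(\<lambda>N. skorokhod {0..} N W k t) \<longlonglongrightarrow> collision_limit W k t"
    by (rule collision_limit_tendsto[OF assms(1)])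
  have "(\<lambda>N. running_sup {0..} (push W (skorokhod {0..} N W) k) t)
      \<longlonglongrightarrow> running_sup {0..} (push W (collision_limit W) k) t"
  proof (rule running_sup_tendsto[OF zero_in_halfline assms(1)])
    show "(\<lambda>N. push W (skorokhod {0..} N W) k s) \<longlonglongrightarrow> push W (collision_limit W) k s" if "s \<ge> 0" for s
      unfolding push_def by (intro tendsto_intros collision_limit_tendsto that)
  qed (use assms in \<open>auto intro!: skorokhod_push_bounded W_lb collision_limit_push_bounded
      push_mono skorokhod_mono_size\<close>)
  moreover have "\<forall>\<^sub>F N in sequentially. running_sup {0..} (push W (skorokhod {0..} N W) k) t
      = skorokhod {0..} N W k t"
    using eventually_gt_at_top[of k]
    by eventually_elim (rule skorokhod_fixpoint[OF zero_in_halfline W_lb assms, symmetric])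
  ultimately show "(\<lambda>N. skorokhod {0..} N W k t) \<longlonglongrightarrow> running_sup {0..} (push W (collision_limit W) k) t"
    by (rule Lim_transform_eventually)
qed

lemma collision_limit_push_le:
  "1 \<le> k \<Longrightarrow> 0 \<le> s \<Longrightarrow> s \<le> t \<Longrightarrow> push W (collision_limit W) k s \<le> collision_limit W k t"
  using running_sup_upper[OF zero_in_halfline collision_limit_push_bounded, of s t k]
    collision_limit_fixpoint[of t k] by simp

lemma ranked_limit_tendsto:
  "t \<ge> 0 \<Longrightarrow> (\<lambda>N. ranked W (skorokhod {0..} N W) k t) \<longlonglongrightarrow> ranked W (collision_limit W) k t"
  unfolding ranked_def by (intro tendsto_intros collision_limit_tendsto)

text \<open>A Fatou argument: the first \<open>m\<close> terms converge, so a limit above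
  \<open>K\<close> would make the sums over \<open>1..N\<close> exceed \<open>K\<close> for all
  large \<open>N\<close>, although infinitely many \<open>N\<close> obey the bound.\<close>

lemma collision_limit_controlled:
  "\<exists>K. \<forall>t\<in>{0..T}. \<forall>m. (\<Sum>k=1..m. max 0 (a - ranked W (collision_limit W) k t)) \<le> K"
proof -
  obtain K where K: "\<exists>\<^sub>\<infinity>N. \<forall>s\<in>{0..T}.
     (\<Sum>k=1..N. max 0 (a - ranked W (skorokhod {0..} N W) k s)) \<le> K"
    using W_controlled unfolding controlled_def by blast
  have "(\<Sum>k=1..m. max 0 (a - ranked W (collision_limit W) k t)) \<le> K" if "t \<in> {0..T}" for t m
  proof (rule ccontr)
    assume "\<not> ?thesis"
    moreover have "(\<lambda>N. \<Sum>k=1..m. max 0 (a - ranked W (skorokhod {0..} N W) k t))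
        \<longlonglongrightarrow> (\<Sum>k=1..m. max 0 (a - ranked W (collision_limit W) k t))"
      using that by (intro tendsto_intros ranked_limit_tendsto) auto
    ultimately have "\<forall>\<^sub>F N in sequentially. K < (\<Sum>k=1..m. max 0 (a - ranked W (skorokhod {0..} N W) k t))"
      by (intro order_tendstoD(1)) auto
    then have "\<forall>\<^sub>F N in sequentially. \<not> (\<forall>s\<in>{0..T}.
        (\<Sum>k=1..N. max 0 (a - ranked W (skorokhod {0..} N W) k s)) \<le> K)"
      using eventually_ge_at_top[of m]
    proof eventually_elim
      case (elim N)
      have "(\<Sum>k=1..m. max 0 (a - ranked W (skorokhod {0..} N W) k t))
          \<le> (\<Sum>k=1..N. max 0 (a - ranked W (skorokhod {0..} N W) k t))"
        using elim by (intro sum_mono2) auto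
      then show ?case using elim that by force
    qed
    then show False using K by (simp add: frequently_def cofinite_eq_sequentially)
  qed
  then show ?thesis by blast
qed

text \<open>At a jump of the limit all particles beyond some index would coalesce, because a jump at
  index \<open>k\<close> closes the gap between \<open>k\<close> and \<open>k + 1\<close> and the jump sizes are subharmonic;
  this contradicts the control.\<close>

lemma collision_limit_right_limit:
  assumes "t \<ge> 0"
  shows "(\<lambda>n. collision_limit W k (t + 1 / real (Suc n))) \<longlonglongrightarrow> collision_limit W k t"
proof -
  define L where "L = collision_limit W"
  define u where "u n = t + 1 / real (Suc n)" for n
  have u: "u n \<ge> 0" "t \<le> u n" "u n \<le> t + 1" for n using assms by (auto simp: u_def)
  have u_dec: "u (Suc n) \<le> u n" for n by (simp add: u_def frac_le)
  have u_lim: "u \<longlonglongrightarrow> t"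
    using LIMSEQ_inverse_real_of_nat_add[of t] by (simp add: u_def[abs_def] inverse_eq_divide)
  have "\<exists>l. (\<lambda>n. L k (u n)) \<longlonglongrightarrow> l" for k
  proof -
    have "decseq (\<lambda>n. L k (u n))"
      unfolding L_def by (intro decseq_SucI collision_limit_mono u u_dec)
    moreover have "0 \<le> L k (u n)" for n unfolding L_def by (intro collision_limit_nonneg u)
    ultimately show ?thesis by (metis decseq_convergent)
  qed
  then obtain p where p: "\<And>k. (\<lambda>n. L k (u n)) \<longlonglongrightarrow> p k" by metis
  define P where "P = (\<lambda>(k::nat) (s::real). p k)"
  have p_ge: "L k t \<le> p k" for k
    using p[of k] by (rule LIMSEQ_le_const) (auto simp: L_def intro!: exI[of _ 0] collision_limit_mono assms u)
  have W_lim: "(\<lambda>n. W k (u n)) \<longlonglongrightarrow> W k t" for k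
    using W_cont[of k] u_lim by (rule continuous_on_tendsto_compose) (use assms u in auto)
  have push_lim: "(\<lambda>n. push W L k (u n)) \<longlonglongrightarrow> push W P k t" for k
    unfolding push_def P_def by (intro tendsto_intros W_lim p)
  have ranked_lim: "(\<lambda>n. ranked W L k (u n)) \<longlonglongrightarrow> ranked W P k t" for k
    unfolding ranked_def P_def by (intro tendsto_intros W_lim p)
  have push_le: "push W P k t \<le> p k" if "1 \<le> k" for k
    using push_lim p by (rule LIMSEQ_le) (auto simp: L_def intro!: exI[of _ 0] collision_limit_push_le that u)
  \<comment> \<open>For times in \<open>(t, u n]\<close> the driving gap is close to its value at
    \<open>t\<close>, and the neighbouring terms are at most their values at \<open>u n\<close>.
    Hence the right limit can exceed \<open>L k t\<close> only up to the limiting push.\<close>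
  have le_push: "p k \<le> max (L k t) (push W P k t)" if "1 \<le> k" for k
  proof (rule field_le_epsilon)
    fix e :: real assume "e > 0"
    have "continuous_on {0..} (\<lambda>s. W k s - W (Suc k) s)" by (intro continuous_intros W_cont)
    then obtain d where d: "d > 0" "\<And>s. s \<ge> 0 \<Longrightarrow> dist s t < d \<Longrightarrow>
        dist (W k s - W (Suc k) s) (W k t - W (Suc k) t) < e"
      using assms \<open>e > 0\<close> unfolding continuous_on_iff by (metis atLeast_iff)
    define Q where "Q n = W k t - W (Suc k) t + e + qp k * L (k - 1) (u n) + qm (Suc k) * L (Suc k) (u n)" for n
    have Q_lim: "Q \<longlonglongrightarrow> W k t - W (Suc k) t + e + qp k * p (k - 1) + qm (Suc k) * p (Suc k)"
      unfolding Q_def[abs_def] by (intro tendsto_intros p)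
    have Lt: "0 \<le> L k t" unfolding L_def using assms by (rule collision_limit_nonneg)
    have "\<forall>\<^sub>F n in sequentially. dist (u n) t < d" using u_lim d(1) by (rule tendstoD)
    then have "\<forall>\<^sub>F n in sequentially. L k (u n) \<le> max (L k t) (Q n)"
    proof eventually_elim
      case (elim n)
      have "running_sup {0..} (push W L k) (u n) \<le> max (L k t) (Q n)"
      proof (rule running_sup_least[OF zero_in_halfline])
        fix s assume s: "0 \<le> s" "s \<le> u n"
        show "push W L k s \<le> max (L k t) (Q n)"
        proof (cases "s \<le> t")
          case True
          then show ?thesis using collision_limit_push_le[OF that s(1) True] unfolding L_def by linarith
        next
          case False
          have "dist (W k s - W (Suc k) s) (W k t - W (Suc k) t) < e"
            using elim s False u(2)[of n] by (intro d(2)) (auto simp: dist_real_def)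
          moreover have "qp k * L (k - 1) s \<le> qp k * L (k - 1) (u n)"
            "qm (Suc k) * L (Suc k) s \<le> qm (Suc k) * L (Suc k) (u n)"
            unfolding L_def using that q_pos[of k] q_pos[of "Suc k"] s
            by (auto intro!: mult_left_mono collision_limit_mono)
          ultimately have "push W L k s \<le> Q n" unfolding push_def Q_def dist_real_def by linarith
          then show ?thesis by simp
        qed
      qed (use u Lt in auto)
      then show ?case using collision_limit_fixpoint[OF u(1) that, of n] by (simp add: L_def)
    qed
    then have "p k \<le> max (L k t) (W k t - W (Suc k) t + e + qp k * p (k - 1) + qm (Suc k) * p (Suc k))"
      by (intro tendsto_le[OF _ tendsto_max[OF tendsto_const Q_lim] p]) auto
    then show "p k \<le> max (L k t) (push W P k t) + e"
      unfolding push_def P_def using \<open>e > 0\<close> by (auto simp: max_def split: if_splits)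
  qed
  define \<delta> where "\<delta> k = p k - L k t" for k
  have \<delta>_0: "\<delta> 0 = 0"
    using p[of 0] unfolding \<delta>_def L_def collision_limit_0 by (simp add: LIMSEQ_const_iff)
  have jump: "p k = push W P k t" if "1 \<le> k" "\<delta> k > 0" for k
    using le_push[OF that(1)] push_le[OF that(1)] that(2) unfolding \<delta>_def by linarith
  have sub: "\<delta> k \<le> qp k * \<delta> (k - 1) + qm (Suc k) * \<delta> (Suc k)" if "1 \<le> k" "\<delta> k > 0" for k
  proof -
    have "push W L k t \<le> L k t" unfolding L_def by (intro collision_limit_push_le that assms) simp
    then have "\<delta> k \<le> push W P k t - push W L k t" using jump[OF that] unfolding \<delta>_def by linarith
    also have "\<dots> = qp k * \<delta> (k - 1) + qm (Suc k) * \<delta> (Suc k)"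
      unfolding push_def P_def \<delta>_def by (simp add: algebra_simps)
    finally show ?thesis .
  qed
  have "\<delta> k = 0"
  proof (rule ccontr)
    assume k: "\<delta> k \<noteq> 0"
    \<comment> \<open>A zero at some \<open>m\<close> beyond \<open>k\<close>, together with the
      zero at index 0, would kill the jump at \<open>k\<close> by the maximum principle. So one jump
      forces jumps at all larger indices.\<close>
    have pos: "\<delta> m > 0" if "k < m" for m
    proof (rule ccontr)
      assume "\<not> \<delta> m > 0"
      moreover have "\<delta> m \<ge> 0" using p_ge by (simp add: \<delta>_def)
      ultimately have "\<delta> m = 0" by simp
      then have "\<delta> k = 0"
        using p_ge by (intro subharmonic_vanishes[of \<delta> m k] \<delta>_0 sub that) (auto simp: \<delta>_def)
      then show False using k by simp
    qed
    define c where "c = ranked W P (Suc k) t"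
    have coal: "ranked W P (Suc k + j) t = c" for j
    proof (induction j)
      case (Suc j)
      have "ranked W P (Suc (Suc k + j)) t - ranked W P (Suc k + j) t
          = P (Suc k + j) t - push W P (Suc k + j) t" by (rule ranked_gap) simp
      also have "\<dots> = 0" using jump[of "Suc k + j"] pos[of "Suc k + j"] by (simp add: P_def)
      finally show ?case using Suc by simp
    qed (simp add: c_def)
    obtain K where K: "\<And>s m. s \<in> {0..t + 1} \<Longrightarrow>
        (\<Sum>k=1..m. max 0 (c + 1 - ranked W (collision_limit W) k s)) \<le> K"
      using collision_limit_controlled[of "t + 1" "c + 1"] by blast
    have K': "(\<Sum>k=1..m. max 0 (c + 1 - ranked W P k t)) \<le> K" for m
    proof (rule LIMSEQ_le_const2)
      show "(\<lambda>n. \<Sum>k=1..m. max 0 (c + 1 - ranked W L k (u n)))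
          \<longlonglongrightarrow> (\<Sum>k=1..m. max 0 (c + 1 - ranked W P k t))"
        by (intro tendsto_intros ranked_lim)
    qed (use K u in \<open>auto simp: L_def\<close>)
    \<comment> \<open>At level \<open>c + 1\<close> every coalesced particle costs exactly 1; this
      range contains more than \<open>K\<close> of them.\<close>
    define m where "m = Suc k + nat \<lceil>K\<rceil>"
    have "real (card {Suc k..m}) = (\<Sum>j\<in>{Suc k..m}. max 0 (c + 1 - ranked W P j t))"
    proof -
      have "max 0 (c + 1 - ranked W P j t) = 1" if "j \<in> {Suc k..m}" for j
        using coal[of "j - Suc k"] that by simp
      then show ?thesis by simp
    qed
    also have "\<dots> \<le> (\<Sum>k=1..m. max 0 (c + 1 - ranked W P k t))" by (intro sum_mono2) auto
    also have "\<dots> \<le> K" by (rule K')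
    finally show False unfolding m_def by simp linarith
  qed
  then show ?thesis using p[of k] unfolding \<delta>_def L_def u_def by simp
qed

text \<open>From the left, continuity comes from monotonicity in time and the lower bound by a
  continuous finite solution that is nearly maximal at \<open>t\<close>; from the right it is
  \<open>collision_limit_right_limit\<close> combined with monotonicity.\<close>

lemma collision_limit_continuous: "continuous_on {0..} (collision_limit W k)"
  unfolding continuous_on_iff
proof (intro ballI allI impI)
  fix t e :: real assume t: "t \<in> {0..}" and "e > 0"
  let ?L = "collision_limit W k"
  have "\<forall>\<^sub>F n in sequentially. ?L (t + 1 / real (Suc n)) < ?L t + e"
    using collision_limit_right_limit[of t k] by (rule order_tendstoD) (use t \<open>e > 0\<close> in auto)
  then obtain n where n: "?L (t + 1 / real (Suc n)) < ?L t + e"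
    using eventually_happens'[OF sequentially_bot] by blast
  have "\<forall>\<^sub>F N in sequentially. ?L t - e / 2 < skorokhod {0..} N W k t"
    using collision_limit_tendsto[of t k] by (rule order_tendstoD) (use t \<open>e > 0\<close> in auto)
  then obtain N where N: "?L t - e / 2 < skorokhod {0..} N W k t"
    using eventually_happens'[OF sequentially_bot] by blast
  have "\<exists>d>0. \<forall>s\<in>{0..}. dist s t < d \<longrightarrow>
      dist (skorokhod {0..} N W k s) (skorokhod {0..} N W k t) < e / 2"
    using skorokhod_continuous[OF W_cont, where N = N and k = k] t \<open>e > 0\<close>
    unfolding continuous_on_iff by (meson half_gt_zero)
  then obtain d where d: "d > 0" "\<And>s. s \<in> {0..} \<Longrightarrow> dist s t < d \<Longrightarrow>
      dist (skorokhod {0..} N W k s) (skorokhod {0..} N W k t) < e / 2" by blast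
  show "\<exists>d>0. \<forall>s\<in>{0..}. dist s t < d \<longrightarrow> dist (?L s) (?L t) < e"
  proof (intro exI[of _ "min d (1 / real (Suc n))"] conjI ballI impI)
    fix s assume s: "s \<in> {0::real..}" "dist s t < min d (1 / real (Suc n))"
    show "dist (?L s) (?L t) < e"
    proof (cases "s \<le> t")
      case True
      have "?L t - e < skorokhod {0..} N W k s"
      proof -
        have "dist (skorokhod {0..} N W k s) (skorokhod {0..} N W k t) < e / 2" using d(2)[OF s(1)] s(2) by simp
        then show ?thesis using N unfolding dist_real_def by linarith
      qed
      then show ?thesis
        using skorokhod_le_collision_limit[where t = s and N = N and k = k] collision_limit_mono[of s t k] True s
        by (auto simp: dist_real_def)
    next
      case False
      then have "s \<le> t + 1 / real (Suc n)" using s(2) by (auto simp: dist_real_def)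
      then have "?L s < ?L t + e" using collision_limit_mono[of s "t + 1 / real (Suc n)" k] s n by auto
      then show ?thesis using collision_limit_mono[of t s k] False t by (auto simp: dist_real_def)
    qed
  qed (use d in auto)
qed

lemma collision_limit_uniform:
  "uniform_limit {0..T} (\<lambda>N. skorokhod {0..} N W k) (collision_limit W k) sequentially"
proof (rule uniform_limit_monotone_functions)
  show "skorokhod {0..} N W k s \<le> skorokhod {0..} N W k t" if "0 \<le> s" "s \<le> t" for N s t
    by (rule skorokhod_mono_time[OF zero_in_halfline W_lb that])
qed (simp_all add: collision_limit_mono skorokhod_le_collision_limit
      collision_limit_tendsto collision_limit_continuous)

lemma ranked_limit_uniform:
  "uniform_limit {0..T} (\<lambda>N. ranked W (skorokhod {0..} N W) k) (ranked W (collision_limit W) k) sequentially"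
proof (rule uniform_limitI)
  fix e :: real assume "e > 0"
  let ?C = "1 + \<bar>qp k\<bar> + \<bar>qm k\<bar>"
  have C: "?C > 0" by linarith
  have u: "\<forall>\<^sub>F N in sequentially. \<forall>t\<in>{0..T}. dist (skorokhod {0..} N W j t) (collision_limit W j t) < e / ?C" for j
    using collision_limit_uniform by (rule uniform_limitD) (use \<open>e > 0\<close> C in simp)
  show "\<forall>\<^sub>F N in sequentially. \<forall>t\<in>{0..T}.
      dist (ranked W (skorokhod {0..} N W) k t) (ranked W (collision_limit W) k t) < e"
    using u[of "k - 1"] u[of k]
  proof (eventually_elim, intro ballI)
    case (elim N)
    fix t assume t: "t \<in> {0..T}"
    let ?a = "skorokhod {0..} N W (k - 1) t - collision_limit W (k - 1) t"
    let ?b = "skorokhod {0..} N W k t - collision_limit W k t"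
    have ab: "\<bar>?a\<bar> < e / ?C" "\<bar>?b\<bar> < e / ?C" using elim t by (auto simp: dist_real_def)
    have "dist (ranked W (skorokhod {0..} N W) k t) (ranked W (collision_limit W) k t)
        = \<bar>qp k * ?a - qm k * ?b\<bar>"
      unfolding ranked_def dist_real_def by (simp add: algebra_simps)
    also have "\<dots> \<le> \<bar>qp k\<bar> * \<bar>?a\<bar> + \<bar>qm k\<bar> * \<bar>?b\<bar>" by (metis abs_mult abs_triangle_ineq4)
    also have "\<dots> \<le> \<bar>qp k\<bar> * (e / ?C) + \<bar>qm k\<bar> * (e / ?C)"
      using ab by (intro add_mono mult_left_mono) auto
    also have "\<dots> < ?C * (e / ?C)" using C \<open>e > 0\<close> by (simp add: algebra_simps add_divide_distrib[symmetric] divide_strict_right_mono)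
    also have "\<dots> = e" using C by simp
    finally show "dist (ranked W (skorokhod {0..} N W) k t) (ranked W (collision_limit W) k t) < e" .
  qed
qed

end

end

section \<open>Convex costs and Gaussian smoothing\<close>

text \<open>Doob's inequality with the supermartingale property asked only in integrated form, on
  the events that the level has not yet been reached. The induction keeps account of
  \<open>K\<close> for each crossed outcome plus the current value on the others.\<close>

lemma maximal_inequality:
  fixes S :: "nat \<Rightarrow> 'a \<Rightarrow> ennreal"
  assumes meas[measurable]: "\<And>i. S i \<in> borel_measurable M"
    and step: "\<And>i. i < m \<Longrightarrow>
      (\<integral>\<^sup>+\<omega>. S (Suc i) \<omega> * indicator {\<omega> \<in> space M. \<forall>j\<le>i. S j \<omega> < K} \<omega> \<partial>M)
      \<le> (\<integral>\<^sup>+\<omega>. S i \<omega> * indicator {\<omega> \<in> space M. \<forall>j\<le>i. S j \<omega> < K} \<omega> \<partial>M)"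
  shows "K * emeasure M {\<omega> \<in> space M. \<exists>i\<le>m. K \<le> S i \<omega>} \<le> (\<integral>\<^sup>+\<omega>. S 0 \<omega> \<partial>M)"
proof -
  define B where "B i = {\<omega> \<in> space M. \<forall>j\<le>i. S j \<omega> < K}" for i
  define E where "E i = {\<omega> \<in> space M. \<exists>j\<le>i. K \<le> S j \<omega>}" for i
  have [measurable]: "B i \<in> sets M" "E i \<in> sets M" for i unfolding B_def E_def by measurable
  have "K * emeasure M (E i) + (\<integral>\<^sup>+\<omega>. S i \<omega> * indicator (B i) \<omega> \<partial>M) \<le> (\<integral>\<^sup>+\<omega>. S 0 \<omega> \<partial>M)"
    if "i \<le> m" for i
    using that
  proof (induction i)
    case 0
    have "K * emeasure M (E 0) + (\<integral>\<^sup>+\<omega>. S 0 \<omega> * indicator (B 0) \<omega> \<partial>M)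
        = (\<integral>\<^sup>+\<omega>. K * indicator (E 0) \<omega> + S 0 \<omega> * indicator (B 0) \<omega> \<partial>M)"
      by (subst nn_integral_add) (auto simp: nn_integral_cmult_indicator)
    also have "\<dots> \<le> (\<integral>\<^sup>+\<omega>. S 0 \<omega> \<partial>M)"
      by (intro nn_integral_mono) (auto simp: E_def B_def indicator_def)
    finally show ?case .
  next
    case (Suc i)
    \<comment> \<open>The event of a first crossing at \<open>Suc i\<close>; there
      \<open>S (Suc i)\<close> is at least \<open>K\<close> and pays for the growth of
      \<open>E\<close>.\<close>
    define D where "D = {\<omega> \<in> B i. K \<le> S (Suc i) \<omega>}"
    have [measurable]: "D \<in> sets M"
    proof -
      have "D = B i \<inter> {\<omega> \<in> space M. K \<le> S (Suc i) \<omega>}" by (auto simp: D_def B_def)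
      also have "\<dots> \<in> sets M" by measurable
      finally show ?thesis .
    qed
    have ED: "E (Suc i) \<subseteq> E i \<union> D"
      by (auto simp: E_def D_def B_def le_Suc_eq not_less)
    have "emeasure M (E (Suc i)) \<le> emeasure M (E i) + emeasure M D"
      by (rule order_trans[OF emeasure_mono[OF ED]]) (auto intro!: emeasure_subadditive)
    then have "K * emeasure M (E (Suc i)) + (\<integral>\<^sup>+\<omega>. S (Suc i) \<omega> * indicator (B (Suc i)) \<omega> \<partial>M)
        \<le> K * (emeasure M (E i) + emeasure M D) + (\<integral>\<^sup>+\<omega>. S (Suc i) \<omega> * indicator (B (Suc i)) \<omega> \<partial>M)"
      by (intro add_mono mult_left_mono) auto
    also have "\<dots> = K * emeasure M (E i)
        + (K * emeasure M D + (\<integral>\<^sup>+\<omega>. S (Suc i) \<omega> * indicator (B (Suc i)) \<omega> \<partial>M))"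
      by (simp add: distrib_left add.assoc)
    also have "K * emeasure M D + (\<integral>\<^sup>+\<omega>. S (Suc i) \<omega> * indicator (B (Suc i)) \<omega> \<partial>M)
        = (\<integral>\<^sup>+\<omega>. K * indicator D \<omega> + S (Suc i) \<omega> * indicator (B (Suc i)) \<omega> \<partial>M)"
      by (subst nn_integral_add) (auto simp: nn_integral_cmult_indicator)
    also have "\<dots> \<le> (\<integral>\<^sup>+\<omega>. S (Suc i) \<omega> * indicator (B i) \<omega> \<partial>M)"
      by (intro nn_integral_mono) (auto simp: D_def B_def indicator_def)
    also have "\<dots> \<le> (\<integral>\<^sup>+\<omega>. S i \<omega> * indicator (B i) \<omega> \<partial>M)"
      using step[of i] Suc.prems by (simp add: B_def)
    finally show ?case using Suc by (meson Suc_leD add_left_mono order_trans)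
  qed
  from order_trans[OF _ this[OF order_refl]] show ?thesis by (simp add: E_def)
qed

definition gauss :: "real \<Rightarrow> real measure" where
  "gauss h = density lborel (normal_density 0 (sqrt h))"

lemma sets_gauss [simp, measurable_cong]: "sets (gauss h) = sets borel"
  by (simp add: gauss_def)

lemma space_gauss [simp]: "space (gauss h) = UNIV"
  by (simp add: gauss_def)

lemma prob_space_gauss: "h > 0 \<Longrightarrow> prob_space (gauss h)"
  unfolding gauss_def by (intro prob_space_normal_density) simp

lemma integral_gauss:
  fixes f :: "real \<Rightarrow> real"
  assumes "f \<in> borel_measurable borel"
  shows "(\<integral>z. f z \<partial>gauss h) = (\<integral>z. normal_density 0 (sqrt h) z * f z \<partial>lborel)"
  unfolding gauss_def using assms by (subst integral_density) auto

lemma integral_gauss_uminus: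
  fixes f :: "real \<Rightarrow> real"
  assumes [measurable]: "f \<in> borel_measurable borel"
  shows "(\<integral>z. f (- z) \<partial>gauss h) = (\<integral>z. f z \<partial>gauss h)"
proof -
  have "(\<integral>z. normal_density 0 (sqrt h) z * f z \<partial>lborel)
      = \<bar>-1\<bar> *\<^sub>R (\<integral>z. normal_density 0 (sqrt h) (0 + (-1) * z) * f (0 + (-1) * z) \<partial>lborel)"
    by (rule lborel_integral_real_affine) simp
  then show ?thesis by (auto simp: integral_gauss normal_density_def)
qed

lemma integrable_gauss_abs: "h > 0 \<Longrightarrow> integrable (gauss h) (\<lambda>z. \<bar>z\<bar>)"
  unfolding gauss_def
  using integrable_normal_moment_abs[of "sqrt h" 0 1] by (subst integrable_density) auto

lemma gauss_exponential:
  assumes "h > 0"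
  shows "integrable (gauss h) (\<lambda>z. exp (b * z))" "(\<integral>z. exp (b * z) \<partial>gauss h) = exp (b\<^sup>2 * h / 2)"
proof -
  have eq: "normal_density 0 (sqrt h) z * exp (b * z)
      = exp (b\<^sup>2 * h / 2) * normal_density (b * h) (sqrt h) z" for z
  proof -
    have "- z\<^sup>2 / (2 * h) + b * z = b\<^sup>2 * h / 2 + - (z - b * h)\<^sup>2 / (2 * h)"
      using assms by (simp add: field_simps power2_eq_square)
    then show ?thesis
      using assms by (simp add: normal_density_def exp_add[symmetric])
  qed
  show "integrable (gauss h) (\<lambda>z. exp (b * z))"
    unfolding gauss_def using assms by (subst integrable_density) (auto simp: eq)
  show "(\<integral>z. exp (b * z) \<partial>gauss h) = exp (b\<^sup>2 * h / 2)"
    using assms by (simp add: integral_gauss eq)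
qed

text \<open>Closed under \<open>smooth\<close>. The Lipschitz condition yields continuity and
  Gaussian integrability; monotonicity and convexity drive the comparison of drifts, variances and
  reflections.\<close>

definition cost :: "(real \<Rightarrow> real) \<Rightarrow> bool" where
  "cost \<phi> \<longleftrightarrow> (\<forall>x. 0 \<le> \<phi> x) \<and> antimono \<phi> \<and> convex_on UNIV \<phi> \<and> (\<forall>x y. \<bar>\<phi> x - \<phi> y\<bar> \<le> \<bar>x - y\<bar>)"

lemma
  assumes "cost \<phi>"
  shows cost_nonneg: "0 \<le> \<phi> x" and cost_antimono: "x \<le> y \<Longrightarrow> \<phi> y \<le> \<phi> x"
    and cost_convex: "convex_on UNIV \<phi>" and cost_lipschitz: "\<bar>\<phi> x - \<phi> y\<bar> \<le> \<bar>x - y\<bar>"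
  using assms by (auto simp: cost_def antimono_def)

lemma cost_measurable:
  assumes "cost \<phi>" shows "\<phi> \<in> borel_measurable borel"
proof (rule borel_measurable_continuous_onI)
  show "continuous_on UNIV \<phi>"
    unfolding continuous_on_iff
  proof (intro ballI allI impI)
    fix x e :: real assume "e > 0"
    then show "\<exists>d>0. \<forall>y\<in>UNIV. dist y x < d \<longrightarrow> dist (\<phi> y) (\<phi> x) < e"
      using cost_lipschitz[OF assms] by (intro exI[of _ e]) (auto simp: dist_real_def intro: le_less_trans)
  qed
qed

lemma cost_integrable:
  assumes "cost \<phi>" "h > 0" shows "integrable (gauss h) (\<lambda>z. \<phi> (a + b * z))"
proof (rule Bochner_Integration.integrable_bound)
  interpret prob_space "gauss h" using assms(2) by (rule prob_space_gauss)
  show "integrable (gauss h) (\<lambda>z. \<phi> a + \<bar>b\<bar> * \<bar>z\<bar>)"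
    using integrable_gauss_abs[OF assms(2)] by auto
  show "(\<lambda>z. \<phi> (a + b * z)) \<in> borel_measurable (gauss h)"
    using cost_measurable[OF assms(1)] by simp
  have "\<bar>\<phi> (a + b * z)\<bar> \<le> \<phi> a + \<bar>b\<bar> * \<bar>z\<bar>" for z
    using cost_lipschitz[OF assms(1), of "a + b * z" a] cost_nonneg[OF assms(1)] by (auto simp: abs_mult)
  then show "AE z in gauss h. norm (\<phi> (a + b * z)) \<le> norm (\<phi> a + \<bar>b\<bar> * \<bar>z\<bar>)"
    by (intro AE_I2) (auto intro: order_trans[OF _ abs_ge_self])
qed

text \<open>Jensen in symmetric form: \<open>a + r * z\<close> is a convex combination of
  \<open>a + s * z\<close> and \<open>a - s * z\<close> with a weight independent of
  \<open>z\<close>, and both ends have the same integral by symmetry of the Gaussian. So larger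
  variance means larger cost.\<close>

lemma cost_integral_mono_scale:
  assumes "cost \<phi>" "h > 0" "0 \<le> r" "r \<le> s" "0 < s"
  shows "(\<integral>z. \<phi> (a + r * z) \<partial>gauss h) \<le> (\<integral>z. \<phi> (a + s * z) \<partial>gauss h)"
proof -
  define \<theta> where "\<theta> = (1 + r / s) / 2"
  have \<theta>: "0 \<le> \<theta>" "\<theta> \<le> 1" using assms by (auto simp: \<theta>_def)
  have le: "\<phi> (a + r * z) \<le> \<theta> * \<phi> (a + s * z) + (1 - \<theta>) * \<phi> (a + (- s) * z)" for z
  proof -
    have "a + r * z = \<theta> * (a + s * z) + (1 - \<theta>) * (a + (- s) * z)"
      using assms by (simp add: \<theta>_def field_simps)
    then show ?thesis
      using convex_onD[OF cost_convex[OF assms(1)] \<theta>, of "a + (- s) * z" "a + s * z"]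
      by (simp add: add.commute)
  qed
  have sym: "(\<integral>z. \<phi> (a + (- s) * z) \<partial>gauss h) = (\<integral>z. \<phi> (a + s * z) \<partial>gauss h)"
    using integral_gauss_uminus[of "\<lambda>z. \<phi> (a + s * z)" h] cost_measurable[OF assms(1)] by simp
  have "(\<integral>z. \<phi> (a + r * z) \<partial>gauss h)
      \<le> (\<integral>z. \<theta> * \<phi> (a + s * z) + (1 - \<theta>) * \<phi> (a + (- s) * z) \<partial>gauss h)"
    using le by (intro integral_mono cost_integrable[OF assms(1,2)] Bochner_Integration.integrable_add
        integrable_mult_right) auto
  also have "\<dots> = \<theta> * (\<integral>z. \<phi> (a + s * z) \<partial>gauss h) + (1 - \<theta>) * (\<integral>z. \<phi> (a + (- s) * z) \<partial>gauss h)"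
    by (subst Bochner_Integration.integral_add)
      (use cost_integrable[OF assms(1,2), of a s] cost_integrable[OF assms(1,2), of a "- s"] in auto)
  also have "\<dots> = (\<integral>z. \<phi> (a + s * z) \<partial>gauss h)" unfolding sym by (simp add: algebra_simps)
  finally show ?thesis .
qed

text \<open>The expected cost after time \<open>h\<close> of a free particle with drift
  \<open>c\<close> and volatility \<open>s\<close>. With \<open>c\<close> a lower bound of all
  drifts and \<open>s\<close> an upper bound of all volatilities, this single operator dominates the
  step of every particle.\<close>

definition smooth :: "real \<Rightarrow> real \<Rightarrow> real \<Rightarrow> (real \<Rightarrow> real) \<Rightarrow> real \<Rightarrow> real" where
  "smooth c s h \<phi> x = (\<integral>z. \<phi> (x + c * h + s * z) \<partial>gauss h)"

context
  fixes c s h :: real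
  assumes h: "h > 0" and s: "s > 0" and c: "c \<le> 0"
begin

lemma smooth_cost:
  assumes "cost \<phi>" shows "cost (smooth c s h \<phi>)"
  unfolding cost_def
proof (intro conjI allI)
  interpret prob_space "gauss h" using h by (rule prob_space_gauss)
  note int = cost_integrable[OF assms h]
  show "0 \<le> smooth c s h \<phi> x" for x
    unfolding smooth_def using cost_nonneg[OF assms] by simp
  show "antimono (smooth c s h \<phi>)"
    unfolding smooth_def by (intro antimonoI integral_mono int cost_antimono[OF assms]) auto
  show "convex_on UNIV (smooth c s h \<phi>)"
  proof (rule convex_onI)
    fix t x y :: real assume t: "0 < t" "t < 1"
    have "smooth c s h \<phi> ((1 - t) *\<^sub>R x + t *\<^sub>R y)
        \<le> (\<integral>z. (1 - t) * \<phi> (x + c * h + s * z) + t * \<phi> (y + c * h + s * z) \<partial>gauss h)"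
      unfolding smooth_def
    proof (intro integral_mono int Bochner_Integration.integrable_add integrable_mult_right)
      fix z
      have "(1 - t) *\<^sub>R x + t *\<^sub>R y + c * h + s * z
          = (1 - t) *\<^sub>R (x + c * h + s * z) + t *\<^sub>R (y + c * h + s * z)"
        by (simp add: algebra_simps)
      then show "\<phi> ((1 - t) *\<^sub>R x + t *\<^sub>R y + c * h + s * z)
          \<le> (1 - t) * \<phi> (x + c * h + s * z) + t * \<phi> (y + c * h + s * z)"
        using convex_onD[OF cost_convex[OF assms], of t "x + c * h + s * z" "y + c * h + s * z"] t
        by simp
    qed
    also have "\<dots> = (1 - t) * smooth c s h \<phi> x + t * smooth c s h \<phi> y"
      unfolding smooth_def
      by (subst Bochner_Integration.integral_add) (auto intro!: int integrable_mult_right)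
    finally show "smooth c s h \<phi> ((1 - t) *\<^sub>R x + t *\<^sub>R y)
        \<le> (1 - t) * smooth c s h \<phi> x + t * smooth c s h \<phi> y" .
  qed simp
  show "\<bar>smooth c s h \<phi> x - smooth c s h \<phi> y\<bar> \<le> \<bar>x - y\<bar>" for x y
  proof -
    have "smooth c s h \<phi> x - smooth c s h \<phi> y
        = (\<integral>z. \<phi> (x + c * h + s * z) - \<phi> (y + c * h + s * z) \<partial>gauss h)"
      unfolding smooth_def by (subst Bochner_Integration.integral_diff) (auto intro!: int)
    then have "\<bar>smooth c s h \<phi> x - smooth c s h \<phi> y\<bar> \<le> (\<integral>z. \<bar>\<phi> (x + c * h + s * z) - \<phi> (y + c * h + s * z)\<bar> \<partial>gauss h)"
      by (simp only: integral_abs_bound)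
    also have "\<dots> \<le> (\<integral>z. \<bar>x - y\<bar> \<partial>gauss h)"
    proof (rule integral_mono)
      show "integrable (gauss h) (\<lambda>z. \<bar>\<phi> (x + c * h + s * z) - \<phi> (y + c * h + s * z)\<bar>)"
        by (intro integrable_abs Bochner_Integration.integrable_diff int)
      show "\<bar>\<phi> (x + c * h + s * z) - \<phi> (y + c * h + s * z)\<bar> \<le> \<bar>x - y\<bar>" for z
        using cost_lipschitz[OF assms, of "x + c * h + s * z" "y + c * h + s * z"] by simp
    qed simp
    finally show ?thesis
    by (simp add: prob_space[unfolded space_gauss])
  qed
qed

text \<open>The drift \<open>c\<close> is nonpositive and points towards higher cost, and Jensen
  handles the noise. It lets the smoothed cost at an intermediate time dominate the original
  one.\<close>

lemma smooth_ge:
  assumes "cost \<phi>" shows "\<phi> x \<le> smooth c s h \<phi> x"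
proof -
  interpret prob_space "gauss h" using h by (rule prob_space_gauss)
  have "c * h \<le> 0" using c h by (simp add: mult_nonpos_nonneg)
  then have "\<phi> x \<le> \<phi> (x + c * h)" using cost_antimono[OF assms] by simp
  also have "\<dots> \<le> smooth c s h \<phi> x"
    unfolding smooth_def
    using cost_integral_mono_scale[OF assms h, of 0 s "x + c * h"] s
    by (simp add: prob_space[unfolded space_gauss])
  finally show ?thesis .
qed

lemma smooth_dominates:
  assumes "cost \<phi>" "c \<le> g" "0 \<le> r" "r \<le> s"
  shows "(\<integral>z. \<phi> (x + g * h + r * z) \<partial>gauss h) \<le> smooth c s h \<phi> x"
proof -
  have "c * h \<le> g * h" using assms h by simp
  then have "(\<integral>z. \<phi> (x + g * h + r * z) \<partial>gauss h) \<le> (\<integral>z. \<phi> (x + c * h + r * z) \<partial>gauss h)"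
    by (intro integral_mono cost_integrable[OF assms(1) h] cost_antimono[OF assms(1)]) auto
  also have "\<dots> \<le> smooth c s h \<phi> x"
    unfolding smooth_def using assms s by (intro cost_integral_mono_scale h) auto
  finally show ?thesis .
qed

text \<open>Exponentials are eigenfunctions of \<open>smooth\<close>. Iterating multiplies the
  exponent of the eigenvalue by the number of steps, so the result depends on the grid only through
  the elapsed time.\<close>

lemma smooth_exponential_bound:
  assumes "cost \<phi>" "\<And>x. \<phi> x \<le> A * exp (- l * x)"
  shows "smooth c s h \<phi> x \<le> A * exp (h * (- l * c + (l * s)\<^sup>2 / 2)) * exp (- l * x)"
proof -
  have eq: "A * exp (- l * (x + c * h + s * z)) = A * exp (- l * (x + c * h)) * exp (- (l * s) * z)" for z
    by (simp add: exp_add[symmetric] algebra_simps)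
  have "smooth c s h \<phi> x \<le> (\<integral>z. A * exp (- l * (x + c * h)) * exp (- (l * s) * z) \<partial>gauss h)"
    unfolding smooth_def
  proof (intro integral_mono cost_integrable[OF assms(1) h] integrable_mult_right gauss_exponential(1) h)
    show "\<phi> (x + c * h + s * z) \<le> A * exp (- l * (x + c * h)) * exp (- (l * s) * z)" for z
      unfolding eq[symmetric] by (rule assms(2))
  qed
  also have "\<dots> = A * exp (- l * (x + c * h)) * exp ((- (l * s))\<^sup>2 * h / 2)"
    by (simp only: integral_mult_right_zero gauss_exponential(2)[OF h])
  also have "\<dots> = A * exp (h * (- l * c + (l * s)\<^sup>2 / 2)) * exp (- l * x)"
    by (simp add: exp_add[symmetric] algebra_simps)
  finally show ?thesis .
qed

lemma smooth_funpow_cost: "cost \<phi> \<Longrightarrow> cost ((smooth c s h ^^ m) \<phi>)"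
  by (induction m) (auto intro: smooth_cost)

lemma smooth_funpow_ge: "cost \<phi> \<Longrightarrow> \<phi> x \<le> (smooth c s h ^^ m) \<phi> x"
proof (induction m)
  case (Suc m)
  then show ?case using smooth_ge[OF smooth_funpow_cost[OF Suc.prems], where x = x] order_trans by auto
qed simp

lemma smooth_funpow_exponential_bound:
  assumes "cost \<phi>" "\<And>x. \<phi> x \<le> A * exp (- l * x)"
  shows "(smooth c s h ^^ m) \<phi> x \<le> A * exp (real m * h * (- l * c + (l * s)\<^sup>2 / 2)) * exp (- l * x)"
proof (induction m arbitrary: x)
  case 0
  then show ?case using assms(2) by simp
next
  case (Suc m)
  have "(smooth c s h ^^ Suc m) \<phi> x \<le> A * exp (real m * h * (- l * c + (l * s)\<^sup>2 / 2))
      * exp (h * (- l * c + (l * s)\<^sup>2 / 2)) * exp (- l * x)"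
    using smooth_exponential_bound[OF smooth_funpow_cost[OF assms(1)] Suc.IH] by simp
  also have "\<dots> = A * exp (real (Suc m) * h * (- l * c + (l * s)\<^sup>2 / 2)) * exp (- l * x)"
    by (simp add: mult.assoc exp_add[symmetric]) (simp add: algebra_simps)
  finally show ?case .
qed

end

section \<open>Hinge costs and the initial total cost\<close>

lemma cost_hinge: "cost (\<lambda>x. max 0 (a - x))"
  unfolding cost_def
proof (intro conjI allI)
  show "convex_on UNIV (\<lambda>x. max 0 (a - x))"
  proof (rule convex_onI)
    fix t x y :: real assume t: "0 < t" "t < 1"
    have "0 \<le> (1 - t) * max 0 (a - x) + t * max 0 (a - y)" using t by auto
    moreover have "(1 - t) * (a - x) + t * (a - y) \<le> (1 - t) * max 0 (a - x) + t * max 0 (a - y)"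
      using t by (intro add_mono mult_left_mono) auto
    moreover have "a - ((1 - t) *\<^sub>R x + t *\<^sub>R y) = (1 - t) * (a - x) + t * (a - y)"
      by (simp add: algebra_simps)
    ultimately show "max 0 (a - ((1 - t) *\<^sub>R x + t *\<^sub>R y)) \<le> (1 - t) * max 0 (a - x) + t * max 0 (a - y)"
      by (intro max.boundedI) simp_all
  qed simp
qed (auto simp: antimono_def)

lemma hinge_exponential_bound:
  fixes l :: real
  assumes "l > 0" shows "max 0 (a - x) \<le> exp (l * a) / l * exp (- l * x)"
proof -
  have "l * (a - x) \<le> exp (l * (a - x))" using exp_ge_add_one_self[of "l * (a - x)"] by linarith
  then have "a - x \<le> exp (l * (a - x)) / l" using assms by (simp add: field_simps)
  moreover have "0 \<le> exp (l * (a - x)) / l" using assms by simp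
  moreover have "exp (l * (a - x)) / l = exp (l * a) / l * exp (- l * x)"
    by (simp add: exp_add[symmetric] algebra_simps)
  ultimately show ?thesis by simp
qed

lemma smooth_hinge_bound:
  assumes "h > 0" "s > 0" "c \<le> 0" "l > 0" "real m * h \<le> T"
  shows "(smooth c s h ^^ m) (\<lambda>x. max 0 (a - x)) x
    \<le> exp (l * (a - c * T - x) + l\<^sup>2 * (s\<^sup>2 * T) / 2) / l"
proof -
  have "(smooth c s h ^^ m) (\<lambda>x. max 0 (a - x)) x
      \<le> exp (l * a) / l * exp (real m * h * (- l * c + (l * s)\<^sup>2 / 2)) * exp (- l * x)"
    by (rule smooth_funpow_exponential_bound[OF assms(1-3) cost_hinge hinge_exponential_bound[OF assms(4)]])
  also have "\<dots> \<le> exp (l * a) / l * exp (T * (- l * c + (l * s)\<^sup>2 / 2)) * exp (- l * x)"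
  proof -
    \<comment> \<open>The rate is nonnegative because \<open>c\<close> is nonpositive, so the
      elapsed time \<open>real m * h\<close> may be replaced by \<open>T\<close>.\<close>
    have "l * c \<le> 0" using assms by (simp add: mult_nonneg_nonpos)
    then have "0 \<le> - l * c + (l * s)\<^sup>2 / 2" using zero_le_power2[of "l * s"] by linarith
    then have "real m * h * (- l * c + (l * s)\<^sup>2 / 2) \<le> T * (- l * c + (l * s)\<^sup>2 / 2)"
      using assms by (intro mult_right_mono) auto
    then show ?thesis using assms by (intro mult_right_mono mult_left_mono) auto
  qed
  also have "\<dots> = exp (l * (a - c * T - x) + l\<^sup>2 * (s\<^sup>2 * T) / 2) / l"
    by (simp add: exp_add[symmetric] algebra_simps power_mult_distrib)
  finally show ?thesis .
qed

text \<open>For a start at \<open>x\<close> far to the right the exponent is optimised at \<open>l = x / (2 v)\<close>,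
  which is what turns the hypothesis on \<open>exp (- \<alpha> y\<^sup>2)\<close> into a bound on the total cost.\<close>

lemma smooth_hinge_gaussian_bound:
  assumes "h > 0" "s > 0" "c \<le> 0" "real m * h \<le> T" "T > 0" "x \<ge> 1" "x \<ge> 2 * (a - c * T)"
  shows "(smooth c s h ^^ m) (\<lambda>x. max 0 (a - x)) x
    \<le> 2 * (s\<^sup>2 * T) * exp (- (1 / (8 * (s\<^sup>2 * T))) * x\<^sup>2)"
proof -
  define v where "v = s\<^sup>2 * T"
  define l where "l = x / (2 * v)"
  have v: "v > 0" using assms by (simp add: v_def)
  have l: "l > 0" using v assms by (simp add: l_def)
  have "(smooth c s h ^^ m) (\<lambda>x. max 0 (a - x)) x \<le> exp (l * (a - c * T - x) + l\<^sup>2 * v / 2) / l"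
    unfolding v_def by (rule smooth_hinge_bound[OF assms(1-3) l assms(4)])
  also have "\<dots> \<le> exp (- (1 / (8 * v)) * x\<^sup>2) / l"
  proof -
    \<comment> \<open>Here \<open>x\<close> being at least \<open>2 * (a - c * T)\<close> is used;
      the exponent becomes a quadratic in \<open>l\<close> with minimum at the chosen
      \<open>l\<close>.\<close>
    have "l * (a - c * T - x) \<le> l * (- x / 2)" using l assms by (intro mult_left_mono) auto
    also have "l * (- x / 2) + l\<^sup>2 * v / 2 = - (1 / (8 * v)) * x\<^sup>2"
      using v by (simp add: l_def power2_eq_square field_simps)
    finally have "l * (a - c * T - x) + l\<^sup>2 * v / 2 \<le> - (1 / (8 * v)) * x\<^sup>2" by simp
    then show ?thesis using l by (intro divide_right_mono) auto
  qed
  also have "\<dots> = 2 * v / x * exp (- (1 / (8 * v)) * x\<^sup>2)" by (simp add: l_def)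
  also have "\<dots> \<le> 2 * v * exp (- (1 / (8 * v)) * x\<^sup>2)"
  proof (rule mult_right_mono)
    have "2 * v / x \<le> 2 * v / 1" using v assms(6) by (intro divide_left_mono) auto
    then show "2 * v / x \<le> 2 * v" by simp
  qed simp
  finally show ?thesis by (simp add: v_def)
qed

lemma total_cost_bound:
  assumes y_mono: "\<And>n. n \<ge> 1 \<Longrightarrow> y n \<le> y (n + 1)"
    and y_sum: "\<And>\<alpha>. \<alpha> > 0 \<Longrightarrow> summable (\<lambda>n. exp (- \<alpha> * (y (Suc n))\<^sup>2))"
    and "s > 0" "c \<le> 0" "T > 0"
  shows "\<exists>C\<ge>0. \<forall>h>0. \<forall>m N. real m * h \<le> T \<longrightarrow>
    (\<Sum>k=1..N. (smooth c s h ^^ m) (\<lambda>x. max 0 (a - x)) (y k)) \<le> C"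
proof -
  define R where "R = max 1 (2 * (a - c * T))"
  define v where "v = s\<^sup>2 * T"
  have v: "v > 0" using assms by (simp add: v_def)
  \<comment> \<open>A majorant free of \<open>h\<close>, \<open>m\<close> and \<open>N\<close>: the
    Gaussian bound beyond \<open>R\<close>, and the crude bound with \<open>l = 1\<close> for the
    finitely many particles starting below \<open>R\<close>.\<close>
  define b where "b n = (if y (Suc n) \<ge> R then 2 * v * exp (- (1 / (8 * v)) * (y (Suc n))\<^sup>2)
    else exp (a - c * T - y (Suc n) + v / 2))" for n
  have mono: "y (Suc i) \<le> y (Suc j)" if "i \<le> j" for i j
    using that by (rule lift_Suc_mono_le[of "\<lambda>n. y (Suc n)", rotated]) (use y_mono[of "Suc n" for n] in simp)
  \<comment> \<open>Otherwise the sorted sequence \<open>y\<close> would be bounded, and the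
    summands with \<open>\<alpha> = 1\<close> could not tend to 0.\<close>
  have "\<exists>n. y (Suc n) \<ge> R"
  proof (rule ccontr)
    assume "\<not> ?thesis"
    then have lt: "y (Suc n) < R" for n by (auto simp: not_le)
    define D where "D = \<bar>y 1\<bar> + \<bar>R\<bar>"
    have "\<bar>y (Suc n)\<bar> \<le> D" for n using mono[of 0 n] lt[of n] by (auto simp: D_def)
    then have "(y (Suc n))\<^sup>2 \<le> D\<^sup>2" for n by (metis abs_ge_zero power2_abs power_mono)
    then have "exp (- (D\<^sup>2)) \<le> exp (- 1 * (y (Suc n))\<^sup>2)" for n by simp
    moreover have "(\<lambda>n. exp (- 1 * (y (Suc n))\<^sup>2)) \<longlonglongrightarrow> 0"
      using y_sum[of 1] by (intro summable_LIMSEQ_zero) simp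
    ultimately have "exp (- (D\<^sup>2)) \<le> 0" by (intro LIMSEQ_le_const) auto
    then show False by simp
  qed
  then obtain n0 where n0: "y (Suc n) \<ge> R" if "n \<ge> n0" for n using mono order_trans by meson
  have b0: "0 \<le> b n" for n using v by (simp add: b_def)
  have "summable (\<lambda>n. 2 * v * exp (- (1 / (8 * v)) * (y (Suc n))\<^sup>2))"
    using v by (intro summable_mult y_sum) simp
  moreover have "\<forall>\<^sub>F n in sequentially. 2 * v * exp (- (1 / (8 * v)) * (y (Suc n))\<^sup>2) = b n"
    using eventually_ge_at_top[of n0] by eventually_elim (simp add: b_def n0)
  ultimately have b_sum: "summable b" using summable_cong by force
  have le: "(smooth c s h ^^ m) (\<lambda>x. max 0 (a - x)) (y (Suc n)) \<le> b n"
    if "h > 0" "real m * h \<le> T" for h m n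
  proof (cases "y (Suc n) \<ge> R")
    case True
    then show ?thesis
      using smooth_hinge_gaussian_bound[of h s c m T "y (Suc n)" a] that assms
      by (simp add: b_def R_def v_def)
  next
    case False
    then show ?thesis
      using smooth_hinge_bound[of h s c 1 m T a "y (Suc n)"] that assms
      by (simp add: b_def v_def)
  qed
  have "(\<Sum>k=1..N. (smooth c s h ^^ m) (\<lambda>x. max 0 (a - x)) (y k)) \<le> suminf b"
    if "h > 0" "real m * h \<le> T" for h m N
  proof -
    have "(\<Sum>k=1..N. (smooth c s h ^^ m) (\<lambda>x. max 0 (a - x)) (y k))
        = (\<Sum>n<N. (smooth c s h ^^ m) (\<lambda>x. max 0 (a - x)) (y (Suc n)))"
      by (simp add: sum.atLeast1_atMost_eq)
    also have "\<dots> \<le> (\<Sum>n<N. b n)" by (intro sum_mono le that)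
    also have "\<dots> \<le> suminf b" using b_sum b0 by (intro sum_le_suminf) auto
    finally show ?thesis .
  qed
  then show ?thesis using suminf_nonneg[OF b_sum b0] by blast
qed

section \<open>Weights and the effect of one reflection on the cost\<close>

context collision begin

text \<open>Dividing by \<open>qp (Suc k)\<close> raises \<open>w (Suc k) * qp (Suc k)\<close> to
  \<open>w k\<close>, which dominates \<open>w k * qm k\<close>. From \<open>n0\<close> on,
  \<open>q_sum\<close> gives \<open>qm k\<close> at most \<open>qp (Suc k)\<close>, so the weight
  may stay constant; only finitely many divisions occur and the weights are bounded.\<close>

lemma collision_weights:
  assumes "\<exists>n0\<ge>1. \<forall>n\<ge>n0. qp n \<ge> 1 / 2" and q_le: "\<And>n. n \<ge> 1 \<Longrightarrow> qp n \<le> 1"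
  shows "\<exists>w C. \<forall>k\<ge>1. 1 \<le> w k \<and> w k \<le> (C::real) \<and> w k * qm k \<le> w (Suc k) * qp (Suc k)"
proof -
  obtain n0 where n0: "n0 \<ge> 1" "\<And>n. n \<ge> n0 \<Longrightarrow> qp n \<ge> 1 / 2" using assms by blast
  define w where "w = rec_nat (1::real) (\<lambda>k x. if Suc k \<ge> n0 then x else x / qp (Suc k))"
  have w0: "w 0 = 1" and wS: "w (Suc k) = (if Suc k \<ge> n0 then w k else w k / qp (Suc k))" for k
    by (simp_all add: w_def)
  have ge: "1 \<le> w k" for k
  proof (induction k)
    case (Suc k)
    have "w k \<le> w k / qp (Suc k)"
      using q_pos(1)[of "Suc k"] q_le[of "Suc k"] Suc by (simp add: le_divide_eq mult_left_le)
    then show ?case using Suc by (auto simp: wS)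
  qed (simp add: w0)
  have "w k \<le> w (Suc k)" for k
    using q_pos(1)[of "Suc k"] q_le[of "Suc k"] ge[of k]
    by (auto simp: wS le_divide_eq mult_left_le)
  then have inc: "i \<le> j \<Longrightarrow> w i \<le> w j" for i j by (rule lift_Suc_mono_le)
  have const: "w (n0 + j) = w n0" for j by (induction j) (auto simp: wS)
  have le: "w k \<le> w n0" for k
  proof (cases "k \<le> n0")
    case False
    then show ?thesis using const[of "k - n0"] by simp
  qed (rule inc)
  have "w k * qm k \<le> w (Suc k) * qp (Suc k)" if "k \<ge> 1" for k
  proof (cases "Suc k \<ge> n0")
    case True
    have "qm k \<le> qp (Suc k)" using n0(2)[OF True] q_sum[OF that] by linarith
    then show ?thesis using True ge[of k] by (simp add: wS mult_left_mono)
  next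
    case False
    have "qm k \<le> 1" using q_sum[OF that] q_pos(1)[of "Suc k"] by linarith
    then show ?thesis using False ge[of k] q_pos(1)[of "Suc k"] by (simp add: wS mult_left_le)
  qed
  then show ?thesis using ge le by blast
qed

text \<open>By convexity the change of the total cost is at most a combination of the pushes \<open>l k\<close>; since
  colliding particles share the same subgradient, the coefficient of \<open>l k\<close> has the sign of
  \<open>w k * qm k - w (Suc k) * qp (Suc k)\<close>.\<close>

lemma reflection_decreases_cost:
  assumes "cost \<phi>"
    and w: "\<And>k. 1 \<le> k \<Longrightarrow> 0 \<le> w k \<and> w k * qm k \<le> w (Suc k) * qp (Suc k)"
    and l: "\<And>k. 0 \<le> l k" "l 0 = 0" "l N = 0"
    and Z': "\<And>k. 1 \<le> k \<Longrightarrow> k \<le> N \<Longrightarrow> Z' k = Z k + qp k * l (k - 1) - qm k * l k"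
    and tie: "\<And>k. 1 \<le> k \<Longrightarrow> k < N \<Longrightarrow> l k > 0 \<Longrightarrow> Z' (Suc k) = Z' k"
  shows "(\<Sum>k=1..N. w k * \<phi> (Z' k)) \<le> (\<Sum>k=1..N. w k * \<phi> (Z k))"
proof -
  \<comment> \<open>The right derivative of \<open>\<phi>\<close>, a subgradient that depends on the
    position only; tied particles therefore have the same slope.\<close>
  define \<psi> where "\<psi> x = Inf ((\<lambda>t. (\<phi> x - \<phi> t) / (x - t)) ` ({x<..} \<inter> UNIV))" for x
  have sub: "\<phi> x + \<psi> x * (z - x) \<le> \<phi> z" for x z
    unfolding \<psi>_def by (rule convex_le_Inf_differential[OF cost_convex[OF assms(1)]]) auto
  have \<psi>: "\<psi> x \<le> 0" for x
    using sub[of x "x + 1"] cost_antimono[OF assms(1), of x "x + 1"] by simp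
  have "(\<Sum>k=1..N. w k * \<phi> (Z' k)) - (\<Sum>k=1..N. w k * \<phi> (Z k))
      = (\<Sum>k=1..N. w k * (\<phi> (Z' k) - \<phi> (Z k)))"
    by (simp add: sum_subtractf[symmetric] algebra_simps)
  also have "\<dots> \<le> (\<Sum>k=1..N. w k * (\<psi> (Z' k) * (qp k * l (k - 1) - qm k * l k)))"
  proof (intro sum_mono mult_left_mono)
    fix k assume k: "k \<in> {1..N}"
    show "\<phi> (Z' k) - \<phi> (Z k) \<le> \<psi> (Z' k) * (qp k * l (k - 1) - qm k * l k)"
    proof -
      have "Z k - Z' k = - (qp k * l (k - 1) - qm k * l k)" using Z'[of k] k by simp
      then show ?thesis using sub[of "Z' k" "Z k"] by (simp only: mult_minus_right)
    qed
  qed (use w in auto)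
  also have "\<dots> = (\<Sum>k=1..N. w k * \<psi> (Z' k) * qp k * l (k - 1)) - (\<Sum>k=1..N. w k * \<psi> (Z' k) * qm k * l k)"
    by (simp add: sum_subtractf[symmetric] algebra_simps)
  \<comment> \<open>Reindexing collects the two contributions of each push \<open>l k\<close>, one
    from either particle it acts on; the boundary terms vanish by \<open>l 0 = 0\<close> and
    \<open>l N = 0\<close>.\<close>
  also have "(\<Sum>k=1..N. w k * \<psi> (Z' k) * qp k * l (k - 1))
      = (\<Sum>k=0..<N. w (Suc k) * \<psi> (Z' (Suc k)) * qp (Suc k) * l k)"
    by (simp add: sum.atLeast1_atMost_eq atLeast0LessThan)
  also have "\<dots> = (\<Sum>k=1..<N. w (Suc k) * \<psi> (Z' (Suc k)) * qp (Suc k) * l k)"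
    by (rule sum.mono_neutral_right) (use l in \<open>auto simp: Suc_le_eq\<close>)
  also have "(\<Sum>k=1..N. w k * \<psi> (Z' k) * qm k * l k) = (\<Sum>k=1..<N. w k * \<psi> (Z' k) * qm k * l k)"
    by (rule sum.mono_neutral_right) (use l in \<open>auto simp: not_less le_antisym\<close>)
  also have "(\<Sum>k=1..<N. w (Suc k) * \<psi> (Z' (Suc k)) * qp (Suc k) * l k)
      - (\<Sum>k=1..<N. w k * \<psi> (Z' k) * qm k * l k)
      = (\<Sum>k=1..<N. w (Suc k) * \<psi> (Z' (Suc k)) * qp (Suc k) * l k - w k * \<psi> (Z' k) * qm k * l k)"
    by (simp add: sum_subtractf)
  also have "\<dots> \<le> 0"
  proof (rule sum_nonpos)
    fix k assume k: "k \<in> {1..<N}"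
    show "w (Suc k) * \<psi> (Z' (Suc k)) * qp (Suc k) * l k - w k * \<psi> (Z' k) * qm k * l k \<le> 0"
    proof (cases "l k > 0")
      case True
      have "w (Suc k) * \<psi> (Z' (Suc k)) * qp (Suc k) * l k - w k * \<psi> (Z' k) * qm k * l k
          = \<psi> (Z' k) * l k * (w (Suc k) * qp (Suc k) - w k * qm k)"
        using tie[of k] k True by (simp add: algebra_simps)
      also have "\<dots> \<le> 0"
        using \<psi>[of "Z' k"] True w[of k] k by (intro mult_nonpos_nonneg) auto
      finally show ?thesis .
    next
      case False
      then show ?thesis using l(1)[of k] by simp
    qed
  qed
  finally show ?thesis by simp
qed

end

section \<open>Tail bound for the discretised systems\<close>

text \<open>Fatou for sets: the lower limit is an increasing union of intersections, each contained
  in some \<open>A n\<close>.\<close>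

lemma emeasure_eventually_le:
  assumes A: "\<And>n. A n \<in> sets M" and le: "\<And>n. emeasure M (A n) \<le> e"
  shows "{x \<in> space M. \<forall>\<^sub>F n in sequentially. x \<in> A n} \<in> sets M" (is "?S \<in> _")
    and "emeasure M {x \<in> space M. \<forall>\<^sub>F n in sequentially. x \<in> A n} \<le> e"
proof -
  define D where "D n = {x \<in> space M. \<forall>m\<ge>n. x \<in> A m}" for n
  have D_eq: "D n = (\<Inter>m. A (n + m))" for n
    using sets.sets_into_space[OF A] by (fastforce simp: D_def le_iff_add)
  have D: "D n \<in> sets M" for n
    unfolding D_eq by (intro sets.countable_INT) (use A in auto)
  have S: "?S = (\<Union>n. D n)" by (auto simp: D_def eventually_sequentially)
  show "?S \<in> sets M" unfolding S using D by (intro sets.countable_UN) auto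
  have "incseq D" by (auto simp: incseq_def D_def)
  then have "emeasure M ?S = (SUP n. emeasure M (D n))"
    unfolding S using D by (intro SUP_emeasure_incseq[symmetric]) auto
  also have "\<dots> \<le> e"
  proof (rule SUP_least)
    fix n
    have "emeasure M (D n) \<le> emeasure M (A n)" by (rule emeasure_mono) (auto simp: D_def A)
    then show "emeasure M (D n) \<le> e" using le order_trans by blast
  qed
  finally show "emeasure M ?S \<le> e" .
qed

section \<open>Filtration and Brownian increments\<close>

lemma usual_conditions_space:
  assumes "usual_conditions M F" "t \<ge> 0" shows "space (F t) = space M"
  using assms filtration.space_F[of "space M" "\<lambda>t. F (max 0 t)" t] by (simp add: usual_conditions_def)

lemma usual_conditions_mono:
  assumes "usual_conditions M F" "0 \<le> s" "s \<le> t" shows "sets (F s) \<subseteq> sets (F t)"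
  using assms filtration.sets_F_mono[of "space M" "\<lambda>t. F (max 0 t)" s t] by (simp add: usual_conditions_def)

lemma usual_conditions_sub:
  assumes "usual_conditions M F" "t \<ge> 0" shows "sets (F t) \<subseteq> sets M"
  using assms unfolding usual_conditions_def by blast

lemma usual_conditions_measurable_mono:
  assumes "usual_conditions M F" "0 \<le> s" "s \<le> t" "X \<in> borel_measurable (F s)"
  shows "X \<in> borel_measurable (F t)"
proof -
  have "space (F t) = space (F s)" using usual_conditions_space[OF assms(1)] assms by simp
  then show ?thesis
    using assms(4) usual_conditions_mono[OF assms(1-3)] by (auto simp: measurable_def)
qed

lemma usual_conditions_measurable_M:
  assumes "usual_conditions M F" "0 \<le> s" "X \<in> borel_measurable (F s)"
  shows "X \<in> borel_measurable M"
  using assms(3) usual_conditions_sub[OF assms(1,2)] usual_conditions_space[OF assms(1,2)]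
  by (auto simp: measurable_def)

text \<open>Independence of the increment from \<open>F s\<close> makes the joint law of past and
  increment a product, and Fubini then integrates out the increment with the past frozen. This takes
  the place of a conditional expectation.\<close>

lemma brownian_increment_freezing:
  assumes uc: "usual_conditions M F" and bm: "standard_brownian_motion M F W"
    and "0 \<le> s" "s < t" and f: "f \<in> borel_measurable (F s \<Otimes>\<^sub>M borel)"
  shows "(\<integral>\<^sup>+\<omega>. f (\<omega>, W t \<omega> - W s \<omega>) \<partial>M) = (\<integral>\<^sup>+\<omega>. (\<integral>\<^sup>+z. f (\<omega>, z) \<partial>gauss (t - s)) \<partial>M)"
proof -
  interpret prob_space M using uc by (simp add: usual_conditions_def)
  define D where "D \<omega> = W t \<omega> - W s \<omega>" for \<omega>
  have dist: "distributed M lborel D (normal_density 0 (sqrt (t - s)))"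
    and indep: "indep_set (sets (F s)) (sets (vimage_algebra (space M) D borel))"
    using bm assms(3,4) unfolding standard_brownian_motion_def D_def by auto
  have D[measurable]: "D \<in> borel_measurable M" using distributed_measurable[OF dist] by simp
  have sp: "space (F s) = space M" by (rule usual_conditions_space[OF uc assms(3)])
  have sub: "sets (F s) \<subseteq> sets M" by (rule usual_conditions_sub[OF uc assms(3)])
  \<comment> \<open>The identity as a map into \<open>F s\<close> turns the whole past into one
    random element, whose joint law with the increment can be formed.\<close>
  have id[measurable]: "(\<lambda>\<omega>. \<omega>) \<in> measurable M (F s)"
    using sub sets.sets_into_space[of _ "F s"] sp by (intro measurableI) (auto simp: Int_absorb2)
  have joint: "distr M (F s) (\<lambda>\<omega>. \<omega>) \<Otimes>\<^sub>M distr M borel D = distr M (F s \<Otimes>\<^sub>M borel) (\<lambda>\<omega>. (\<omega>, D \<omega>))"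
  proof (rule pair_measure_eqI)
    show "sigma_finite_measure (distr M (F s) (\<lambda>\<omega>. \<omega>))" "sigma_finite_measure (distr M borel D)"
      by (intro prob_space_imp_sigma_finite prob_space_distr id D)+
    show "sets (distr M (F s) (\<lambda>\<omega>. \<omega>) \<Otimes>\<^sub>M distr M borel D)
        = sets (distr M (F s \<Otimes>\<^sub>M borel) (\<lambda>\<omega>. (\<omega>, D \<omega>)))"
      by (simp cong: sets_pair_measure_cong)
    fix A E assume "A \<in> sets (distr M (F s) (\<lambda>\<omega>. \<omega>))" "E \<in> sets (distr M borel D)"
    then have AE: "A \<in> sets (F s)" "E \<in> sets borel" by auto
    have A: "A \<subseteq> space M" using sets.sets_into_space[OF AE(1)] sp by simp
    have E: "D -` E \<inter> space M \<in> sets (vimage_algebra (space M) D borel)"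
      unfolding sets_vimage_algebra using AE(2) by (intro sigma_sets.Basic) auto
    have "emeasure (distr M (F s \<Otimes>\<^sub>M borel) (\<lambda>\<omega>. (\<omega>, D \<omega>))) (A \<times> E)
        = emeasure M ((\<lambda>\<omega>. (\<omega>, D \<omega>)) -` (A \<times> E) \<inter> space M)"
      using AE by (intro emeasure_distr) auto
    also have "(\<lambda>\<omega>. (\<omega>, D \<omega>)) -` (A \<times> E) \<inter> space M = A \<inter> (D -` E \<inter> space M)" using A by auto
    also have "emeasure M \<dots> = emeasure M A * emeasure M (D -` E \<inter> space M)"
      using indep_setD[OF indep AE(1) E] by (simp add: emeasure_eq_measure ennreal_mult)
    also have "\<dots> = emeasure (distr M (F s) (\<lambda>\<omega>. \<omega>)) A * emeasure (distr M borel D) E"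
      using AE A by (simp add: emeasure_distr[OF id] emeasure_distr[OF D] Int_absorb2)
    finally show "emeasure (distr M (F s) (\<lambda>\<omega>. \<omega>)) A * emeasure (distr M borel D) E
        = emeasure (distr M (F s \<Otimes>\<^sub>M borel) (\<lambda>\<omega>. (\<omega>, D \<omega>))) (A \<times> E)" ..
  qed
  have gauss: "distr M borel D = gauss (t - s)"
  proof -
    have "distr M borel D = distr M lborel D" by (rule distr_cong) simp_all
    then show ?thesis using distributed_distr_eq_density[OF dist] by (simp add: gauss_def)
  qed
  interpret G: prob_space "gauss (t - s)" using assms(4) by (intro prob_space_gauss) simp
  have f': "f \<in> borel_measurable (distr M (F s) (\<lambda>\<omega>. \<omega>) \<Otimes>\<^sub>M gauss (t - s))"
    using f by (simp cong: measurable_cong_sets add: sets_pair_measure_cong[OF sets_distr sets_gauss])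
  have "(\<integral>\<^sup>+\<omega>. f (\<omega>, D \<omega>) \<partial>M) = (\<integral>\<^sup>+p. f p \<partial>distr M (F s \<Otimes>\<^sub>M borel) (\<lambda>\<omega>. (\<omega>, D \<omega>)))"
    using f by (subst nn_integral_distr) auto
  also have "\<dots> = (\<integral>\<^sup>+p. f p \<partial>(distr M (F s) (\<lambda>\<omega>. \<omega>) \<Otimes>\<^sub>M gauss (t - s)))"
    by (simp add: joint[symmetric] gauss)
  also have "\<dots> = (\<integral>\<^sup>+\<omega>. (\<integral>\<^sup>+z. f (\<omega>, z) \<partial>gauss (t - s)) \<partial>distr M (F s) (\<lambda>\<omega>. \<omega>))"
    by (rule G.nn_integral_fst[OF f', symmetric])
  also have "\<dots> = (\<integral>\<^sup>+\<omega>. (\<integral>\<^sup>+z. f (\<omega>, z) \<partial>gauss (t - s)) \<partial>M)"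
    using G.borel_measurable_nn_integral_fst[OF f'] by (subst nn_integral_distr) auto
  finally show ?thesis by (simp add: D_def)
qed

section \<open>The discretised particle system\<close>

locale competing_particles = collision qp qm
  for qp qm :: "nat \<Rightarrow> real" +
  fixes M :: "'a measure" and F :: "real \<Rightarrow> 'a measure"
    and g \<sigma> y :: "nat \<Rightarrow> real" and B :: "nat \<Rightarrow> real \<Rightarrow> 'a \<Rightarrow> real"
    and c s :: real and w :: "nat \<Rightarrow> real" and wmax :: real
  assumes uc: "usual_conditions M F"
    and bm: "\<And>k. k \<ge> 1 \<Longrightarrow> standard_brownian_motion M F (B k)"
    and c: "c \<le> 0" "\<And>k. k \<ge> 1 \<Longrightarrow> c \<le> g k"
    and s: "s > 0" "\<And>k. k \<ge> 1 \<Longrightarrow> 0 \<le> \<sigma> k \<and> \<sigma> k \<le> s"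
    and w: "\<And>k. k \<ge> 1 \<Longrightarrow> 1 \<le> w k \<and> w k \<le> wmax \<and> w k * qm k \<le> w (Suc k) * qp (Suc k)"
    and y_mono: "\<And>n. n \<ge> 1 \<Longrightarrow> y n \<le> y (n + 1)"
    and y_sum: "\<And>\<alpha>. \<alpha> > 0 \<Longrightarrow> summable (\<lambda>n. exp (- \<alpha> * (y (Suc n))\<^sup>2))"
begin

sublocale prob_space M using uc by (simp add: usual_conditions_def)

text \<open>Index 0 is set to 0 because nothing is assumed about \<open>B 0\<close>.\<close>

definition drive :: "'a \<Rightarrow> nat \<Rightarrow> real \<Rightarrow> real" where
  "drive \<omega> k t = (if k = 0 then 0 else y k + g k * t + \<sigma> k * B k t \<omega>)"

lemma B_measurable: "k \<ge> 1 \<Longrightarrow> t \<ge> 0 \<Longrightarrow> B k t \<in> borel_measurable (F t)"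
  using bm by (auto simp: standard_brownian_motion_def continuous_adapted_def)

lemma drive_continuous: "\<omega> \<in> space M \<Longrightarrow> continuous_on {0..} (drive \<omega> k)"
  using bm[of k]
  by (cases "k = 0")
    (auto simp: drive_def[abs_def] standard_brownian_motion_def continuous_adapted_def
      intro!: continuous_intros)

lemma drive_locally_bounded: "\<omega> \<in> space M \<Longrightarrow> locally_bounded (drive \<omega> k)"
  by (intro locally_bounded_continuous drive_continuous)

lemma drive_measurable:
  assumes "t \<ge> 0" shows "(\<lambda>\<omega>. drive \<omega> k t) \<in> borel_measurable (F t)"
proof (cases "k = 0")
  case False
  have [measurable]: "B k t \<in> borel_measurable (F t)" using False assms by (intro B_measurable) auto
  show ?thesis using False unfolding drive_def by simp
qed (simp add: drive_def)

lemma space_F: "t \<ge> 0 \<Longrightarrow> space (F t) = space M"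
  by (rule usual_conditions_space[OF uc])

text \<open>On a grid each running supremum runs over countably many times, all at most
  \<open>t\<close>, so the iterates are adapted. The solution on the half-line inherits this as a
  limit of grid solutions.\<close>

lemma picard_measurable:
  assumes "h > 0" "t \<ge> 0"
  shows "(\<lambda>\<omega>. picard (grid h) N (drive \<omega>) n k t) \<in> borel_measurable (F t)"
  using assms(2)
proof (induction n arbitrary: k t)
  case (Suc n)
  show ?case
  proof (cases "1 \<le> k \<and> k < N")
    case True
    have "(\<lambda>\<omega>. SUP r\<in>grid h \<inter> {0..t}. max 0 (push (drive \<omega>) (picard (grid h) N (drive \<omega>) n) k r))
        \<in> borel_measurable (F t)"
    proof (rule borel_measurable_cSUP)
      show "countable (grid h \<inter> {0..t})" by (auto simp: grid_def)
      show "(\<lambda>\<omega>. max 0 (push (drive \<omega>) (picard (grid h) N (drive \<omega>) n) k r)) \<in> borel_measurable (F t)"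
        if r: "r \<in> grid h \<inter> {0..t}" for r
      proof -
        have r0: "0 \<le> r" "r \<le> t" using r by auto
        note [measurable] = usual_conditions_measurable_mono[OF uc r0 drive_measurable[OF r0(1)]]
          usual_conditions_measurable_mono[OF uc r0 Suc.IH[OF r0(1)]]
        show ?thesis unfolding push_def by measurable
      qed
      show "bdd_above ((\<lambda>r. max 0 (push (drive \<omega>) (picard (grid h) N (drive \<omega>) n) k r)) ` (grid h \<inter> {0..t}))"
        if "\<omega> \<in> space (F t)" for \<omega>
        using that space_F[OF Suc.prems]
        by (intro running_sup_bdd picard_push_bounded zero_in_grid drive_locally_bounded) auto
    qed
    then show ?thesis using True by (simp add: reflect_def running_sup_def)
  next
    case False
    then show ?thesis by (auto simp: reflect_def)
  qed
qed simp

lemma skorokhod_grid_measurable: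
  assumes "h > 0" "t \<ge> 0"
  shows "(\<lambda>\<omega>. skorokhod (grid h) N (drive \<omega>) k t) \<in> borel_measurable (F t)"
proof (rule borel_measurable_LIMSEQ_real)
  show "(\<lambda>\<omega>. picard (grid h) N (drive \<omega>) n k t) \<in> borel_measurable (F t)" for n
    by (rule picard_measurable[OF assms])
  show "(\<lambda>n. picard (grid h) N (drive \<omega>) n k t) \<longlonglongrightarrow> skorokhod (grid h) N (drive \<omega>) k t"
    if "\<omega> \<in> space (F t)" for \<omega>
    using that space_F[OF assms(2)] assms(2)
    by (intro picard_tendsto zero_in_grid drive_locally_bounded) auto
qed

lemma skorokhod_measurable:
  assumes "t \<ge> 0"
  shows "(\<lambda>\<omega>. skorokhod {0..} N (drive \<omega>) k t) \<in> borel_measurable (F t)"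
proof (rule borel_measurable_LIMSEQ_real)
  show "(\<lambda>\<omega>. skorokhod (grid (1 / real (Suc n))) N (drive \<omega>) k t) \<in> borel_measurable (F t)" for n
    by (rule skorokhod_grid_measurable[OF _ assms]) simp
  show "(\<lambda>n. skorokhod (grid (1 / real (Suc n))) N (drive \<omega>) k t) \<longlonglongrightarrow> skorokhod {0..} N (drive \<omega>) k t"
    if "\<omega> \<in> space (F t)" for \<omega>
    using that space_F[OF assms] by (intro skorokhod_grid_tendsto(2) drive_continuous assms) auto
qed

definition chain :: "nat \<Rightarrow> real \<Rightarrow> 'a \<Rightarrow> nat \<Rightarrow> nat \<Rightarrow> real" where
  "chain N h \<omega> k i = ranked (drive \<omega>) (skorokhod (grid h) N (drive \<omega>)) k (real i * h)"

lemma chain_measurable: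
  assumes "h > 0" shows "(\<lambda>\<omega>. chain N h \<omega> k i) \<in> borel_measurable (F (real i * h))"
proof -
  have "0 \<le> real i * h" using assms by simp
  note [measurable] = drive_measurable[OF this] skorokhod_grid_measurable[OF assms this]
  show ?thesis unfolding chain_def ranked_def by measurable
qed

lemma initial_AE: "AE \<omega> in M. \<forall>k\<ge>1. B k 0 \<omega> = 0"
proof -
  have "AE \<omega> in M. k \<ge> 1 \<longrightarrow> B k 0 \<omega> = 0" for k
    using bm[of k] by (cases "k \<ge> 1") (auto simp: standard_brownian_motion_def)
  then show ?thesis by (simp add: AE_all_countable)
qed

lemma drive_initial: "\<forall>k\<ge>1. B k 0 \<omega> = 0 \<Longrightarrow> 1 \<le> k \<Longrightarrow> drive \<omega> k 0 = y k"
  by (simp add: drive_def)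

lemma chain_initial_AE: "AE \<omega> in M. \<forall>k\<ge>1. chain N h \<omega> k 0 = y k"
  using initial_AE AE_space
proof eventually_elim
  case (elim \<omega>)
  have "skorokhod (grid h) N (drive \<omega>) k 0 = 0" for k
    by (rule skorokhod_initial[OF zero_in_grid drive_locally_bounded])
      (use elim y_mono in \<open>auto simp: drive_initial\<close>)
  then show ?case using elim by (auto simp: chain_def ranked_def drive_initial)
qed

text \<open>The right-hand side is the cost after the free move alone. The increments of the
  collision terms are the pushes of \<open>reflection_decreases_cost\<close>; the required ties come
  from \<open>running_sup_grid_step\<close> and the fixed point equation.\<close>

lemma chain_step:
  assumes "\<omega> \<in> space M" "h > 0" "cost \<phi>"
  shows "(\<Sum>k=1..N. w k * \<phi> (chain N h \<omega> k (Suc i)))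
    \<le> (\<Sum>k=1..N. w k * \<phi> (chain N h \<omega> k i + g k * h
         + \<sigma> k * (B k (real (Suc i) * h) \<omega> - B k (real i * h) \<omega>)))"
proof (rule reflection_decreases_cost[OF assms(3)])
  note lb = drive_locally_bounded[OF assms(1)]
  let ?L = "skorokhod (grid h) N (drive \<omega>)"
  let ?t = "real i * h" and ?u = "real (Suc i) * h"
  have t: "0 \<le> ?t" "?t \<le> ?u" "0 \<le> ?u" using assms(2) by (auto intro!: mult_right_mono)
  show "0 \<le> ?L k ?u - ?L k ?t" for k
    using skorokhod_mono_time[OF zero_in_grid lb t(1,2)] by simp
  show "?L 0 ?u - ?L 0 ?t = 0" "?L N ?u - ?L N ?t = 0"
    by (simp_all add: skorokhod_outside[OF zero_in_grid lb])
  show "0 \<le> w k \<and> w k * qm k \<le> w (Suc k) * qp (Suc k)" if "1 \<le> k" for k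
    using w[OF that] by auto
  show "chain N h \<omega> k (Suc i) = chain N h \<omega> k i + g k * h
      + \<sigma> k * (B k ?u \<omega> - B k ?t \<omega>) + qp k * (?L (k - 1) ?u - ?L (k - 1) ?t) - qm k * (?L k ?u - ?L k ?t)"
    if "1 \<le> k" for k
    using that by (simp add: chain_def ranked_def drive_def algebra_simps)
  show "chain N h \<omega> (Suc k) (Suc i) = chain N h \<omega> k (Suc i)"
    if k: "1 \<le> k" "k < N" "0 < ?L k ?u - ?L k ?t" for k
  proof -
    have "?L k ?u = push (drive \<omega>) ?L k ?u"
      using running_sup_grid_step[OF assms(2) skorokhod_push_bounded[OF zero_in_grid lb], where i = i] k t
      by (simp add: skorokhod_fixpoint[OF zero_in_grid lb _ k(1,2)])
    then show ?thesis
      using ranked_gap[OF k(1), of "drive \<omega>" ?L ?u] by (simp add: chain_def)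
  qed
qed

text \<open>Valued in \<open>ennreal\<close>, so that expectations can be taken before any
  integrability is known.\<close>

definition total_cost :: "(real \<Rightarrow> real) \<Rightarrow> nat \<Rightarrow> real \<Rightarrow> nat \<Rightarrow> 'a \<Rightarrow> ennreal" where
  "total_cost \<phi> N h i \<omega> = (\<Sum>k=1..N. ennreal (w k * \<phi> (chain N h \<omega> k i)))"

lemma total_cost_measurable:
  assumes "cost \<phi>" "h > 0" shows "total_cost \<phi> N h i \<in> borel_measurable (F (real i * h))"
proof -
  note [measurable] = cost_measurable[OF assms(1)] chain_measurable[OF assms(2)]
  show ?thesis unfolding total_cost_def[abs_def] by measurable
qed

text \<open>Reflection only lowers the cost, the remaining free move involves one increment per
  summand and is integrated by freezing, and \<open>smooth\<close> dominates the outcome for every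
  drift and volatility. The event \<open>A\<close> of the past encodes conditioning.\<close>

lemma total_cost_supermartingale:
  assumes "cost \<phi>" "h > 0" and A: "A \<in> sets (F (real i * h))"
  shows "(\<integral>\<^sup>+\<omega>. total_cost \<phi> N h (Suc i) \<omega> * indicator A \<omega> \<partial>M)
    \<le> (\<integral>\<^sup>+\<omega>. total_cost (smooth c s h \<phi>) N h i \<omega> * indicator A \<omega> \<partial>M)"
proof -
  let ?t = "real i * h" and ?u = "real (Suc i) * h"
  have t: "0 \<le> ?t" "?t < ?u" "0 \<le> ?u" using assms(2) by auto
  define f where "f k = (\<lambda>(\<omega>, z). ennreal (w k * \<phi> (chain N h \<omega> k i + g k * h + \<sigma> k * z)) * indicator A \<omega>)" for k
  note [measurable] = cost_measurable[OF assms(1)] chain_measurable[OF assms(2)] A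
  have f: "f k \<in> borel_measurable (F ?t \<Otimes>\<^sub>M borel)" for k
    unfolding f_def by measurable
  have w0: "0 \<le> w k" if "k \<in> {1..N}" for k using w[of k] that by auto
  have sm: "cost (smooth c s h \<phi>)" by (rule smooth_cost[OF assms(2) s(1) c(1) assms(1)])
  have inc: "(\<lambda>\<omega>. f k (\<omega>, B k ?u \<omega> - B k ?t \<omega>)) \<in> borel_measurable M" if "k \<in> {1..N}" for k
  proof -
    have "B k ?u \<in> borel_measurable M" "B k ?t \<in> borel_measurable M"
      using that
      by (intro usual_conditions_measurable_M[OF uc t(3)] usual_conditions_measurable_M[OF uc t(1)]
          B_measurable t(1,3); simp)+
    moreover have "(\<lambda>\<omega>. chain N h \<omega> k i) \<in> borel_measurable M"
      by (rule usual_conditions_measurable_M[OF uc t(1) chain_measurable[OF assms(2)]])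
    moreover have "A \<in> sets M" using A usual_conditions_sub[OF uc t(1)] by blast
    ultimately show ?thesis unfolding f_def by simp
  qed
  have pt: "total_cost \<phi> N h (Suc i) \<omega> * indicator A \<omega> \<le> (\<Sum>k=1..N. f k (\<omega>, B k ?u \<omega> - B k ?t \<omega>))"
    if "\<omega> \<in> space M" for \<omega>
  proof -
    have "total_cost \<phi> N h (Suc i) \<omega> = ennreal (\<Sum>k=1..N. w k * \<phi> (chain N h \<omega> k (Suc i)))"
      unfolding total_cost_def by (rule sum_ennreal) (use w0 cost_nonneg[OF assms(1)] in auto)
    also have "\<dots> \<le> ennreal (\<Sum>k=1..N. w k * \<phi> (chain N h \<omega> k i + g k * h
         + \<sigma> k * (B k ?u \<omega> - B k ?t \<omega>)))"
      by (intro ennreal_leI chain_step that assms)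
    also have "\<dots> = (\<Sum>k=1..N. ennreal (w k * \<phi> (chain N h \<omega> k i + g k * h
         + \<sigma> k * (B k ?u \<omega> - B k ?t \<omega>))))"
      by (rule sum_ennreal[symmetric]) (use w0 cost_nonneg[OF assms(1)] in auto)
    finally show ?thesis by (auto simp: f_def indicator_def)
  qed
  have freeze: "(\<integral>\<^sup>+z. f k (\<omega>, z) \<partial>gauss h) \<le> ennreal (w k * smooth c s h \<phi> (chain N h \<omega> k i)) * indicator A \<omega>"
    if "k \<in> {1..N}" for k \<omega>
  proof (cases "\<omega> \<in> A")
    case True
    have "(\<integral>\<^sup>+z. f k (\<omega>, z) \<partial>gauss h)
        = (\<integral>\<^sup>+z. ennreal (w k * \<phi> (chain N h \<omega> k i + g k * h + \<sigma> k * z)) \<partial>gauss h)"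
      using True by (simp add: f_def)
    also have "\<dots> = ennreal (\<integral>z. w k * \<phi> (chain N h \<omega> k i + g k * h + \<sigma> k * z) \<partial>gauss h)"
      using w0[OF that] cost_nonneg[OF assms(1)]
      by (intro nn_integral_eq_integral integrable_mult_right cost_integrable[OF assms(1,2)]) auto
    also have "\<dots> = ennreal (w k * (\<integral>z. \<phi> (chain N h \<omega> k i + g k * h + \<sigma> k * z) \<partial>gauss h))"
      by simp
    also have "\<dots> \<le> ennreal (w k * smooth c s h \<phi> (chain N h \<omega> k i))"
      using w0[OF that] that c(2)[of k] s(2)[of k]
      by (intro ennreal_leI mult_left_mono smooth_dominates assms s(1) c(1)) auto
    finally show ?thesis using True by simp
  qed (simp add: f_def)
  have "(\<integral>\<^sup>+\<omega>. total_cost \<phi> N h (Suc i) \<omega> * indicator A \<omega> \<partial>M)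
      \<le> (\<integral>\<^sup>+\<omega>. (\<Sum>k=1..N. f k (\<omega>, B k ?u \<omega> - B k ?t \<omega>)) \<partial>M)"
    by (intro nn_integral_mono pt)
  also have "\<dots> = (\<Sum>k=1..N. \<integral>\<^sup>+\<omega>. f k (\<omega>, B k ?u \<omega> - B k ?t \<omega>) \<partial>M)"
    by (intro nn_integral_sum inc)
  also have "\<dots> = (\<Sum>k=1..N. \<integral>\<^sup>+\<omega>. (\<integral>\<^sup>+z. f k (\<omega>, z) \<partial>gauss (?u - ?t)) \<partial>M)"
    by (intro sum.cong refl brownian_increment_freezing[OF uc bm t(1,2) f]) auto
  also have "\<dots> \<le> (\<Sum>k=1..N. \<integral>\<^sup>+\<omega>. ennreal (w k * smooth c s h \<phi> (chain N h \<omega> k i)) * indicator A \<omega> \<partial>M)"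
  proof -
    have "?u - ?t = h" by (simp add: algebra_simps)
    then show ?thesis by (auto intro!: sum_mono nn_integral_mono freeze)
  qed
  also have "\<dots> = (\<integral>\<^sup>+\<omega>. (\<Sum>k=1..N. ennreal (w k * smooth c s h \<phi> (chain N h \<omega> k i)) * indicator A \<omega>) \<partial>M)"
  proof (rule nn_integral_sum[symmetric])
    fix k
    have "(\<lambda>\<omega>. chain N h \<omega> k i) \<in> borel_measurable M"
      by (rule usual_conditions_measurable_M[OF uc t(1) chain_measurable[OF assms(2)]])
    moreover have "A \<in> sets M" using A usual_conditions_sub[OF uc t(1)] by blast
    ultimately show "(\<lambda>\<omega>. ennreal (w k * smooth c s h \<phi> (chain N h \<omega> k i)) * indicator A \<omega>) \<in> borel_measurable M"
      using cost_measurable[OF sm] by simp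
  qed
  also have "\<dots> = (\<integral>\<^sup>+\<omega>. total_cost (smooth c s h \<phi>) N h i \<omega> * indicator A \<omega> \<partial>M)"
    by (simp add: total_cost_def sum_distrib_right)
  finally show ?thesis .
qed

lemma total_cost_tail:
  fixes C K :: real
  assumes "h > 0" "K > 0" "C \<ge> 0" and "cost \<phi>"
    and C: "(\<Sum>k=1..N. (smooth c s h ^^ m) \<phi> (y k)) \<le> C"
  shows "{\<omega> \<in> space M. \<exists>i\<le>m. K \<le> (\<Sum>k=1..N. \<phi> (chain N h \<omega> k i))} \<in> sets M" (is "?E \<in> _")
    and "emeasure M {\<omega> \<in> space M. \<exists>i\<le>m. K \<le> (\<Sum>k=1..N. \<phi> (chain N h \<omega> k i))} \<le> ennreal (wmax * C / K)"
proof -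
  note cst = smooth_funpow_cost[OF assms(1) s(1) c(1) assms(4)]
  have [measurable]: "(\<lambda>\<omega>. chain N h \<omega> k i) \<in> borel_measurable M" for k i
    using assms(1) by (intro usual_conditions_measurable_M[OF uc _ chain_measurable]) auto
  note [measurable] = cost_measurable[OF assms(4)]
  show E: "?E \<in> sets M" by measurable
  \<comment> \<open>At step \<open>i\<close> the cost is smoothed over the \<open>m - i\<close>
    steps still to come. As smoothing raises costs and weights are at least 1, \<open>S i\<close>
    dominates the plain cost, while \<open>S 0\<close> starts almost surely below
    \<open>wmax * C\<close>.\<close>
  define S where "S i = total_cost ((smooth c s h ^^ (m - i)) \<phi>) N h i" for i
  have S_F: "S i \<in> borel_measurable (F (real i * h))" for i
    unfolding S_def by (rule total_cost_measurable[OF cst assms(1)])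
  have S_M[measurable]: "S i \<in> borel_measurable M" for i
    using assms(1) by (intro usual_conditions_measurable_M[OF uc _ S_F]) auto
  have w0: "0 \<le> w k" "1 \<le> w k" if "k \<in> {1..N}" for k using w[of k] that by auto
  have "?E \<subseteq> {\<omega> \<in> space M. \<exists>i\<le>m. ennreal K \<le> S i \<omega>}"
  proof safe
    fix \<omega> i assume \<omega>: "\<omega> \<in> space M" "i \<le> m" "K \<le> (\<Sum>k=1..N. \<phi> (chain N h \<omega> k i))"
    have "ennreal K \<le> ennreal (\<Sum>k=1..N. w k * (smooth c s h ^^ (m - i)) \<phi> (chain N h \<omega> k i))"
    proof (rule ennreal_leI, rule order_trans[OF \<omega>(3)], rule sum_mono)
      fix k assume k: "k \<in> {1..N}"
      have "\<phi> (chain N h \<omega> k i) \<le> (smooth c s h ^^ (m - i)) \<phi> (chain N h \<omega> k i)"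
        by (rule smooth_funpow_ge[OF assms(1) s(1) c(1) assms(4)])
      also have "\<dots> \<le> w k * (smooth c s h ^^ (m - i)) \<phi> (chain N h \<omega> k i)"
        using mult_right_mono[OF w0(2)[OF k] cost_nonneg[OF cst]] by simp
      finally show "\<phi> (chain N h \<omega> k i) \<le> w k * (smooth c s h ^^ (m - i)) \<phi> (chain N h \<omega> k i)" .
    qed
    also have "\<dots> = S i \<omega>"
      unfolding S_def total_cost_def
      by (rule sum_ennreal[symmetric]) (use w0 cost_nonneg[OF cst] in auto)
    finally show "\<exists>i\<le>m. ennreal K \<le> S i \<omega>" using \<omega>(2) by blast
  qed
  then have "ennreal K * emeasure M ?E \<le> ennreal K * emeasure M {\<omega> \<in> space M. \<exists>i\<le>m. ennreal K \<le> S i \<omega>}"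
    by (intro mult_left_mono emeasure_mono) auto
  also have "\<dots> \<le> (\<integral>\<^sup>+\<omega>. S 0 \<omega> \<partial>M)"
  proof (rule maximal_inequality[OF S_M])
    fix i assume "i < m"
    define A where "A = {\<omega> \<in> space M. \<forall>j\<le>i. S j \<omega> < ennreal K}"
    have A: "A \<in> sets (F (real i * h))"
    proof -
      have "S j \<in> borel_measurable (F (real i * h))" if "j \<le> i" for j
        using that assms(1) by (intro usual_conditions_measurable_mono[OF uc _ _ S_F] mult_right_mono) auto
      then have "{\<omega> \<in> space (F (real i * h)). S j \<omega> < ennreal K} \<in> sets (F (real i * h))" if "j \<in> {..i}" for j
        using that by (intro borel_measurable_less) auto
      then have "{\<omega> \<in> space (F (real i * h)). \<forall>j\<in>{..i}. S j \<omega> < ennreal K} \<in> sets (F (real i * h))"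
        by (rule sets.sets_Collect_finite_All) auto
      moreover have "A = {\<omega> \<in> space (F (real i * h)). \<forall>j\<in>{..i}. S j \<omega> < ennreal K}"
        unfolding A_def using space_F[of "real i * h"] assms(1) by auto
      ultimately show ?thesis by (simp only:)
    qed
    \<comment> \<open>Advancing the chain by one step uses up exactly one smoothing.\<close>
    have "m - i = Suc (m - Suc i)" using \<open>i < m\<close> by simp
    then have "(\<integral>\<^sup>+\<omega>. S (Suc i) \<omega> * indicator A \<omega> \<partial>M) \<le> (\<integral>\<^sup>+\<omega>. S i \<omega> * indicator A \<omega> \<partial>M)"
      using total_cost_supermartingale[OF cst assms(1) A, of "m - Suc i" N] by (simp add: S_def)
    then show "(\<integral>\<^sup>+\<omega>. S (Suc i) \<omega> * indicator {\<omega> \<in> space M. \<forall>j\<le>i. S j \<omega> < ennreal K} \<omega> \<partial>M)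
        \<le> (\<integral>\<^sup>+\<omega>. S i \<omega> * indicator {\<omega> \<in> space M. \<forall>j\<le>i. S j \<omega> < ennreal K} \<omega> \<partial>M)"
      unfolding A_def .
  qed
  also have "(\<integral>\<^sup>+\<omega>. S 0 \<omega> \<partial>M) \<le> (\<integral>\<^sup>+\<omega>. ennreal (wmax * C) \<partial>M)"
  proof (rule nn_integral_mono_AE)
    show "AE \<omega> in M. S 0 \<omega> \<le> ennreal (wmax * C)"
      using chain_initial_AE[of N h]
    proof eventually_elim
      case (elim \<omega>)
      have "S 0 \<omega> = ennreal (\<Sum>k=1..N. w k * (smooth c s h ^^ m) \<phi> (chain N h \<omega> k 0))"
        unfolding S_def total_cost_def using w0 cost_nonneg[OF cst] by (subst sum_ennreal) auto
      also have "\<dots> \<le> ennreal (\<Sum>k=1..N. wmax * (smooth c s h ^^ m) \<phi> (y k))"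
        using elim w cost_nonneg[OF cst] by (intro ennreal_leI sum_mono) (auto intro!: mult_right_mono)
      also have "\<dots> \<le> ennreal (wmax * C)"
        using C w[of 1] by (intro ennreal_leI) (auto simp: sum_distrib_left[symmetric] intro!: mult_left_mono)
      finally show ?case .
    qed
  qed
  also have "\<dots> = ennreal (wmax * C)" by (simp add: emeasure_space_1)
  finally have "ennreal K * emeasure M ?E \<le> ennreal (wmax * C)" .
  moreover have "emeasure M ?E = ennreal (measure M ?E)" by (rule emeasure_eq_measure)
  moreover have "0 \<le> wmax * C" using w[of 1] assms(3) by auto
  ultimately have "K * measure M ?E \<le> wmax * C"
    using assms(2) by (simp add: ennreal_mult[symmetric])
  then have "measure M ?E \<le> wmax * C / K" using assms(2) by (simp add: field_simps)
  then show "emeasure M ?E \<le> ennreal (wmax * C / K)" by (simp add: emeasure_eq_measure ennreal_leI)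
qed

text \<open>With \<open>T\<close> a natural number, \<open>T * Suc n\<close> steps of length
  \<open>1 / real (Suc n)\<close> fill the interval from 0 to \<open>T\<close> exactly.\<close>

definition bad :: "nat \<Rightarrow> real \<Rightarrow> nat \<Rightarrow> nat \<Rightarrow> real \<Rightarrow> 'a set" where
  "bad T a N n K = {\<omega> \<in> space M. \<exists>i\<le>T * Suc n.
     K \<le> (\<Sum>k=1..N. max 0 (a - chain N (1 / real (Suc n)) \<omega> k i))}"

text \<open>The tail bound is uniform in \<open>N\<close> and \<open>n\<close>, but over infinitely
  many pairs it cannot be summed. Being bad eventually in \<open>n\<close>, and then eventually in
  \<open>N\<close>, is no likelier than the uniform bound, and letting \<open>K\<close> grow leaves
  a null set. The negation yields the nested frequent quantifiers.\<close>

lemma bad_AE: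
  assumes "T \<ge> 1"
  shows "AE \<omega> in M. \<exists>K::nat. \<exists>\<^sub>F N in sequentially. \<exists>\<^sub>F n in sequentially. \<omega> \<notin> bad T a N n (real (Suc K))"
proof -
  obtain C where C: "C \<ge> 0" "\<And>h m N. h > 0 \<Longrightarrow> real m * h \<le> real T \<Longrightarrow>
      (\<Sum>k=1..N. (smooth c s h ^^ m) (\<lambda>x. max 0 (a - x)) (y k)) \<le> C"
    using total_cost_bound[OF y_mono y_sum s(1) c(1), of "real T" a] assms by auto
  have tail: "bad T a N n K \<in> sets M" "emeasure M (bad T a N n K) \<le> ennreal (wmax * C / K)"
    if "K > 0" for N n K
  proof -
    have h: "1 / real (Suc n) > 0" "real (T * Suc n) * (1 / real (Suc n)) \<le> real T"
      by (simp_all del: of_nat_Suc mult_Suc_right)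
    note tail = total_cost_tail[OF h(1) that C(1) cost_hinge C(2)[OF h]]
    show "bad T a N n K \<in> sets M" "emeasure M (bad T a N n K) \<le> ennreal (wmax * C / K)"
      unfolding bad_def by (rule tail)+
  qed
  define Z1 where "Z1 K N = {\<omega> \<in> space M. \<forall>\<^sub>F n in sequentially. \<omega> \<in> bad T a N n K}" for K N
  have Z1: "Z1 K N \<in> sets M" "emeasure M (Z1 K N) \<le> ennreal (wmax * C / K)" if "K > 0" for K N
    unfolding Z1_def by (rule emeasure_eventually_le[OF tail(1)[OF that] tail(2)[OF that]])+
  define Z2 where "Z2 K = {\<omega> \<in> space M. \<forall>\<^sub>F N in sequentially. \<omega> \<in> Z1 K N}" for K
  have Z2: "Z2 K \<in> sets M" "emeasure M (Z2 K) \<le> ennreal (wmax * C / K)" if "K > 0" for K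
    unfolding Z2_def by (rule emeasure_eventually_le[OF Z1(1)[OF that] Z1(2)[OF that]])+
  define Z where "Z = (\<Inter>K. Z2 (real (Suc K)))"
  have Z: "Z \<in> sets M" unfolding Z_def using Z2 by (intro sets.countable_INT) auto
  have "emeasure M Z \<le> ennreal (wmax * C / real (Suc K))" for K
  proof -
    have "emeasure M Z \<le> emeasure M (Z2 (real (Suc K)))"
      unfolding Z_def by (intro emeasure_mono Z2) auto
    also have "\<dots> \<le> ennreal (wmax * C / real (Suc K))" by (rule Z2) simp
    finally show ?thesis .
  qed
  moreover have "(\<lambda>K. ennreal (wmax * C / real (Suc K))) \<longlonglongrightarrow> ennreal 0"
  proof (intro tendsto_intros)
    have "(\<lambda>K. wmax * C * inverse (real (Suc K))) \<longlonglongrightarrow> wmax * C * 0"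
      by (intro tendsto_intros LIMSEQ_inverse_real_of_nat)
    then show "(\<lambda>K. wmax * C / real (Suc K)) \<longlonglongrightarrow> 0" by (simp add: divide_inverse)
  qed
  ultimately have "emeasure M Z \<le> ennreal 0" by (intro LIMSEQ_le_const) auto
  then have "Z \<in> null_sets M" using Z by auto
  then show ?thesis
  proof (rule AE_I')
    show "{\<omega> \<in> space M. \<not> (\<exists>K::nat. \<exists>\<^sub>F N in sequentially. \<exists>\<^sub>F n in sequentially.
        \<omega> \<notin> bad T a N n (real (Suc K)))} \<subseteq> Z"
      unfolding Z_def Z2_def Z1_def frequently_def by auto
  qed
qed

text \<open>A continuous-time cost above \<open>Suc K\<close> would, by convergence of the grid
  solutions, exceed it on all fine grids. Natural horizons and levels suffice because they dominate
  real ones, which keeps the exceptional null sets countable in number.\<close>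

lemma controlled_of_not_bad:
  assumes \<omega>: "\<omega> \<in> space M"
    and nb: "\<And>T a :: nat. T \<ge> 1 \<Longrightarrow> \<exists>K::nat. \<exists>\<^sub>F N in sequentially. \<exists>\<^sub>F n in sequentially.
        \<omega> \<notin> bad T (real a) N n (real (Suc K))"
  shows "controlled (drive \<omega>)"
  unfolding controlled_def
proof (intro allI)
  fix T a :: real
  define T' where "T' = Suc (nat \<lceil>T\<rceil>)"
  define a' where "a' = nat \<lceil>a\<rceil>"
  have T': "T \<le> real T'" "1 \<le> T'" and a': "a \<le> real a'" unfolding T'_def a'_def by linarith+
  obtain K where K: "\<exists>\<^sub>F N in sequentially. \<exists>\<^sub>F n in sequentially. \<omega> \<notin> bad T' (real a') N n (real (Suc K))"
    using nb[OF T'(2), of a'] by blast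
  have "(\<Sum>k=1..N. max 0 (a - ranked (drive \<omega>) (skorokhod {0..} N (drive \<omega>)) k t)) \<le> real (Suc K)"
    if fr: "\<exists>\<^sub>F n in sequentially. \<omega> \<notin> bad T' (real a') N n (real (Suc K))" and t: "t \<in> {0..T}" for N t
  proof (rule ccontr)
    assume "\<not> ?thesis"
    moreover have "(\<lambda>n. \<Sum>k=1..N. max 0 (a - ranked (drive \<omega>)
         (skorokhod (grid (1 / real (Suc n))) N (drive \<omega>)) k (grid_floor (1 / real (Suc n)) t)))
        \<longlonglongrightarrow> (\<Sum>k=1..N. max 0 (a - ranked (drive \<omega>) (skorokhod {0..} N (drive \<omega>)) k t))"
      using t by (intro tendsto_intros ranked_grid_tendsto drive_continuous \<omega>) auto
    ultimately have "\<forall>\<^sub>F n in sequentially. real (Suc K) < (\<Sum>k=1..N. max 0 (a - ranked (drive \<omega>)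
         (skorokhod (grid (1 / real (Suc n))) N (drive \<omega>)) k (grid_floor (1 / real (Suc n)) t)))"
      by (intro order_tendstoD(1)) auto
    then have "\<forall>\<^sub>F n in sequentially. \<omega> \<in> bad T' (real a') N n (real (Suc K))"
    proof eventually_elim
      case (elim n)
      define i where "i = nat \<lfloor>t / (1 / real (Suc n))\<rfloor>"
      have "real i \<le> t * real (Suc n)" unfolding i_def using t by simp
      also have "\<dots> \<le> real T' * real (Suc n)" using t T' by (intro mult_right_mono) auto
      finally have i: "i \<le> T' * Suc n" by (metis of_nat_le_iff of_nat_mult)
      have "real (Suc K) \<le> (\<Sum>k=1..N. max 0 (a - chain N (1 / real (Suc n)) \<omega> k i))"
        using elim by (simp add: chain_def grid_floor_def i_def)
      also have "\<dots> \<le> (\<Sum>k=1..N. max 0 (real a' - chain N (1 / real (Suc n)) \<omega> k i))"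
        using a' by (intro sum_mono) auto
      finally show ?case using i \<omega> unfolding bad_def by blast
    qed
    then show False using fr by (simp add: frequently_def)
  qed
  then have "\<exists>\<^sub>F N in sequentially. \<forall>t\<in>{0..T}.
      (\<Sum>k=1..N. max 0 (a - ranked (drive \<omega>) (skorokhod {0..} N (drive \<omega>)) k t)) \<le> real (Suc K)"
    by (intro frequently_elim1[OF K]) blast
  then show "\<exists>K. \<exists>\<^sub>\<infinity>N. \<forall>t\<in>{0..T}.
      (\<Sum>k=1..N. max 0 (a - ranked (drive \<omega>) (skorokhod {0..} N (drive \<omega>)) k t)) \<le> K"
    by (auto simp: cofinite_eq_sequentially)
qed

lemma controlled_AE: "AE \<omega> in M. controlled (drive \<omega>)"
proof -
  have "AE \<omega> in M. \<forall>T a :: nat. T \<ge> 1 \<longrightarrow> (\<exists>K::nat. \<exists>\<^sub>F N in sequentially. \<exists>\<^sub>F n in sequentially.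
        \<omega> \<notin> bad T (real a) N n (real (Suc K)))"
    unfolding AE_all_countable using bad_AE by auto
  then show ?thesis
    using AE_space by eventually_elim (rule controlled_of_not_bad; blast)
qed

end

section \<open>Construction of the approximative version\<close>

text \<open>The set where \<open>X\<close> is below \<open>L\<close> is covered by countably many
  rational intervals on which \<open>L\<close> is flat by \<open>running_sup_flat\<close>; each has
  measure zero.\<close>

lemma running_sup_stieltjes:
  assumes X: "continuous_on {0..} X" and L: "continuous_on {0..} L"
    and eq: "\<And>t. t \<ge> 0 \<Longrightarrow> L t = running_sup {0..} X t"
  shows "(\<integral>\<^sup>+t\<in>{0..}. ennreal (L t - X t) \<partial>interval_measure (\<lambda>t. L (max 0 t))) = 0"
proof -
  let ?\<mu> = "interval_measure (\<lambda>t. L (max 0 t))"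
  have zero_in: "(0::real) \<in> {0..}" by simp
  have mono: "L (max 0 s) \<le> L (max 0 t)" if "s \<le> t" for s t
    using running_sup_mono_time[OF zero_in locally_bounded_continuous[OF X], of "max 0 s" "max 0 t"] that
    by (simp add: eq)
  have "continuous_on UNIV (\<lambda>t. L (max 0 t))"
    by (rule continuous_on_compose2[OF L]) (auto intro!: continuous_intros)
  then have rc: "continuous (at_right a) (\<lambda>t. L (max 0 t))" for a
    by (simp add: continuous_on_eq_continuous_within continuous_at_imp_continuous_at_within)
  \<comment> \<open>The left end \<open>p\<close> may be negative, since the half-open interval must
    contain time 0 if a gap is open there; \<open>max 0 p\<close> confines the condition to
    nonnegative times.\<close>
  define P where "P = {(p, q). p \<in> \<rat> \<and> q \<in> \<rat> \<and> p \<le> q \<and> (\<forall>s. max 0 p \<le> s \<and> s \<le> q \<longrightarrow> X s < L s)}"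
  have "P \<subseteq> \<rat> \<times> \<rat>" by (auto simp: P_def)
  then have cP: "countable P" using countable_rat countable_SIGMA countable_subset by metis
  have null: "{fst r<..snd r} \<in> null_sets ?\<mu>" if rP: "r \<in> P" for r
  proof -
    obtain p q where r: "r = (p, q)" "p \<le> q" "\<And>s. max 0 p \<le> s \<Longrightarrow> s \<le> q \<Longrightarrow> X s < L s"
      using rP by (auto simp: P_def)
    have "L (max 0 q) = L (max 0 p)"
    proof (cases "q \<ge> 0")
      case True
      have "running_sup {0..} X q = running_sup {0..} X (max 0 p)"
        by (rule running_sup_flat[OF X]) (use r True in \<open>auto simp: eq[symmetric]\<close>)
      then show ?thesis using True by (simp add: eq)
    qed (use r in auto)
    then have "emeasure ?\<mu> {p<..q} = 0"
      using emeasure_interval_measure_Ioc[of p q "\<lambda>t. L (max 0 t)"] r(2) mono rc by simp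
    then show ?thesis by (auto simp: r(1))
  qed
  have "(\<Union>r\<in>P. {fst r<..snd r}) \<in> null_sets ?\<mu>" by (intro null_sets_UN' cP null)
  then have "AE t in ?\<mu>. t \<notin> (\<Union>r\<in>P. {fst r<..snd r})" by (rule AE_not_in)
  then have "AE t in ?\<mu>. ennreal (L t - X t) * indicator {0..} t = 0"
  proof eventually_elim
    case (elim t)
    have "\<not> X t < L t" if t0: "t \<ge> 0"
    proof
      assume lt: "X t < L t"
      have "continuous_on {0..} (\<lambda>s. L s - X s)" by (intro continuous_intros X L)
      then obtain d where d: "d > 0" "\<And>s. s \<in> {0..} \<Longrightarrow> dist s t < d \<Longrightarrow> dist (L s - X s) (L t - X t) < L t - X t"
        using lt t0 unfolding continuous_on_iff by (metis atLeast_iff diff_gt_0_iff_gt)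
      obtain p where p: "p \<in> \<rat>" "t - d < p" "p < t" using Rats_dense_in_real[of "t - d" t] d(1) by auto
      obtain q where q: "q \<in> \<rat>" "t < q" "q < t + d" using Rats_dense_in_real[of t "t + d"] d(1) by auto
      have "X s < L s" if "max 0 p \<le> s" "s \<le> q" for s
      proof -
        have "dist s t < d" using that p q by (auto simp: dist_real_def)
        then have "dist (L s - X s) (L t - X t) < L t - X t" using d(2)[of s] that by auto
        then show ?thesis unfolding dist_real_def by linarith
      qed
      then have "(p, q) \<in> P" using p q by (auto simp: P_def)
      then show False using elim p q by force
    qed
    then show ?case by (auto simp: indicator_def ennreal_eq_0_iff)
  qed
  then show ?thesis by (subst nn_integral_cong_AE) auto
qed

context competing_particles begin

text \<open>Reduces finite and infinite systems alike to the fixed point equation: a running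
  supremum is nondecreasing and dominates \<open>push\<close>, which orders the particles by
  \<open>ranked_gap\<close>, and complementarity is \<open>running_sup_stieltjes\<close>.\<close>

lemma ranked_systemI:
  assumes I: "I \<subseteq> {1..}"
    and meas: "\<And>k t. t \<ge> 0 \<Longrightarrow> (\<lambda>\<omega>. L \<omega> k t) \<in> borel_measurable (F t)"
    and cont: "\<And>k \<omega>. \<omega> \<in> space M \<Longrightarrow> continuous_on {0..} (L \<omega> k)"
    and zero: "\<And>k t \<omega>. \<not> (k \<in> I \<and> Suc k \<in> I) \<Longrightarrow> \<omega> \<in> space M \<Longrightarrow> t \<ge> 0 \<Longrightarrow> L \<omega> k t = 0"
    and fixpoint: "AE \<omega> in M. (\<forall>k. L \<omega> k 0 = 0) \<and> (\<forall>k t. k \<in> I \<longrightarrow> Suc k \<in> I \<longrightarrow> t \<ge> 0 \<longrightarrow>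
       L \<omega> k t = running_sup {0..} (push (drive \<omega>) (L \<omega>) k) t)"
  shows "ranked_system M F I g \<sigma> qp qm B y (\<lambda>k t \<omega>. ranked (drive \<omega>) (L \<omega>) k t) (\<lambda>k t \<omega>. L \<omega> k t)"
  unfolding ranked_system_def
proof (intro conjI ballI allI impI)
  show "continuous_adapted M F (\<lambda>t \<omega>. ranked (drive \<omega>) (L \<omega>) k t)" for k
    unfolding continuous_adapted_def
  proof (intro conjI allI impI ballI)
    fix t :: real assume "0 \<le> t"
    note [measurable] = meas[OF this] drive_measurable[OF this]
    show "(\<lambda>\<omega>. ranked (drive \<omega>) (L \<omega>) k t) \<in> borel_measurable (F t)" unfolding ranked_def by measurable
  next
    fix \<omega> assume "\<omega> \<in> space M"
    then show "continuous_on {0..} (\<lambda>t. ranked (drive \<omega>) (L \<omega>) k t)"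
      unfolding ranked_def by (intro continuous_intros cont drive_continuous)
  qed
  show "continuous_adapted M F (\<lambda>t \<omega>. L \<omega> k t)" for k
    unfolding continuous_adapted_def using meas cont by auto
  show "L \<omega> k t = 0" if "\<not> (k \<in> I \<and> Suc k \<in> I)" "0 \<le> t" "\<omega> \<in> space M" for k t \<omega>
    using zero that by blast
  show "AE \<omega> in M.
     (\<forall>k\<in>I. ranked (drive \<omega>) (L \<omega>) k 0 = y k) \<and>
     (\<forall>k\<in>I. \<forall>t\<ge>0. ranked (drive \<omega>) (L \<omega>) k t = ranked (drive \<omega>) (L \<omega>) k 0 + g k * t + \<sigma> k * B k t \<omega>
         + qp k * L \<omega> (k - 1) t - qm k * L \<omega> k t) \<and>
     (\<forall>k. k \<in> I \<and> Suc k \<in> I \<longrightarrow>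
        (\<forall>t\<ge>0. ranked (drive \<omega>) (L \<omega>) k t \<le> ranked (drive \<omega>) (L \<omega>) (Suc k) t) \<and>
        L \<omega> k 0 = 0 \<and> mono_on {0..} (L \<omega> k) \<and>
        (\<integral>\<^sup>+t\<in>{0..}. ennreal (ranked (drive \<omega>) (L \<omega>) (Suc k) t - ranked (drive \<omega>) (L \<omega>) k t)
           \<partial>interval_measure (\<lambda>t. L \<omega> k (max 0 t))) = 0)"
    using fixpoint initial_AE AE_space
  proof eventually_elim
    case (elim \<omega>)
    have start: "ranked (drive \<omega>) (L \<omega>) k 0 = y k" if "k \<in> I" for k
      using elim that I by (auto simp: ranked_def drive_initial)
    have dyn: "ranked (drive \<omega>) (L \<omega>) k t = y k + g k * t + \<sigma> k * B k t \<omega>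
         + qp k * L \<omega> (k - 1) t - qm k * L \<omega> k t" if "k \<in> I" for k t
      using that I by (auto simp: ranked_def drive_def)
    have coll: "(\<forall>t\<ge>0. ranked (drive \<omega>) (L \<omega>) k t \<le> ranked (drive \<omega>) (L \<omega>) (Suc k) t) \<and>
        L \<omega> k 0 = 0 \<and> mono_on {0..} (L \<omega> k) \<and>
        (\<integral>\<^sup>+t\<in>{0..}. ennreal (ranked (drive \<omega>) (L \<omega>) (Suc k) t - ranked (drive \<omega>) (L \<omega>) k t)
           \<partial>interval_measure (\<lambda>t. L \<omega> k (max 0 t))) = 0" if k: "k \<in> I" "Suc k \<in> I" for k
    proof -
      let ?X = "push (drive \<omega>) (L \<omega>) k"
      have k1: "1 \<le> k" using I k by auto
      have fp: "L \<omega> k t = running_sup {0..} ?X t" if "t \<ge> 0" for t using elim k that by blast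
      have X: "continuous_on {0..} ?X"
        unfolding push_def[abs_def] by (intro continuous_intros drive_continuous cont elim)
      note lb = locally_bounded_continuous[OF X]
      have zero_in: "(0::real) \<in> {0..}" by simp
      have gap: "ranked (drive \<omega>) (L \<omega>) (Suc k) t - ranked (drive \<omega>) (L \<omega>) k t = L \<omega> k t - ?X t" for t
        by (rule ranked_gap[OF k1])
      have "?X t \<le> L \<omega> k t" if "t \<ge> 0" for t
        using running_sup_upper[OF zero_in lb, of t t] that fp[OF that] by simp
      then have "\<forall>t\<ge>0. ranked (drive \<omega>) (L \<omega>) k t \<le> ranked (drive \<omega>) (L \<omega>) (Suc k) t"
        using gap by (metis diff_ge_0_iff_ge)
      moreover have "mono_on {0..} (L \<omega> k)"
        using running_sup_mono_time[OF zero_in lb] fp by (auto simp: mono_on_def)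
      moreover have "(\<integral>\<^sup>+t\<in>{0..}. ennreal (L \<omega> k t - ?X t) \<partial>interval_measure (\<lambda>t. L \<omega> k (max 0 t))) = 0"
        by (rule running_sup_stieltjes[OF X cont fp]) (use elim in auto)
      ultimately show ?thesis using elim by (simp add: gap)
    qed
    show ?case using start dyn coll by auto
  qed
qed

definition finite_collisions :: "nat \<Rightarrow> 'a \<Rightarrow> nat \<Rightarrow> real \<Rightarrow> real" where
  "finite_collisions N \<omega> = skorokhod {0..} N (drive \<omega>)"

text \<open>Set to 0 on the exceptional paths, because adapted continuous processes are required to
  be continuous on every path and not just almost surely.\<close>

definition infinite_collisions :: "'a \<Rightarrow> nat \<Rightarrow> real \<Rightarrow> real" where
  "infinite_collisions \<omega> k t = (if controlled (drive \<omega>) then collision_limit (drive \<omega>) k t else 0)"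

lemma drive_initial_sorted:
  "\<forall>k\<ge>1. B k 0 \<omega> = 0 \<Longrightarrow> 1 \<le> k \<Longrightarrow> drive \<omega> k 0 \<le> drive \<omega> (Suc k) 0"
  using y_mono[of k] by (simp add: drive_initial)

lemma finite_system:
  "ranked_system M F {1..N} g \<sigma> qp qm B y (\<lambda>k t \<omega>. ranked (drive \<omega>) (finite_collisions N \<omega>) k t)
     (\<lambda>k t \<omega>. finite_collisions N \<omega> k t)"
proof (rule ranked_systemI)
  have zero_in: "(0::real) \<in> {0..}" by simp
  show "(\<lambda>\<omega>. finite_collisions N \<omega> k t) \<in> borel_measurable (F t)" if "t \<ge> 0" for k t
    unfolding finite_collisions_def by (rule skorokhod_measurable[OF that])
  show "continuous_on {0..} (finite_collisions N \<omega> k)" if "\<omega> \<in> space M" for k \<omega>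
    unfolding finite_collisions_def by (intro skorokhod_continuous drive_continuous that)
  show "finite_collisions N \<omega> k t = 0"
    if "\<not> (k \<in> {1..N} \<and> Suc k \<in> {1..N})" "\<omega> \<in> space M" for k t \<omega>
    unfolding finite_collisions_def
    by (rule skorokhod_outside[OF zero_in drive_locally_bounded[OF that(2)]]) (use that in auto)
  show "AE \<omega> in M. (\<forall>k. finite_collisions N \<omega> k 0 = 0) \<and> (\<forall>k t. k \<in> {1..N} \<longrightarrow> Suc k \<in> {1..N} \<longrightarrow> t \<ge> 0 \<longrightarrow>
       finite_collisions N \<omega> k t = running_sup {0..} (push (drive \<omega>) (finite_collisions N \<omega>) k) t)"
    using initial_AE AE_space
  proof eventually_elim
    case (elim \<omega>)
    note lb = drive_locally_bounded[OF elim(2)]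
    have "skorokhod {0..} N (drive \<omega>) k 0 = 0" for k
      by (rule skorokhod_initial[OF zero_in lb]) (rule drive_initial_sorted[OF elim(1)])
    moreover have "skorokhod {0..} N (drive \<omega>) k t
        = running_sup {0..} (push (drive \<omega>) (skorokhod {0..} N (drive \<omega>)) k) t"
      if "k \<in> {1..N}" "Suc k \<in> {1..N}" "t \<ge> 0" for k t
      by (rule skorokhod_fixpoint[OF zero_in lb]) (use that in auto)
    ultimately show ?case unfolding finite_collisions_def by blast
  qed
qed auto

text \<open>The exceptional set is contained in a null set, so it is measurable by completeness and
  lies in \<open>F 0\<close> by the usual conditions. This keeps the modification on exceptional
  paths adapted.\<close>

lemma controlled_measurable:
  assumes "t \<ge> 0" shows "{\<omega> \<in> space M. controlled (drive \<omega>)} \<in> sets (F t)"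
proof -
  have compl: "complete_measure M" "null_sets M \<subseteq> sets (F 0)"
    using uc unfolding usual_conditions_def by blast+
  interpret complete_measure M by (rule compl)
  let ?N = "{\<omega> \<in> space M. \<not> controlled (drive \<omega>)}"
  obtain Z where Z: "?N \<subseteq> Z" "Z \<in> null_sets M" using controlled_AE by (rule AE_E) auto
  then have "?N \<in> sets M" by (intro complete[of ?N Z])
  then have "?N \<in> null_sets M" using null_sets_subset[OF Z(2) _ Z(1)] by blast
  then have "space (F 0) - ?N \<in> sets (F 0)" using compl(2) by (intro sets.compl_sets) blast
  also have "space (F 0) - ?N = {\<omega> \<in> space M. controlled (drive \<omega>)}" using space_F[of 0] by auto
  finally show ?thesis using usual_conditions_mono[OF uc order_refl assms] by blast
qed

lemma infinite_system:
  "ranked_system M F {1..} g \<sigma> qp qm B y (\<lambda>k t \<omega>. ranked (drive \<omega>) (infinite_collisions \<omega>) k t)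
     (\<lambda>k t \<omega>. infinite_collisions \<omega> k t)"
proof (rule ranked_systemI)
  show "(\<lambda>\<omega>. infinite_collisions \<omega> k t) \<in> borel_measurable (F t)" if t: "t \<ge> 0" for k t
  proof (rule borel_measurable_LIMSEQ_real)
    have "{\<omega> \<in> space (F t). controlled (drive \<omega>)} \<in> sets (F t)"
      using controlled_measurable[OF t] space_F[OF t] by simp
    then show "(\<lambda>\<omega>. if controlled (drive \<omega>) then skorokhod {0..} N (drive \<omega>) k t else 0) \<in> borel_measurable (F t)" for N
      by (intro measurable_If skorokhod_measurable[OF t]) auto
    show "(\<lambda>N. if controlled (drive \<omega>) then skorokhod {0..} N (drive \<omega>) k t else 0)
        \<longlonglongrightarrow> infinite_collisions \<omega> k t" if "\<omega> \<in> space (F t)" for \<omega>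
      using that space_F[OF t] t
      by (auto simp: infinite_collisions_def intro!: collision_limit_tendsto drive_continuous)
  qed
  show "continuous_on {0..} (infinite_collisions \<omega> k)" if "\<omega> \<in> space M" for k \<omega>
    using that collision_limit_continuous[of "drive \<omega>" k] drive_continuous[of \<omega>]
    by (cases "controlled (drive \<omega>)") (simp_all add: infinite_collisions_def[abs_def])
  show "infinite_collisions \<omega> k t = 0" if "\<not> (k \<in> {1..} \<and> Suc k \<in> {1..})" "\<omega> \<in> space M" for k t \<omega>
    using that collision_limit_0[of "drive \<omega>" t] drive_continuous[of \<omega>]
    by (auto simp: infinite_collisions_def not_le)
  show "AE \<omega> in M. (\<forall>k. infinite_collisions \<omega> k 0 = 0) \<and> (\<forall>k t. k \<in> {1..} \<longrightarrow> Suc k \<in> {1..} \<longrightarrow> t \<ge> 0 \<longrightarrow>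
       infinite_collisions \<omega> k t = running_sup {0..} (push (drive \<omega>) (infinite_collisions \<omega>) k) t)"
    using initial_AE controlled_AE AE_space
  proof eventually_elim
    case (elim \<omega>)
    have eq: "infinite_collisions \<omega> = collision_limit (drive \<omega>)"
      using elim by (simp add: infinite_collisions_def fun_eq_iff)
    have "collision_limit (drive \<omega>) k 0 = 0" for k
      by (rule collision_limit_initial[OF drive_continuous[OF elim(3)] elim(2)])
        (rule drive_initial_sorted[OF elim(1)])
    moreover have "collision_limit (drive \<omega>) k t
        = running_sup {0..} (push (drive \<omega>) (collision_limit (drive \<omega>)) k) t"
      if "k \<in> {1..}" "t \<ge> 0" for k t
      by (rule collision_limit_fixpoint[OF drive_continuous[OF elim(3)] elim(2)]) (use that in auto)
    ultimately show ?case unfolding eq by blast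
  qed
qed auto

lemma approximation_AE:
  "AE \<omega> in M. \<forall>k\<ge>1. \<forall>T\<ge>0. uniform_limit {0..T} (\<lambda>N t. ranked (drive \<omega>) (finite_collisions N \<omega>) k t)
     (\<lambda>t. ranked (drive \<omega>) (infinite_collisions \<omega>) k t) sequentially"
  using controlled_AE AE_space
proof eventually_elim
  case (elim \<omega>)
  have eq: "infinite_collisions \<omega> = collision_limit (drive \<omega>)"
    using elim by (simp add: infinite_collisions_def fun_eq_iff)
  show ?case
    unfolding eq finite_collisions_def using ranked_limit_uniform[OF drive_continuous[OF elim(2)] elim(1)] by blast
qed

lemma approximative_version_exists: "\<exists>Y. approximative_version M F g \<sigma> qp qm B y Y"
  unfolding approximative_version_def
  by (intro exI conjI allI impI, rule finite_system, rule approximation_AE, rule infinite_system)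

end

theorem theorem3p7:
  fixes M :: "'a measure" and F :: "real \<Rightarrow> 'a measure"
    and g \<sigma> qp qm y :: "nat \<Rightarrow> real"
    and B :: "nat \<Rightarrow> real \<Rightarrow> 'a \<Rightarrow> real"
  assumes "usual_conditions M F"
    and "\<And>n. n \<ge> 1 \<Longrightarrow> \<sigma> n > 0"
    and "\<And>n. n \<ge> 1 \<Longrightarrow> qp (n + 1) + qm n = 1"
    and "\<And>n. n \<ge> 1 \<Longrightarrow> 0 < qp n \<and> qp n < 1 \<and> 0 < qm n \<and> qm n < 1"
    and "\<And>n. n \<ge> 1 \<Longrightarrow> y n \<le> y (n + 1)"
    and "\<And>\<alpha>. \<alpha> > 0 \<Longrightarrow> summable (\<lambda>n. exp (- \<alpha> * (y (Suc n))\<^sup>2))"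
    and "bdd_below (g ` {1..})"
    and "bdd_above ((\<lambda>n. (\<sigma> n)\<^sup>2) ` {1..})"
    and "\<exists>n0\<ge>1. \<forall>n\<ge>n0. qp n \<ge> 1 / 2"
    and "iid_brownian_motions M F B"
  shows "\<exists>Y. approximative_version M F g \<sigma> qp qm B y Y"
proof -
  interpret collision qp qm using assms(3,4) by unfold_locales auto
  obtain w C where w: "\<And>k. k \<ge> 1 \<Longrightarrow> 1 \<le> w k \<and> w k \<le> C \<and> w k * qm k \<le> w (Suc k) * qp (Suc k)"
    using collision_weights[OF assms(9)] assms(4) by (metis less_imp_le)
  obtain c' where c': "\<And>k. k \<ge> 1 \<Longrightarrow> c' \<le> g k" using assms(7) by (auto simp: bdd_below_def)
  obtain v where v: "\<And>k. k \<ge> 1 \<Longrightarrow> (\<sigma> k)\<^sup>2 \<le> v" using assms(8) by (auto simp: bdd_above_def)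
  have "0 < (\<sigma> 1)\<^sup>2" using assms(2)[of 1] by simp
  then have "0 < v" using v[of 1] by linarith
  \<comment> \<open>Capping the drift bound at 0 ensures that smoothing never lowers a cost;
    \<open>sqrt v\<close> is a common bound of all \<open>\<sigma> k\<close>.\<close>
  interpret competing_particles qp qm M F g \<sigma> y B "min 0 c'" "sqrt v" w C
  proof unfold_locales
    show "standard_brownian_motion M F (B k)" if "k \<ge> 1" for k
      using assms(10) that by (simp add: iid_brownian_motions_def)
    show "0 \<le> \<sigma> k \<and> \<sigma> k \<le> sqrt v" if "k \<ge> 1" for k
      using assms(2)[OF that] v[OF that] by (auto intro: real_le_rsqrt)
    show "min 0 c' \<le> g k" if "k \<ge> 1" for k using c'[OF that] by linarith
  qed (use assms(1,5,6) w \<open>0 < v\<close> in auto)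
  show ?thesis by (rule approximative_version_exists)
qed

end
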